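(* Let $n \geq 2$. For each $k \in \mathbb{N}$, let $R_k^{\mathcal{N}}$ denote any $n$-dimensional unit-measure cuboid which maximises $\mu_k$ among all $n$-dimensional unit-measure cuboids, and let $a_{1,k}^* \leq \dots \leq a_{n,k}^*$ be its side-lengths. Then, for any admissible exponent $\theta_n$ (as defined in the context), as $k \to \infty$, $$a_{n,k}^* = 1 + O\bigl(k^{(\theta_n-(n-1))/(2n)}\bigr).$$ That is, any sequence of maximising $n$-dimensional cuboids $(R_k^{\mathcal{N}})_k$ for $\mu_k$ converges to the $n$-dimensional unit cube as $k \to \infty$ (all side-lengths $a_{i,k}^*$ tend to $1$).
   Context: $\mathbb{N}=\{1,2,\dots\}$. An $n$-dimensional unit-measure cuboid is a domain $R=\prod_{i=1}^n (0,a_i)\subset\mathbb{R}^n$ with $a_i>0$, $\prod_{i=1}^n a_i=1$, with side-lengths labelled so that $a_1\le\dots\le a_n$. $0=\mu_0(R)\le\mu_1(R)\le\mu_2(R)\le\dots$ are the eigenvalues of the Neumann Laplacian on $R$, repeated according to multiplicity and indexed from $0$; they are the numbers $\sum_{j=1}^n \pi^2 i_j^2/a_j^2$ with $i_1,\dots,i_n$ non-negative integers, listed in non-decreasing order. For every $k\in\mathbb{N}$ a unit-measure cuboid maximising $\mu_k$ exists (it need not be unique). Admissible exponent: $\theta_n$ denotes any exponent such that for all $a_1,\dots,a_n>0$, $$\#\{z\in\mathbb{Z}^n: a_1^{-2}z_1^2+\dots+a_n^{-2}z_n^2\le t^2\}-\omega_n t^n\prod_{i=1}^n a_i = O(t^{\theta_n}),\quad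 t\to\infty,$$ uniformly for $a_1,\dots,a_n$ in compact subsets of $(0,\infty)$, where $\omega_n$ is the volume of the unit ball in $\mathbb{R}^n$. It is known that for every $n\ge2$ there are admissible exponents with $\theta_n<n-1$. *)

theory Defs
  imports
    "HOL-Analysis.Analysis"
    "HOL-Library.Landau_Symbols"
    "HOL-Library.FuncSet"
begin

text \<open>
  The cuboid \<open>(0, a 1) \<times> \<dots> \<times> (0, a n)\<close> is represented by the function \<open>a\<close> of its side-lengths, of
  which only the values on \<open>{1..n}\<close> matter.
\<close>

definition unit_cuboid :: "nat \<Rightarrow> (nat \<Rightarrow> real) \<Rightarrow> bool" where
  "unit_cuboid n a \<longleftrightarrow>
     (\<forall>i\<in>{1..n}. 0 < a i) \<and> mono_on {1..n} a \<and> (\<Prod>i=1..n. a i) = 1"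

text \<open>
  Multi-indices are extensional functions, so that each tuple of non-negative integers is counted
  exactly once. The eigenvalue belonging to \<open>m\<close> is the one of the Neumann eigenfunction
  \<open>\<Prod>j. cos (pi * m j * x j / a j)\<close>; these eigenfunctions are complete.
\<close>

definition multi_indices :: "nat \<Rightarrow> (nat \<Rightarrow> nat) set" where
  "multi_indices n = {1..n} \<rightarrow>\<^sub>E UNIV"

definition neumann_eigenvalue :: "nat \<Rightarrow> (nat \<Rightarrow> real) \<Rightarrow> (nat \<Rightarrow> nat) \<Rightarrow> real" where
  "neumann_eigenvalue n a m = (\<Sum>j=1..n. pi\<^sup>2 * (real (m j))\<^sup>2 / (a j)\<^sup>2)"

text \<open>
  The bijection \<open>e\<close> lists every multi-index once, hence every eigenvalue as often as its
  multiplicity. For positive side-lengths and \<open>n \<ge> 1\<close> only finitely many multi-indices have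
  eigenvalue below a given bound, so exactly one monotone listing \<open>\<mu>\<close> exists.
\<close>

definition neumann_mu :: "nat \<Rightarrow> (nat \<Rightarrow> real) \<Rightarrow> nat \<Rightarrow> real" where
  "neumann_mu n a =
     (THE \<mu>. mono \<mu> \<and>
        (\<exists>e. bij_betw e UNIV (multi_indices n) \<and> (\<forall>k. \<mu> k = neumann_eigenvalue n a (e k))))"

definition maximises_mu :: "nat \<Rightarrow> nat \<Rightarrow> (nat \<Rightarrow> real) \<Rightarrow> bool" where
  "maximises_mu n k a \<longleftrightarrow>
     unit_cuboid n a \<and> (\<forall>b. unit_cuboid n b \<longrightarrow> neumann_mu n b k \<le> neumann_mu n a k)"

definition lattice_count :: "nat \<Rightarrow> (nat \<Rightarrow> real) \<Rightarrow> real \<Rightarrow> nat" where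
  "lattice_count n a t =
     card {z \<in> {1..n} \<rightarrow>\<^sub>E (UNIV :: int set). (\<Sum>i=1..n. (real_of_int (z i))\<^sup>2 / (a i)\<^sup>2) \<le> t\<^sup>2}"

text \<open>
  The bound \<open>C\<close> and the threshold for \<open>t\<close> depend only on the compact set \<open>K\<close>. The side-lengths
  \<open>a\<close> are not required to be ordered or to have product 1.
\<close>

definition admissible_exponent :: "nat \<Rightarrow> real \<Rightarrow> bool" where
  "admissible_exponent n \<theta> \<longleftrightarrow>
     (\<forall>K :: real set. compact K \<and> K \<subseteq> {0<..} \<longrightarrow>
        (\<exists>C. \<forall>\<^sub>F t in at_top. \<forall>a. (\<forall>i\<in>{1..n}. a i \<in> K) \<longrightarrow>
           \<bar>real (lattice_count n a t) - unit_ball_vol (real n) * t ^ n * (\<Prod>i=1..n. a i)\<bar>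
             \<le> C * t powr \<theta>))"

end

theory Submission
  imports Defs "HOL-Number_Theory.Cong"
begin

text \<open>
  Let \<open>pi^2 t^2\<close> be the \<open>k\<close>-th eigenvalue of the unit cube. A maximiser has at most \<open>k\<close> eigenvalues
  below this level, whereas the cube has more than \<open>k\<close> up to it. The counting function of a cuboid
  counts lattice points in an orthant of an ellipsoid, and its expansion is \<open>2^-n\<close> times
  \<open>w_n t^n + w_(n-1) t^(n-1) (\<Sum>i. 1 / a i)\<close> plus an error, where \<open>w_d\<close> is the volume of the unit
  ball of dimension \<open>d\<close>. Comparing the two expansions shows that \<open>\<Sum>i. 1 / a i\<close> exceeds its
  minimum \<open>n\<close> by at most the relative error, and since this minimum is nondegenerate, \<open>a n - 1\<close> is
  at most of the order of the square root of that.

  The comparison requires the sides to stay in a compact set; this follows from a lower bound for the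
  count whose second term is \<open>c t^(n-1) / a 1\<close>, uniformly in all cuboids. An admissible exponent gives
  the rate. Convergence without a given admissible exponent below \<open>n - 1\<close> only needs the lattice
  point error \<open>o(t^(n-1))\<close>. By slicing and induction on the dimension, this reduces to ellipses in the
  plane, where the sawtooth sum along the boundary is shown to be small with Dirichlet's approximation
  theorem.
\<close>

section \<open>Sawtooth sums along a curve\<close>

text \<open>The second term comes from the faces of the orthant. A lattice point with a vanishing
  coordinate lies in several orthants, so 2^n times the orthant count exceeds the full count by the
  lattice points on the coordinate hyperplanes; for sides of product 1 the section without
  coordinate i has volume w_(n-1) t^(n-1) / a i. The volume terms of maximiser and cube cancel,
  leaving the sums of reciprocals. As t is at least of order k^(1/n), the relative error t^(\<theta>
  - (n - 1)) yields under the square root the exponent of the statement.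

  Two obstacles shape the analysis. At the end of a slicing direction the profile of the ball may
  have infinite slope, so the trapezoidal rule and all slope bounds are used on a slightly shorter
  range, and the rest is estimated by monotonicity or by its length. In the plane the remaining
  error is a sawtooth sum; there curvature makes the slope of the arc pass every rational of small
  denominator quickly, so few starting points are bad.\<close>

text \<open>
  If \<open>y\<close> is nearly an arithmetic progression with step \<open>p / q\<close>, its values are nearly equidistributed
  modulo 1, so all but boundedly many summands agree with \<open>r / q - 1/2\<close> for a permutation \<open>r\<close>.
\<close>
lemma sawtooth_complete_residues:
  fixes y :: "nat \<Rightarrow> real" and \<alpha> :: real and p :: int and q :: nat
  assumes "0 < q" "coprime p (int q)"
    and close: "\<And>j. j < q \<Longrightarrow> real q * \<bar>y j - (\<alpha> + real j * real_of_int p / real q)\<bar> \<le> 2"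
  shows "\<bar>\<Sum>j<q. (frac (y j) - 1/2)\<bar> \<le> 9"
proof -
  \<comment> \<open>Position of the j-th point on the grid of multiples of 1/q, after rounding q
    \<alpha> down. Coprimality makes it a permutation of the residues, so sums over
    \<open>r j\<close> do not depend on \<alpha> or p.\<close>
  define r where "r j = nat ((\<lfloor>real q * \<alpha>\<rfloor> + int j * p) mod int q)" for j
  have r_less: "r j < q" for j
    using assms(1) by (simp add: r_def nat_less_iff)
  have "inj_on r {..<q}"
  proof (rule inj_onI)
    fix i j assume ij: "i \<in> {..<q}" "j \<in> {..<q}" "r i = r j"
    then have "[\<lfloor>real q * \<alpha>\<rfloor> + int i * p = \<lfloor>real q * \<alpha>\<rfloor> + int j * p] (mod int q)"
      using assms(1) by (simp add: r_def unique_euclidean_semiring_class.cong_def nat_eq_iff)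
    then have "[int i * p = int j * p] (mod int q)"
      by (simp add: cong_add_lcancel)
    then have "[int i = int j] (mod int q)"
      using assms(2) by (simp add: cong_mult_rcancel)
    then show "i = j"
      using ij by (simp add: cong_int_iff cong_less_modulus_unique_nat)
  qed
  moreover have "r ` {..<q} \<subseteq> {..<q}"
    using r_less by auto
  ultimately have bij: "bij_betw r {..<q} {..<q}"
    by (simp add: bij_betw_def endo_inj_surj)
  have reindex: "(\<Sum>j<q. h (r j)) = (\<Sum>j<q. h j)" for h :: "nat \<Rightarrow> real"
    using sum.reindex_bij_betw[OF bij] .
  \<comment> \<open>Rounding and the deviation in \<open>close\<close> displace
    \<open>q * y j\<close> by at least -2 and less than 3 from an integer of residue
    \<open>r j\<close>. Outside the residues 0, 1, q-3, q-2, q-1 this cannot cross a multiple of q;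
    on them the trivial bound 1 is used. The total is 5 + 3 = 8, and (q-1)/2 against q/2 adds
    1/2.\<close>
  define E where "E = (\<lambda>j. if j < 2 \<or> q < j + 4 then 1 else 3 / real q)"
  have dev: "\<bar>frac (y j) - real (r j) / real q\<bar> \<le> E (r j)" if "j < q" for j
  proof (cases "r j < 2 \<or> q < r j + 4")
    case True
    have "0 \<le> real (r j) / real q" "real (r j) / real q \<le> 1"
      using r_less[of j] by (simp_all add: divide_simps)
    then have "\<bar>frac (y j) - real (r j) / real q\<bar> \<le> 1"
      using frac_ge_0[of "y j"] frac_lt_1[of "y j"] by linarith
    then show ?thesis using True by (simp add: E_def)
  next
    case False
    define A where "A = \<lfloor>real q * \<alpha>\<rfloor> + int j * p"
    define u where "u = real q * y j - real_of_int A"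
    have ueq: "u = frac (real q * \<alpha>) + real q * (y j - (\<alpha> + real j * real_of_int p / real q))"
      using assms(1) by (simp add: u_def A_def frac_def field_simps)
    have ub: "\<bar>real q * (y j - (\<alpha> + real j * real_of_int p / real q))\<bar> \<le> 2"
      using close[OF that] by (simp add: abs_mult)
    have u: "-2 \<le> u" "u \<le> 3"
      using ueq ub frac_ge_0[of "real q * \<alpha>"] frac_lt_1[of "real q * \<alpha>"] by linarith+
    have u3: "u < 3"
      using ueq ub frac_lt_1[of "real q * \<alpha>"] by linarith
    have rA: "int (r j) = A mod int q"
      using assms(1) by (simp add: r_def A_def)
    have A: "A = int q * (A div int q) + int (r j)"
      unfolding rA by simp
    have "real_of_int A = real q * real_of_int (A div int q) + real (r j)"
      by (subst A) (simp only: of_int_add of_int_mult of_int_of_nat_eq)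
    then have yj: "y j = real_of_int (A div int q) + (real (r j) + u) / real q"
      using assms(1) by (simp add: u_def field_simps)
    have "0 \<le> real (r j) + u" "real (r j) + u < real q"
      using False u u3 by auto
    then have "frac (y j) = (real (r j) + u) / real q"
      using yj assms(1) by (subst frac_unique_iff) auto
    then have "frac (y j) - real (r j) / real q = u / real q"
      by (simp add: add_divide_distrib)
    moreover have "\<bar>u / real q\<bar> \<le> 3 / real q"
      using u by (auto simp: abs_divide intro!: divide_right_mono)
    ultimately show ?thesis
      using False by (simp add: E_def)
  qed
  have "(\<Sum>j<q. E (r j)) \<le> 8"
  proof -
    have "(\<Sum>j<q. E (r j)) = (\<Sum>j<q. E j)"
      by (rule reindex)
    also have "\<dots> \<le> (\<Sum>j<q. (if j \<in> {0, 1, q - 1, q - 2, q - 3} then 1 else 0) + 3 / real q)"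
      by (intro sum_mono) (auto simp: E_def)
    also have "\<dots> = real (card ({..<q} \<inter> {0, 1, q - 1, q - 2, q - 3})) + 3"
      using assms(1) by (simp add: sum.distrib sum.If_cases Int_def)
    also have "card ({..<q} \<inter> {0, 1, q - 1, q - 2, q - 3}) \<le> card {0, 1, q - 1, q - 2, q - 3}"
      by (intro card_mono) auto
    also have "card {0, 1, q - 1, q - 2, q - 3} \<le> 5"
      by (auto simp: card_insert_if)
    finally show ?thesis by simp
  qed
  moreover have "\<bar>(\<Sum>j<q. frac (y j)) - (\<Sum>j<q. real (r j) / real q)\<bar> \<le> (\<Sum>j<q. E (r j))"
    unfolding sum_subtractf[symmetric]
    by (rule order.trans[OF sum_abs sum_mono]) (use dev in auto)
  moreover have "(\<Sum>j<q. real (r j) / real q) = (real q - 1) / 2"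
  proof -
    have "(\<Sum>j<q. real j) = real q * (real q - 1) / 2"
      by (induction q) (simp_all add: field_simps)
    then show ?thesis
      using assms(1) reindex[of "\<lambda>j. real j / real q"] by (simp add: sum_divide_distrib[symmetric])
  qed
  moreover have "(\<Sum>j<q. (frac (y j) - 1/2)) = (\<Sum>j<q. frac (y j)) - real q / 2"
    by (simp add: sum_subtractf)
  moreover have "\<bar>x - real q / 2\<bar> \<le> 9"
    if "e \<le> 8" "\<bar>x - z\<bar> \<le> e" "z = (real q - 1) / 2" for x z e :: real
    using that by argo
  ultimately show ?thesis
    by metis
qed

text \<open>
  Starting from a point \<open>x\<close> that is not bad, Dirichlet approximation of the slope \<open>g x\<close> gives a block of
  length between \<open>Q\<close> and \<open>M\<close> whose sawtooth sum is at most 9; bad points are skipped one at a time.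
\<close>
lemma sawtooth_sum_blocks:
  fixes f g :: "nat \<Rightarrow> real" and M Q N :: nat and C t :: real
  defines "bad \<equiv> (\<lambda>x. \<exists>q p :: int. 0 < q \<and> q < int Q \<and> \<bar>of_int q * g x - of_int p\<bar> < 1 / real M)"
  assumes "0 < M" "0 < Q" "0 < t" "C * real M ^ 3 \<le> t" "0 \<le> C"
    and lin: "\<And>x j. x + j < N \<Longrightarrow> \<bar>f (x + j) - f x - real j * g x\<bar> \<le> C * (real j)\<^sup>2 / t"
  shows "v \<le> N \<Longrightarrow> u \<le> v \<Longrightarrow> \<bar>\<Sum>x=u..<v. (frac (f x) - 1/2)\<bar>
           \<le> 9 / real Q * real (v - u) + real (card {x \<in> {u..<v}. bad x}) + real M"
proof (induction "v - u" arbitrary: u rule: less_induct)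
  case less
  have triv: "\<bar>frac z - 1/2\<bar> \<le> (1::real)" for z :: real
    using frac_ge_0[of z] frac_lt_1[of z] by linarith
  show ?case
  \<comment> \<open>A last stretch of length at most M is bounded trivially; this cost is paid only
    once.\<close>
  proof (cases "v - u \<le> M")
    case True
    have "\<bar>\<Sum>x=u..<v. (frac (f x) - 1/2)\<bar> \<le> (\<Sum>x=u..<v. 1)"
      by (rule order.trans[OF sum_abs sum_mono]) (rule triv)
    also have "\<dots> \<le> real M" using True by simp
    finally show ?thesis
      by (smt (verit, best) divide_nonneg_nonneg mult_nonneg_nonneg of_nat_0_le_iff)
  next
    case False
    \<comment> \<open>Each block is charged to its length at rate 9 / Q or to its bad points, so the
      recursion accumulates no fixed cost per block.\<close>
    have step: ?thesis
      if "0 < q" "q \<le> M" "\<bar>\<Sum>x=u..<u+q. (frac (f x) - 1/2)\<bar>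
            \<le> 9 / real Q * real q + real (card {x \<in> {u..<u+q}. bad x})" for q
    proof -
      have le: "u + q \<le> v" using that False by linarith
      have split: "{u..<v} = {u..<u+q} \<union> {u+q..<v}" using le by auto
      have "(\<Sum>x=u..<v. (frac (f x) - 1/2)) = (\<Sum>x=u..<u+q. (frac (f x) - 1/2)) + (\<Sum>x=u+q..<v. (frac (f x) - 1/2))"
        using le by (simp add: sum.atLeastLessThan_concat)
      moreover have "card {x \<in> {u..<v}. bad x} = card {x \<in> {u..<u+q}. bad x} + card {x \<in> {u+q..<v}. bad x}"
        by (subst card_Un_disjoint[symmetric]) (use split in \<open>auto intro!: arg_cong[where f = card]\<close>)
      moreover have "\<bar>\<Sum>x=u+q..<v. (frac (f x) - 1/2)\<bar>
           \<le> 9 / real Q * real (v - (u + q)) + real (card {x \<in> {u+q..<v}. bad x}) + real M"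
        using less.hyps[of "u + q"] that le less.prems by simp
      moreover have "9 / real Q * real (v - u) = 9 / real Q * real q + 9 / real Q * real (v - (u + q))"
      proof -
        have "real (v - u) = real q + real (v - (u + q))" using le by linarith
        then show ?thesis by (simp only: distrib_left)
      qed
      ultimately show ?thesis
        using that(3) by linarith
    qed
    show ?thesis
    proof (cases "bad u")
      case True
      have "{x \<in> {u..<u+1}. bad x} = {u}" using True by auto
      then show ?thesis
        using triv[of "f u"] \<open>0 < M\<close> by (intro step[of 1]) (auto intro: order.trans[of _ 1])
    next
      case gd: False
      obtain h k where hk: "coprime h k" "0 < k" "k \<le> int M" "\<bar>of_int k * g u - of_int h\<bar> < 1 / real M"
        using Dirichlet_approx_coprime[of M "g u"] \<open>0 < M\<close> by (metis)
      \<comment> \<open>A denominator below Q would make u bad. Hence the bound 9 for the block is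
        at most 9 / Q times its length.\<close>
      have "int Q \<le> k" using gd hk unfolding bad_def by (meson not_le)
      define q where "q = nat k"
      have q: "0 < q" "q \<le> M" "k = int q" "Q \<le> q" using hk \<open>int Q \<le> k\<close> by (auto simp: q_def)
      have "\<bar>\<Sum>j<q. (frac (f (u + j)) - 1/2)\<bar> \<le> 9"
      proof (rule sawtooth_complete_residues[where p = h and \<alpha> = "f u"])
        fix j assume j: "j < q"
        have "u + j < N" using j q False less.prems by linarith
        \<comment> \<open>The cubic condition on M enters here: the curvature shifts the j-th value
          by at most C j^2 / t, and q times this shift must stay below 1 for all j < q \<le>
          M.\<close>
        have 1: "real q * \<bar>f (u + j) - f u - real j * g u\<bar> \<le> 1"
        proof -
          have "real q * \<bar>f (u + j) - f u - real j * g u\<bar> \<le> real q * (C * (real j)\<^sup>2 / t)"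
            by (intro mult_left_mono lin \<open>u + j < N\<close>) auto
          also have "\<dots> \<le> real M * (C * (real M)\<^sup>2 / t)"
            using j q \<open>0 < t\<close> \<open>0 \<le> C\<close> by (intro mult_mono divide_right_mono power_mono) auto
          also have "\<dots> = C * real M ^ 3 / t" by (simp add: power3_eq_cube power2_eq_square)
          also have "\<dots> \<le> 1" using assms by simp
          finally show ?thesis .
        qed
        have 2: "real q * \<bar>real j * g u - real j * real_of_int h / real q\<bar> \<le> 1"
        proof -
          have "real q * \<bar>real j * g u - real j * real_of_int h / real q\<bar>
                = \<bar>real q * (real j * g u - real j * real_of_int h / real q)\<bar>"
            by (simp add: abs_mult)
          also have "real q * (real j * g u - real j * real_of_int h / real q) = real j * (of_int k * g u - of_int h)"
            using q by (simp add: field_simps)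
          also have "\<bar>\<dots>\<bar> \<le> real M * (1 / real M)"
            unfolding abs_mult using hk j q by (intro mult_mono) auto
          finally show ?thesis using \<open>0 < M\<close> by simp
        qed
        have "\<bar>f (u + j) - (f u + real j * real_of_int h / real q)\<bar>
              \<le> \<bar>f (u + j) - f u - real j * g u\<bar> + \<bar>real j * g u - real j * real_of_int h / real q\<bar>"
          using abs_triangle_ineq[of "f (u + j) - f u - real j * g u" "real j * g u - real j * real_of_int h / real q"]
          by (simp add: algebra_simps)
        then have "real q * \<bar>f (u + j) - (f u + real j * real_of_int h / real q)\<bar>
          \<le> real q * (\<bar>f (u + j) - f u - real j * g u\<bar> + \<bar>real j * g u - real j * real_of_int h / real q\<bar>)"
          by (rule mult_left_mono) auto
        then show "real q * \<bar>f (u + j) - (f u + real j * real_of_int h / real q)\<bar> \<le> 2"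
          using 1 2 by (simp add: distrib_left)
      qed (use hk q in auto)
      moreover have "(\<Sum>x=u..<u+q. (frac (f x) - 1/2)) = (\<Sum>j<q. (frac (f (u + j)) - 1/2))"
        by (rule sum.reindex_bij_witness[of _ "\<lambda>j. u + j" "\<lambda>x. x - u"]) auto
      moreover have "9 \<le> 9 / real Q * real q" using q \<open>0 < Q\<close> by (simp add: field_simps)
      ultimately show ?thesis
        using q by (intro step[of q]) auto
    qed
  qed
qed

section \<open>Points where the slope is nearly rational\<close>

lemma card_nat_le_of_diameter:
  fixes S :: "nat set" and D :: real
  assumes "\<And>x y. x \<in> S \<Longrightarrow> y \<in> S \<Longrightarrow> x < y \<Longrightarrow> real y - real x \<le> D" "0 \<le> D"
  shows "real (card S) \<le> D + 1"
proof (cases "S = {}")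
  case False
  define m where "m = (LEAST x. x \<in> S)"
  have m: "m \<in> S" "\<And>x. x \<in> S \<Longrightarrow> m \<le> x"
    using False by (auto simp: m_def intro: LeastI Least_le)
  have "S \<subseteq> {m..m + nat \<lfloor>D\<rfloor>}"
  proof
    fix x assume "x \<in> S"
    then have "real x - real m \<le> D"
      using assms m by (metis cancel_comm_monoid_add_class.diff_cancel le_neq_implies_less)
    then show "x \<in> {m..m + nat \<lfloor>D\<rfloor>}"
      using m(2)[OF \<open>x \<in> S\<close>] assms(2) by (simp add: le_nat_floor nat_le_iff le_floor_iff flip: le_diff_conv2) (use le_nat_floor[of "x - m" D] in \<open>simp add: of_nat_diff\<close>)
  qed
  then have "card S \<le> card {m..m + nat \<lfloor>D\<rfloor>}" by (intro card_mono) auto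
  then have "card S \<le> nat \<lfloor>D\<rfloor> + 1" by simp
  then show ?thesis using assms(2) by linarith
qed (use assms in simp)

text \<open>The slope decreases at rate at least c / t, so q times the slope is within 1 / M of a
  fixed p only on a stretch of length at most 2 t / (c M). The bound on g leaves at most
  \<open>2 * B * Q + 3\<close> numerators for each of at most Q denominators.\<close>

lemma card_near_rational_slope:
  fixes g :: "nat \<Rightarrow> real" and M Q N B :: nat and c t :: real
  assumes "0 < M" "0 < t" "0 < c"
    and bd: "\<And>x. x < N \<Longrightarrow> \<bar>g x\<bar> \<le> real B"
    and sep: "\<And>x y. x < y \<Longrightarrow> y < N \<Longrightarrow> c * (real y - real x) / t \<le> g x - g y"
  shows "real (card {x. x < N \<and> (\<exists>q p :: int. 0 < q \<and> q < int Q \<and> \<bar>of_int q * g x - of_int p\<bar> < 1 / real M)})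
          \<le> real (Q * (2 * B * Q + 3)) * (2 * t / (c * real M) + 1)"
proof -
  define P where "P = {1..int Q} \<times> {- int (B * Q + 1)..int (B * Q + 1)}"
  define S where "S = (\<lambda>(q, p). {x. x < N \<and> \<bar>of_int q * g x - of_int p\<bar> < 1 / real M})"
  have cS: "real (card (S qp)) \<le> 2 * t / (c * real M) + 1" if "qp \<in> P" for qp
  proof -
    obtain q p where qp: "qp = (q, p)" by force
    have "1 \<le> q" using that qp by (auto simp: P_def)
    show ?thesis
    proof (rule card_nat_le_of_diameter)
      fix x y assume xy: "x \<in> S qp" "y \<in> S qp" "x < y"
      have "of_int q * (g x - g y) \<le> 2 / real M"
        using xy by (auto simp: S_def qp right_diff_distrib abs_less_iff)
      moreover have "c * (real y - real x) / t \<le> g x - g y"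
        using sep xy by (auto simp: S_def qp)
      moreover have "0 \<le> g x - g y"
        by (rule order.trans[OF _ calculation(2)]) (use assms xy in auto)
      then have "1 * (g x - g y) \<le> of_int q * (g x - g y)"
        using \<open>1 \<le> q\<close> by (intro mult_right_mono) auto
      ultimately have "c * (real y - real x) / t \<le> 2 / real M" by simp
      then show "real y - real x \<le> 2 * t / (c * real M)"
        using assms by (simp add: field_simps)
    qed (use assms in auto)
  qed
  have sub: "{x. x < N \<and> (\<exists>q p :: int. 0 < q \<and> q < int Q \<and> \<bar>of_int q * g x - of_int p\<bar> < 1 / real M)} \<subseteq> (\<Union>qp\<in>P. S qp)"
  proof safe
    fix x and q p :: int
    assume x: "x < N" "0 < q" "q < int Q" "\<bar>of_int q * g x - of_int p\<bar> < 1 / real M"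
    have "1 / real M \<le> 1" using \<open>0 < M\<close> by simp
    moreover have "\<bar>of_int q * g x\<bar> \<le> real Q * real B"
      unfolding abs_mult using x bd by (intro mult_mono) auto
    ultimately have "\<bar>real_of_int p\<bar> < real (B * Q + 1)"
      using x(4) by (simp add: mult.commute)
    then have "\<bar>p\<bar> < int (B * Q + 1)"
      by (metis of_int_abs of_int_less_iff of_int_of_nat_eq)
    then have "(q, p) \<in> P" using x by (auto simp: P_def)
    then show "x \<in> (\<Union>qp\<in>P. S qp)"
      using x by (intro UN_I[of "(q, p)"]) (auto simp: S_def)
  qed
  have "finite P" by (simp add: P_def)
  have "finite (S qp)" for qp by (cases qp) (auto simp: S_def)
  have "card {x. x < N \<and> (\<exists>q p :: int. 0 < q \<and> q < int Q \<and> \<bar>of_int q * g x - of_int p\<bar> < 1 / real M)} \<le> card (\<Union>qp\<in>P. S qp)"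
    using sub \<open>finite P\<close> \<open>\<And>qp. finite (S qp)\<close> by (intro card_mono) auto
  also have "\<dots> \<le> (\<Sum>qp\<in>P. card (S qp))"
    using \<open>finite P\<close> by (rule card_UN_le)
  finally have "real (card {x. x < N \<and> (\<exists>q p :: int. 0 < q \<and> q < int Q \<and> \<bar>of_int q * g x - of_int p\<bar> < 1 / real M)}) \<le> (\<Sum>qp\<in>P. real (card (S qp)))"
    by (simp flip: of_nat_sum)
  also have "\<dots> \<le> (\<Sum>qp\<in>P. 2 * t / (c * real M) + 1)" by (intro sum_mono cS)
  also have "\<dots> = real (Q * (2 * B * Q + 3)) * (2 * t / (c * real M) + 1)"
  proof -
    have "card {- int m..int m} = 2 * m + 1" for m
      by (simp add: nat_eq_iff)
    then have "card P = Q * (2 * (B * Q + 1) + 1)"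
      unfolding P_def card_cartesian_product by (simp only: card_atLeastAtMost_int) simp
    then show ?thesis by (simp add: algebra_simps)
  qed
  finally show ?thesis .
qed


text \<open>The hypotheses express curvature of order 1 / t, bounded below through c and above
  through C. In the block estimate, Q makes the cost per length small, M (depending on Q) makes bad
  points rare, and T (depending on both) absorbs the fixed terms and ensures the cubic condition.
  Each contribution gets a third of \<open>\<epsilon> * t\<close>, whence the constants 27 and
  6.\<close>

lemma sawtooth_sum_small:
  fixes B C c \<epsilon> :: real
  assumes "0 < c" "0 \<le> C" "0 < \<epsilon>"
  obtains T where "0 < T"
    "\<And>t f g N. \<lbrakk>T \<le> t; real N \<le> C * t;
       \<And>x. x < N \<Longrightarrow> \<bar>g x\<bar> \<le> B;
       \<And>x y. x < y \<Longrightarrow> y < N \<Longrightarrow> c * (real y - real x) / t \<le> g x - g y;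
       \<And>x j. x + j < N \<Longrightarrow> \<bar>f (x + j) - f x - real j * g x\<bar> \<le> C * (real j)\<^sup>2 / t\<rbrakk>
     \<Longrightarrow> \<bar>\<Sum>x<N. (frac (f x) - 1/2)\<bar> \<le> \<epsilon> * t"
proof -
  define b where "b = nat \<lceil>B\<rceil>"
  obtain Q :: nat where Q: "0 < Q" "27 * C / \<epsilon> \<le> real Q"
    using real_arch_simple[of "max 1 (27 * C / \<epsilon>)"] by (metis gr0I max.bounded_iff not_one_le_zero of_nat_0)
  define k where "k = real (Q * (2 * b * Q + 3))"
  have "0 \<le> k" by (simp add: k_def)
  obtain M :: nat where M: "0 < M" "6 * k / (c * \<epsilon>) \<le> real M"
    using real_arch_simple[of "max 1 (6 * k / (c * \<epsilon>))"] by (metis gr0I max.bounded_iff not_one_le_zero of_nat_0)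
  define T where "T = max (max 1 (C * real M ^ 3)) (3 * (k + real M) / \<epsilon>)"
  show thesis
  proof
    show "0 < T" by (simp add: T_def)
    fix t :: real and f g :: "nat \<Rightarrow> real" and N
    assume t: "T \<le> t" and N: "real N \<le> C * t"
      and bd: "\<And>x. x < N \<Longrightarrow> \<bar>g x\<bar> \<le> B"
      and sep: "\<And>x y. x < y \<Longrightarrow> y < N \<Longrightarrow> c * (real y - real x) / t \<le> g x - g y"
      and lin: "\<And>x j. x + j < N \<Longrightarrow> \<bar>f (x + j) - f x - real j * g x\<bar> \<le> C * (real j)\<^sup>2 / t"
    have t': "0 < t" "C * real M ^ 3 \<le> t" "3 * (k + real M) / \<epsilon> \<le> t"
      using t \<open>0 < T\<close> by (auto simp: T_def)
    define bad where "bad x \<longleftrightarrow> (\<exists>q p :: int. 0 < q \<and> q < int Q \<and> \<bar>of_int q * g x - of_int p\<bar> < 1 / real M)" for x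
    have bd': "\<bar>g x\<bar> \<le> real b" if "x < N" for x
      using bd[OF that] by (simp add: b_def) linarith
    have 1: "\<bar>\<Sum>x=0..<N. (frac (f x) - 1/2)\<bar> \<le> 9 / real Q * real (N - 0) + real (card {x \<in> {0..<N}. bad x}) + real M"
      unfolding bad_def
      by (rule sawtooth_sum_blocks[OF \<open>0 < M\<close> \<open>0 < Q\<close> t'(1,2) \<open>0 \<le> C\<close> lin order.refl]) auto
    have 2: "real (card {x \<in> {0..<N}. bad x}) \<le> k * (2 * t / (c * real M) + 1)"
      using card_near_rational_slope[OF \<open>0 < M\<close> t'(1) assms(1) bd' sep, of N Q]
      by (simp add: bad_def k_def)
    have 3: "9 / real Q * real N \<le> \<epsilon> / 3 * t"
    proof -
      have "9 / real Q * real N \<le> 9 / real Q * (C * t)"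
        using N by (intro mult_left_mono) auto
      also have "9 / real Q * C \<le> \<epsilon> / 3"
        using Q assms by (simp add: field_simps)
      then have "9 / real Q * (C * t) \<le> \<epsilon> / 3 * t"
        using t'(1) by (simp only: mult.assoc[symmetric]) (rule mult_right_mono, auto)
      finally show ?thesis .
    qed
    have 4: "k * (2 * t / (c * real M)) \<le> \<epsilon> / 3 * t"
    proof -
      have "2 * k / (c * real M) \<le> \<epsilon> / 3"
        using M assms by (simp add: field_simps)
      then have "2 * k / (c * real M) * t \<le> \<epsilon> / 3 * t"
        using t'(1) by (intro mult_right_mono) auto
      then show ?thesis by (simp add: mult_ac)
    qed
    have 5: "k + real M \<le> \<epsilon> / 3 * t"
      using t'(3) assms by (simp add: field_simps)
    have "\<epsilon> * t = \<epsilon> / 3 * t + \<epsilon> / 3 * t + \<epsilon> / 3 * t" by simp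
    then show "\<bar>\<Sum>x<N. (frac (f x) - 1/2)\<bar> \<le> \<epsilon> * t"
      using 1 2 3 4 5 by (simp only: distrib_left atLeast0LessThan diff_zero mult_1_right)
  qed
qed

section \<open>Riemann sums of the ball profile\<close>

lemma sum_le_integral_antimono:
  fixes h :: "real \<Rightarrow> real"
  assumes "antimono_on {real k..A} h" "continuous_on {real k..A} h"
  shows "k \<le> l \<Longrightarrow> real l \<le> A \<Longrightarrow> integral {real k..real l} h \<le> (\<Sum>m=k..<l. h (real m))"
    and "k \<le> l \<Longrightarrow> real l \<le> A \<Longrightarrow> (\<Sum>m=k..<l. h (real (Suc m))) \<le> integral {real k..real l} h"
proof -
  have "k \<le> l \<Longrightarrow> real l \<le> A \<Longrightarrow> integral {real k..real l} h \<le> (\<Sum>m=k..<l. h (real m))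
      \<and> (\<Sum>m=k..<l. h (real (Suc m))) \<le> integral {real k..real l} h"
  proof (induction l)
    case (Suc l)
    show ?case
    proof (cases "k = Suc l")
      case False
      have le: "k \<le> l" "real l \<le> A" using Suc False by auto
      have int: "h integrable_on {real k..real (Suc l)}"
        by (intro integrable_continuous_interval continuous_on_subset[OF assms(2)]) (use Suc in auto)
      have int': "h integrable_on {real l..real (Suc l)}"
        by (intro integrable_continuous_interval continuous_on_subset[OF assms(2)]) (use Suc le in auto)
      have split: "integral {real k..real (Suc l)} h = integral {real k..real l} h + integral {real l..real (Suc l)} h"
        by (rule Henstock_Kurzweil_Integration.integral_combine[symmetric, OF _ _ int]) (use le in auto)
      have mono: "h y \<le> h x" if "real k \<le> x" "x \<le> y" "y \<le> A" for x y
        by (rule monotone_onD[OF assms(1)]) (use that in auto)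
      have "integral {real l..real (Suc l)} h \<le> integral {real l..real (Suc l)} (\<lambda>_. h (real l))"
        by (intro integral_le int') (use Suc le in \<open>auto intro!: mono\<close>)
      moreover have "integral {real l..real (Suc l)} (\<lambda>_. h (real (Suc l))) \<le> integral {real l..real (Suc l)} h"
        by (intro integral_le int') (use Suc le in \<open>auto intro!: mono\<close>)
      ultimately show ?thesis
        using Suc.IH[OF le] le unfolding split by simp
    qed simp
  qed simp
  then show "k \<le> l \<Longrightarrow> real l \<le> A \<Longrightarrow> integral {real k..real l} h \<le> (\<Sum>m=k..<l. h (real m))"
    "k \<le> l \<Longrightarrow> real l \<le> A \<Longrightarrow> (\<Sum>m=k..<l. h (real (Suc m))) \<le> integral {real k..real l} h" by auto
qed

text \<open>The right end A need not be an integer. Nonnegativity of \<open>h A\<close> makes the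
  integral over the incomplete last cell lie between 0 and the last summand.\<close>

lemma sum_integral_antimono:
  fixes h :: "real \<Rightarrow> real"
  assumes "antimono_on {real k..A} h" "continuous_on {real k..A} h" "real k \<le> A" "0 \<le> h A"
  shows "integral {real k..A} h \<le> (\<Sum>m=k..nat \<lfloor>A\<rfloor>. h (real m))"
    and "(\<Sum>m=k..nat \<lfloor>A\<rfloor>. h (real m)) \<le> h k + integral {real k..A} h"
proof -
  define l where "l = nat \<lfloor>A\<rfloor>"
  have l: "k \<le> l" "real l \<le> A" "A \<le> real l + 1"
    using assms(3) by (auto simp: l_def le_nat_floor)
  have int: "h integrable_on {real k..A}"
    by (intro integrable_continuous_interval assms)
  have int': "h integrable_on {real l..A}"
    by (intro integrable_continuous_interval continuous_on_subset[OF assms(2)]) (use l in auto)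
  have split: "integral {real k..A} h = integral {real k..real l} h + integral {real l..A} h"
    by (rule Henstock_Kurzweil_Integration.integral_combine[symmetric, OF _ _ int]) (use l in auto)
  have mono: "h y \<le> h x" if "real k \<le> x" "x \<le> y" "y \<le> A" for x y
    by (rule monotone_onD[OF assms(1)]) (use that in auto)
  have "0 \<le> integral {real l..A} h"
    by (intro integral_nonneg int') (use l in \<open>auto intro!: order.trans[OF assms(4)] mono\<close>)
  moreover have "integral {real l..A} h \<le> h l"
  proof -
    have "integral {real l..A} h \<le> integral {real l..A} (\<lambda>_. h l)"
      by (intro integral_le int') (use l in \<open>auto intro!: mono\<close>)
    also have "\<dots> = (A - real l) * h l" using l by simp
    also have "\<dots> \<le> 1 * h l"
      using l by (intro mult_right_mono order.trans[OF assms(4)] mono) auto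
    finally show ?thesis by simp
  qed
  moreover have "integral {real k..real l} h \<le> (\<Sum>m=k..<l. h (real m))"
    "(\<Sum>m=k..<l. h (real (Suc m))) \<le> integral {real k..real l} h"
    using sum_le_integral_antimono[OF assms(1,2)] l by auto
  moreover have "(\<Sum>m=k..l. h (real m)) = (\<Sum>m=k..<l. h (real m)) + h l"
    using l by (simp add: sum.last_plus add.commute flip: atLeastLessThanSuc_atLeastAtMost)
  moreover have "(\<Sum>m=k..l. h (real m)) = h k + (\<Sum>m=k..<l. h (real (Suc m)))"
  proof -
    have "(\<Sum>m=k..k + j. h (real m)) = h k + (\<Sum>m=k..<k + j. h (real (Suc m)))" for j
      by (induction j) auto
    from this[of "l - k"] show ?thesis using l(1) by simp
  qed
  ultimately show "integral {real k..A} h \<le> (\<Sum>m=k..nat \<lfloor>A\<rfloor>. h (real m))"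
    "(\<Sum>m=k..nat \<lfloor>A\<rfloor>. h (real m)) \<le> h k + integral {real k..A} h"
    unfolding split l_def[symmetric] by linarith+
qed

section \<open>The trapezoidal rule for stretched profiles\<close>

lemma integral_stretch:
  fixes \<phi> :: "real \<Rightarrow> real"
  assumes "0 < A" "continuous_on {0..1} \<phi>"
  shows "integral {0..A} (\<lambda>x. \<phi> (x / A)) = A * integral {0..1} \<phi>"
proof -
  have "(\<phi> has_integral integral {0..1} \<phi>) (cbox 0 1)"
    using integrable_continuous_interval[OF assms(2)] by (simp add: has_integral_integral)
  from has_integral_affinity[OF this, of "1 / A" 0] assms(1)
  have "((\<lambda>x. \<phi> (x / A)) has_integral A * integral {0..1} \<phi>) ((\<lambda>x. A * x) ` {0..1})"
    by (simp add: mult.commute)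
  also have "(\<lambda>x. A * x) ` {0..1} = {0..A}"
    using assms(1) by (simp add: image_mult_atLeastAtMost)
  finally show ?thesis by (rule integral_unique)
qed

text \<open>Both the value at the right endpoint and the integral are compared with the tangent line
  at a, for which the rule is exact. Only the oscillation of the derivative enters, which suits a
  derivative known merely to be continuous.\<close>

lemma trapezoid_cell:
  fixes h h' :: "real \<Rightarrow> real"
  assumes der: "\<And>x. x \<in> {a..a+1} \<Longrightarrow> (h has_real_derivative h' x) (at x)"
    and osc: "\<And>x. x \<in> {a..a+1} \<Longrightarrow> \<bar>h' x - h' a\<bar> \<le> \<delta>"
  shows "\<bar>(h a + h (a + 1)) / 2 - integral {a..a+1} h\<bar> \<le> 2 * \<delta>"
proof -
  define L where "L x = h a + h' a * (x - a)" for x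
  have near: "\<bar>h x - L x\<bar> \<le> \<delta>" if x: "x \<in> {a..a+1}" for x
  proof (cases "x = a")
    case True
    then show ?thesis using osc[of a] by (simp add: L_def)
  next
    case False
    then have "a < x" using x by auto
    then obtain z where z: "a < z" "z < x" "h x - h a = (x - a) * h' z"
      using MVT2[of a x h h'] der x by auto
    have "h x - L x = (h' z - h' a) * (x - a)"
      using z(3) by (simp add: L_def algebra_simps)
    then have "\<bar>h x - L x\<bar> = \<bar>h' z - h' a\<bar> * (x - a)"
      using \<open>a < x\<close> by (simp add: abs_mult)
    also have "\<dots> \<le> \<delta> * 1"
      using osc[of z] z x \<open>a < x\<close> by (intro mult_mono) auto
    finally show ?thesis by simp
  qed
  have cont: "continuous_on {a..a+1} h"
    using der by (meson DERIV_isCont continuous_at_imp_continuous_on)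
  have "(L has_integral (h a + h' a / 2)) {a..a+1}"
  proof -
    have "(L has_integral ((\<lambda>x. h a * x + h' a * (x - a)\<^sup>2 / 2) (a + 1) - (\<lambda>x. h a * x + h' a * (x - a)\<^sup>2 / 2) a)) {a..a+1}"
      by (rule fundamental_theorem_of_calculus)
         (auto simp: L_def has_real_derivative_iff_has_vector_derivative[symmetric] intro!: derivative_eq_intros)
    then show ?thesis by (simp add: algebra_simps)
  qed
  moreover have hint: "(h has_integral integral {a..a+1} h) {a..a+1}"
    using integrable_continuous_interval[OF cont] by (simp add: has_integral_integral)
  ultimately have D: "((\<lambda>x. h x - L x) has_integral (integral {a..a+1} h - (h a + h' a / 2))) {a..a+1}"
    by (intro has_integral_diff)
  have "0 \<le> \<delta>" using osc[of a] by auto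
  have "\<bar>integral {a..a+1} h - (h a + h' a / 2)\<bar> \<le> \<delta>"
    using has_integral_bound_real[OF \<open>0 \<le> \<delta>\<close> finite.emptyI D] near by simp
  moreover have "\<bar>h (a + 1) - (h a + h' a)\<bar> \<le> \<delta>"
    using near[of "a + 1"] by (simp add: L_def)
  moreover have "(h a + h (a + 1)) / 2 - integral {a..a+1} h
     = (h (a + 1) - (h a + h' a)) / 2 - (integral {a..a+1} h - (h a + h' a / 2))"
    by argo
  ultimately show ?thesis using \<open>0 \<le> \<delta>\<close> by argo
qed

lemma trapezoid_sum:
  fixes h h' :: "real \<Rightarrow> real"
  assumes der: "\<And>x. x \<in> {0..real K} \<Longrightarrow> (h has_real_derivative h' x) (at x)"
    and osc: "\<And>x y. x \<in> {0..real K} \<Longrightarrow> y \<in> {0..real K} \<Longrightarrow> \<bar>x - y\<bar> \<le> 1 \<Longrightarrow> \<bar>h' x - h' y\<bar> \<le> \<delta>"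
  shows "\<bar>(\<Sum>m<K. h (real m)) + h K / 2 - h 0 / 2 - integral {0..real K} h\<bar> \<le> 2 * \<delta> * real K"
  using assms
proof (induction K)
  case (Suc K)
  have cont: "continuous_on {0..real (Suc K)} h"
    using Suc.prems(1) by (meson DERIV_isCont continuous_at_imp_continuous_on)
  have "integral {0..real (Suc K)} h = integral {0..real K} h + integral {real K..real K + 1} h"
    by (subst Henstock_Kurzweil_Integration.integral_combine) (auto intro!: integrable_continuous_interval cont simp: add.commute intro: continuous_on_subset[OF cont])
  moreover have "\<bar>(\<Sum>m<K. h (real m)) + h K / 2 - h 0 / 2 - integral {0..real K} h\<bar> \<le> 2 * \<delta> * real K"
    using Suc.IH Suc.prems by simp
  moreover have "\<bar>(h K + h (real K + 1)) / 2 - integral {real K..real K + 1} h\<bar> \<le> 2 * \<delta>"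
    by (rule trapezoid_cell[where h' = h']) (use Suc.prems in auto)
  moreover have "2 * \<delta> * real (Suc K) = 2 * \<delta> * real K + 2 * \<delta>" by (simp add: algebra_simps)
  moreover have "(\<Sum>m<Suc K. h (real m)) = (\<Sum>m<K. h (real m)) + h K" "h (real (Suc K)) = h (real K + 1)"
    by (simp_all add: add.commute)
  moreover have "\<bar>s + k + k1 / 2 - z / 2 - (i + j)\<bar> \<le> e + b"
    if "\<bar>s + k / 2 - z / 2 - i\<bar> \<le> e" "\<bar>(k + k1) / 2 - j\<bar> \<le> b" for s k k1 z i j e b :: real
    using that by argo
  ultimately show ?case by simp
qed simp


lemma sum_scaled_antimono:
  fixes \<phi> :: "real \<Rightarrow> real"
  assumes "antimono_on {0..1} \<phi>" "continuous_on {0..1} \<phi>" "0 \<le> \<phi> 1" "0 < A"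
  shows "A * integral {0..1} \<phi> \<le> (\<Sum>m\<le>nat \<lfloor>A\<rfloor>. \<phi> (real m / A))"
    and "(\<Sum>m\<le>nat \<lfloor>A\<rfloor>. \<phi> (real m / A)) \<le> \<phi> 0 + A * integral {0..1} \<phi>"
proof -
  have am: "antimono_on {real 0..A} (\<lambda>x. \<phi> (x / A))"
    using assms by (auto intro!: monotone_onI monotone_onD[OF assms(1)] divide_right_mono)
  have co: "continuous_on {real 0..A} (\<lambda>x. \<phi> (x / A))"
    using assms(4) by (intro continuous_on_compose2[OF assms(2)] continuous_intros) auto
  show "A * integral {0..1} \<phi> \<le> (\<Sum>m\<le>nat \<lfloor>A\<rfloor>. \<phi> (real m / A))"
    "(\<Sum>m\<le>nat \<lfloor>A\<rfloor>. \<phi> (real m / A)) \<le> \<phi> 0 + A * integral {0..1} \<phi>"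
    using sum_integral_antimono[OF am co] assms integral_stretch[OF assms(4,2)]
    by (simp_all add: atLeast0AtMost)
qed

text \<open>The derivative may blow up at 1, as for a quarter circle. On [0, w] it is uniformly
  continuous, and stretching by A reduces its variation per cell to \<epsilon> / (4 A), so all cells
  together cost \<epsilon> / 2. The tail is squeezed by monotonicity.\<close>

lemma sum_scaled_trapezoid:
  fixes \<phi> \<phi>' :: "real \<Rightarrow> real"
  assumes anti: "antimono_on {0..1} \<phi>" and cont: "continuous_on {0..1} \<phi>" and zero: "\<phi> 1 = 0"
    and der: "\<And>u. u \<in> {0..<1} \<Longrightarrow> (\<phi> has_real_derivative \<phi>' u) (at u)"
    and cont': "continuous_on {0..<1} \<phi>'"
    and "0 < \<epsilon>"
  obtains A0 where "0 < A0"
    "\<And>A. A0 \<le> A \<Longrightarrow> \<bar>(\<Sum>m\<le>nat \<lfloor>A\<rfloor>. \<phi> (real m / A)) - A * integral {0..1} \<phi> - \<phi> 0 / 2\<bar> \<le> \<epsilon>"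
proof -
  have nonneg: "0 \<le> \<phi> u" if "u \<in> {0..1}" for u
    using monotone_onD[OF anti, of u 1] that zero by auto
  obtain v where v: "0 < v" "v < 1" "\<phi> v \<le> \<epsilon>"
  proof -
    have "(\<phi> \<longlongrightarrow> 0) (at 1 within {0..1})"
      using cont zero by (metis atLeastAtMost_iff continuous_on_def order.refl zero_le_one)
    then have "\<forall>\<^sub>F u in at 1 within {0..1}. dist (\<phi> u) 0 < \<epsilon>"
      using \<open>0 < \<epsilon>\<close> by (rule tendstoD)
    then obtain d where d: "0 < d" "\<And>u. u \<in> {0..1} \<Longrightarrow> u \<noteq> 1 \<Longrightarrow> dist u 1 < d \<Longrightarrow> dist (\<phi> u) 0 < \<epsilon>"
      unfolding eventually_at by metis
    define v where "v = max (1/2) (1 - d/2)"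
    have "0 \<le> v" "v < 1" "1 - v < d" using d(1) by (auto simp: v_def less_max_iff_disj)
    then have "\<phi> v \<le> \<epsilon>" using d(2)[of v] by (auto simp: dist_real_def)
    then show thesis using that[of v] d(1) by (auto simp: v_def)
  qed
  \<comment> \<open>The cut K / A may fall short of w by up to 1 / A; placing w to the right of v
    keeps the cut beyond v, where \<phi> is at most \<epsilon>.\<close>
  define w where "w = (1 + v) / 2"
  have w: "v < w" "w < 1" "0 < w" using v by (auto simp: w_def)
  have "uniformly_continuous_on {0..w} \<phi>'"
    using w by (intro compact_uniformly_continuous continuous_on_subset[OF cont']) auto
  then obtain d where d: "0 < d" "\<And>x y. x \<in> {0..w} \<Longrightarrow> y \<in> {0..w} \<Longrightarrow> dist x y < d \<Longrightarrow> dist (\<phi>' x) (\<phi>' y) < \<epsilon> / 4"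
    unfolding uniformly_continuous_on_def using \<open>0 < \<epsilon>\<close> by (metis divide_pos_pos zero_less_numeral)
  define A0 where "A0 = max (2 / d) (1 / (w - v))"
  show thesis
  proof
    show "0 < A0" using w by (simp add: A0_def less_max_iff_disj)
    fix A assume A: "A0 \<le> A"
    then have "0 < A" using \<open>0 < A0\<close> by linarith
    have A1: "1 / A < d"
    proof -
      have "2 / d \<le> A" using A by (simp add: A0_def)
      then show ?thesis using \<open>0 < A\<close> d(1) by (simp add: field_simps)
    qed
    have A2: "1 / A \<le> w - v"
    proof -
      have "1 / (w - v) \<le> A" using A by (simp add: A0_def)
      then show ?thesis using \<open>0 < A\<close> w by (simp add: field_simps)
    qed
    define K where "K = nat \<lfloor>w * A\<rfloor>"
    define N where "N = nat \<lfloor>A\<rfloor>"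
    have "0 \<le> w * A" using w \<open>0 < A\<close> by simp
    then have K: "real K \<le> w * A" "w * A - 1 \<le> real K"
      unfolding K_def by linarith+
    have "w * A \<le> A" using w \<open>0 < A\<close> by simp
    then have KN: "K \<le> N" unfolding K_def N_def by (intro nat_mono floor_mono)
    have KA: "real K / A \<le> w" "v \<le> real K / A"
    proof -
      show "real K / A \<le> w" using K(1) \<open>0 < A\<close> by (simp add: field_simps)
      have "(w * A - 1) / A \<le> real K / A" using K(2) \<open>0 < A\<close> by (intro divide_right_mono) auto
      then have "w - 1 / A \<le> real K / A" using \<open>0 < A\<close> by (simp add: diff_divide_distrib)
      then show "v \<le> real K / A" using A2 by linarith
    qed
    define h where "h = (\<lambda>x. \<phi> (x / A))"
    have trap: "\<bar>(\<Sum>m<K. h (real m)) + h (real K) / 2 - h 0 / 2 - integral {0..real K} h\<bar> \<le> 2 * (\<epsilon> / 4 / A) * real K"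
    proof (rule trapezoid_sum[where h' = "\<lambda>x. \<phi>' (x / A) / A"])
      have dom: "x / A \<in> {0..w}" if "x \<in> {0..real K}" for x
        using that \<open>0 < A\<close> order.trans[OF divide_right_mono[of x "real K" A] KA(1)] by auto
      show "(h has_real_derivative \<phi>' (x / A) / A) (at x)" if "x \<in> {0..real K}" for x
        unfolding h_def using DERIV_chain2[OF der, of "\<lambda>x. x / A" x "1 / A"] dom[OF that] w
        by (auto intro!: DERIV_cdivide[where f = "\<lambda>x. x" and D = 1, simplified])
      show "\<bar>\<phi>' (x / A) / A - \<phi>' (y / A) / A\<bar> \<le> \<epsilon> / 4 / A"
        if xy: "x \<in> {0..real K}" "y \<in> {0..real K}" "\<bar>x - y\<bar> \<le> 1" for x y
      proof -
        have "\<bar>x / A - y / A\<bar> = \<bar>x - y\<bar> / A" using \<open>0 < A\<close> by (simp add: diff_divide_distrib[symmetric] abs_divide)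
        also have "\<dots> \<le> 1 / A" using xy \<open>0 < A\<close> by (intro divide_right_mono) auto
        finally have "dist (x / A) (y / A) < d" using A1 by (simp add: dist_real_def)
        then have "\<bar>\<phi>' (x / A) - \<phi>' (y / A)\<bar> \<le> \<epsilon> / 4"
          using d(2)[OF dom[OF xy(1)] dom[OF xy(2)]] by (simp add: dist_real_def)
        then show ?thesis
          using \<open>0 < A\<close> divide_right_mono[of "\<bar>\<phi>' (x / A) - \<phi>' (y / A)\<bar>" "\<epsilon> / 4" A]
          by (simp add: diff_divide_distrib[symmetric] abs_divide)
      qed
    qed
    have "2 * (\<epsilon> / 4 / A) * real K = \<epsilon> / 2 * (real K / A)" by simp
    also have "\<dots> \<le> \<epsilon> / 2 * 1" using KA w \<open>0 < \<epsilon>\<close> by (intro mult_left_mono) auto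
    finally have trap': "\<bar>(\<Sum>m<K. h (real m)) + h (real K) / 2 - h 0 / 2 - integral {0..real K} h\<bar> \<le> \<epsilon> / 2"
      using trap by linarith
    have am: "antimono_on {0..A} h" unfolding h_def
      using \<open>0 < A\<close> by (auto intro!: monotone_onI monotone_onD[OF anti] divide_right_mono)
    have co: "continuous_on {0..A} h" unfolding h_def
      using \<open>0 < A\<close> by (intro continuous_on_compose2[OF cont] continuous_intros) auto
    have "real K \<le> A" using K(1) \<open>w * A \<le> A\<close> by linarith
    have tail: "integral {real K..A} h \<le> (\<Sum>m=K..N. h (real m))"
      "(\<Sum>m=K..N. h (real m)) \<le> h (real K) + integral {real K..A} h"
      unfolding N_def
      using sum_integral_antimono[of K A h] \<open>real K \<le> A\<close> \<open>0 < A\<close> zero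
        monotone_on_subset[OF am] continuous_on_subset[OF co] by (auto simp: h_def)
    have "(\<Sum>m\<le>N. h (real m)) = (\<Sum>m<K. h (real m)) + (\<Sum>m=K..N. h (real m))"
      using KN sum.atLeastLessThan_concat[of 0 K "Suc N" "\<lambda>m. h (real m)"]
      by (simp add: atLeast0LessThan atMost_atLeast0 atLeastLessThanSuc_atLeastAtMost)
    moreover have "integral {0..A} h = integral {0..real K} h + integral {real K..A} h"
      by (rule Henstock_Kurzweil_Integration.integral_combine[symmetric])
        (use \<open>real K \<le> A\<close> in \<open>auto intro!: integrable_continuous_interval co\<close>)
    moreover have "integral {0..A} h = A * integral {0..1} \<phi>"
      unfolding h_def by (rule integral_stretch[OF \<open>0 < A\<close> cont])
    moreover have "0 \<le> h (real K)" "h (real K) \<le> \<epsilon>"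
    proof -
      have K01: "real K / A \<in> {0..1}" unfolding atLeastAtMost_iff using KA w v by linarith
      show "0 \<le> h (real K)" unfolding h_def by (rule nonneg[OF K01])
      have "h (real K) \<le> \<phi> v" unfolding h_def using KA K01 v by (intro monotone_onD[OF anti]) auto
      then show "h (real K) \<le> \<epsilon>" using v by linarith
    qed
    \<comment> \<open>The trapezoidal sum includes half the summand k at the cut. The tail sum
      exceeds its integral by an amount in [0, k], which is within k / 2 of this half, so a second
      \<epsilon> / 2 suffices.\<close>
    moreover have "\<bar>s + t - (i + j) - z / 2\<bar> \<le> \<epsilon>"
      if "\<bar>s + k / 2 - z / 2 - i\<bar> \<le> \<epsilon> / 2" "j \<le> t" "t \<le> k + j" "0 \<le> k" "k \<le> \<epsilon>" for s t i j z k :: real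
      using that by argo
    ultimately have "\<bar>(\<Sum>m\<le>N. h (real m)) - A * integral {0..1} \<phi> - h 0 / 2\<bar> \<le> \<epsilon>"
      using trap' tail by (metis)
    then show "\<bar>(\<Sum>m\<le>nat \<lfloor>A\<rfloor>. \<phi> (real m / A)) - A * integral {0..1} \<phi> - \<phi> 0 / 2\<bar> \<le> \<epsilon>"
      by (simp add: h_def N_def)
  qed
qed

section \<open>Slices of the unit ball\<close>

definition ball_profile :: "nat \<Rightarrow> real \<Rightarrow> real" where
  "ball_profile d u = sqrt (1 - u\<^sup>2) ^ d"

text \<open>A slice of the (d+1)-dimensional unit ball at height u is a d-ball of radius sqrt (1 -
  u^2). Thus \<open>ball_profile\<close> is its volume relative to the unit d-ball, and this
  integral is half the ratio of consecutive unit ball volumes.\<close>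

definition profile_integral :: "nat \<Rightarrow> real" where
  "profile_integral d = integral {0..1} (ball_profile d)"

lemma ball_profile_antimono: "antimono_on {0..1} (ball_profile d)"
  by (auto simp: ball_profile_def power2_eq_square abs_square_le_1 intro!: monotone_onI power_mono mult_mono real_sqrt_ge_zero mult_le_one)

lemma ball_profile_continuous: "continuous_on S (ball_profile d)"
  unfolding ball_profile_def by (intro continuous_intros)

lemma profile_integral_nonneg: "0 \<le> profile_integral d"
  unfolding profile_integral_def
  by (intro integral_nonneg integrable_continuous_interval ball_profile_continuous)
     (auto simp: ball_profile_def abs_square_le_1)

text \<open>Cavalieri's principle for the ball: the Beta integral over [-1, 1], halved by symmetry,
  combined with the Gamma function formula for the volume.\<close>

lemma unit_ball_vol_Suc: "unit_ball_vol (real (Suc d)) = 2 * unit_ball_vol (real d) * profile_integral d"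
proof -
  have int: "ball_profile d integrable_on {a..b}" for a b
    by (intro integrable_continuous_interval ball_profile_continuous)
  have "(ball_profile d has_integral integral {-1..1} (ball_profile d)) {-1..1}"
    using int by (rule integrable_integral)
  from nn_integral_has_integral_lebesgue[OF _ this]
  have "ennreal (Beta (1 / 2) (real d / 2 + 1)) = ennreal (integral {-1..1} (ball_profile d))"
    using emeasure_cball_aux_integral[of d] by (simp add: ball_profile_def abs_square_le_1 abs_le_iff)
  moreover have "0 \<le> integral {-1..1} (ball_profile d)"
    by (intro integral_nonneg int) (auto simp: ball_profile_def abs_square_le_1)
  moreover have "0 \<le> Beta (1 / 2) (real d / 2 + 1)"
    by (simp add: Beta_def)
  ultimately have "Beta (1 / 2) (real d / 2 + 1) = integral {-1..1} (ball_profile d)"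
    by simp
  also have "\<dots> = integral {-1..0} (ball_profile d) + integral {0..1} (ball_profile d)"
    by (rule Henstock_Kurzweil_Integration.integral_combine[symmetric]) (auto intro: int)
  also have "integral {-1..0} (ball_profile d) = integral {0..1} (ball_profile d)"
  proof -
    have "(\<lambda>x. ball_profile d (- x)) = ball_profile d"
      by (simp add: ball_profile_def fun_eq_iff)
    then show ?thesis
      using Henstock_Kurzweil_Integration.integral_reflect_real[of 1 0 "ball_profile d"] by simp
  qed
  finally have "Beta (1 / 2) (real d / 2 + 1) = 2 * profile_integral d"
    by (simp add: profile_integral_def)
  moreover have "unit_ball_vol (real d) * Beta (1/2) (real d / 2 + 1) = unit_ball_vol (real (Suc d))"
    by (auto simp: unit_ball_vol_def Beta_def Gamma_eq_zero_iff field_simps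
          Gamma_one_half_real powr_half_sqrt [symmetric] powr_add [symmetric])
  ultimately show ?thesis by simp
qed

lemma sum_ball_profile:
  assumes "0 < A"
  shows "A * profile_integral d \<le> (\<Sum>m\<le>nat \<lfloor>A\<rfloor>. ball_profile d (real m / A))"
    and "(\<Sum>m\<le>nat \<lfloor>A\<rfloor>. ball_profile d (real m / A)) \<le> A * profile_integral d + 1"
  using sum_scaled_antimono[OF ball_profile_antimono ball_profile_continuous _ assms, of d]
  by (auto simp: profile_integral_def ball_profile_def)

text \<open>For d = 0 the profile does not vanish at 1 and the sum would be a step function of A,
  without a limiting second term.\<close>

lemma sum_ball_profile_trapezoid:
  assumes "1 \<le> d" "0 < \<epsilon>"
  obtains A0 where "0 < A0"
    "\<And>A. A0 \<le> A \<Longrightarrow> \<bar>(\<Sum>m\<le>nat \<lfloor>A\<rfloor>. ball_profile d (real m / A)) - A * profile_integral d - 1 / 2\<bar> \<le> \<epsilon>"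
proof -
  define D where "D u = real d * sqrt (1 - u\<^sup>2) ^ (d - 1) * (- u / sqrt (1 - u\<^sup>2))" for u
  have pos: "0 < 1 - u\<^sup>2" if "0 \<le> u" "u < 1" for u :: real
    using that by (simp add: abs_square_less_1)
  have der: "(ball_profile d has_real_derivative D u) (at u)" if "u \<in> {0..<1}" for u
    unfolding ball_profile_def D_def using pos[of u] that
    by (auto intro!: derivative_eq_intros simp: field_simps)
  have cont: "continuous_on {0..<1} D"
    unfolding D_def by (intro continuous_intros) (use pos in force)
  have "ball_profile d 1 = 0" using assms by (simp add: ball_profile_def)
  from sum_scaled_trapezoid[OF ball_profile_antimono ball_profile_continuous this der cont assms(2)]
  obtain A0 where "0 < A0" "\<And>A. A0 \<le> A \<Longrightarrow>
      \<bar>(\<Sum>m\<le>nat \<lfloor>A\<rfloor>. ball_profile d (real m / A)) - A * integral {0..1} (ball_profile d) - ball_profile d 0 / 2\<bar> \<le> \<epsilon>"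
    by blast
  then show thesis
    using that by (simp add: profile_integral_def ball_profile_def)
qed

lemma ball_profile_le:
  assumes "1 \<le> d" "0 \<le> u" "u \<le> 1"
  shows "ball_profile d u \<le> 1 - u\<^sup>2 / 2"
proof -
  have "u\<^sup>2 \<le> 1" using assms by (simp add: power_le_one)
  then have "sqrt (1 - u\<^sup>2) ^ d \<le> sqrt (1 - u\<^sup>2) ^ 1"
    using assms by (intro power_decreasing) auto
  also have "sqrt (1 - u\<^sup>2) ^ 1 \<le> 1 - u\<^sup>2 / 2"
  proof -
    have "(1 - u\<^sup>2 / 2)\<^sup>2 = 1 - u\<^sup>2 + (u\<^sup>2 / 2)\<^sup>2"
      by (simp add: power2_eq_square algebra_simps)
    then show ?thesis
      using \<open>u\<^sup>2 \<le> 1\<close> by (simp only: power_one_right) (rule real_le_lsqrt, auto)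
  qed
  finally show ?thesis by (simp add: ball_profile_def)
qed

text \<open>The excess must be uniform down to A near 0, because the sides of a cuboid are not yet
  known to be bounded below. For large A the trapezoidal rule gives nearly 1/2; for A \<le> 1 the
  summand at 0 alone exceeds A times the integral; in between the gain comes from the first cell,
  where the profile is below 1 by at least \<open>u\<^sup>2 / 2\<close>.\<close>

lemma sum_ball_profile_excess:
  assumes "1 \<le> d"
  obtains c where "0 < c"
    "\<And>A. 0 < A \<Longrightarrow> A * profile_integral d + c \<le> (\<Sum>m\<le>nat \<lfloor>A\<rfloor>. ball_profile d (real m / A))"
proof -
  obtain A0 where A0: "0 < A0" "\<And>A. A0 \<le> A \<Longrightarrow>
      \<bar>(\<Sum>m\<le>nat \<lfloor>A\<rfloor>. ball_profile d (real m / A)) - A * profile_integral d - 1 / 2\<bar> \<le> 1/4"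
    using sum_ball_profile_trapezoid[OF assms, of "1/4"] by auto
  \<comment> \<open>The integral of x^2 / (2 A^2) over the first cell is 1 / (6 A^2), smallest at A
    = A0 in the middle range. The value 1/6 serves A \<le> 1, where the integral of the profile is
    at most 5/6.\<close>
  define c where "c = min (1/6) (1 / (6 * A0\<^sup>2))"
  have bound: "integral {0..b} (\<lambda>x. ball_profile d (x / A)) \<le> b - b ^ 3 / (6 * A\<^sup>2)"
    if "0 \<le> b" "b \<le> A" "0 < A" for b A
  proof -
    have "((\<lambda>x. 1 - (x / A)\<^sup>2 / 2) has_integral ((\<lambda>x. x - x ^ 3 / (6 * A\<^sup>2)) b - (\<lambda>x. x - x ^ 3 / (6 * A\<^sup>2)) 0)) {0..b}"
      using that by (intro fundamental_theorem_of_calculus)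
        (auto simp: has_real_derivative_iff_has_vector_derivative[symmetric] field_simps intro!: derivative_eq_intros)
    then have I: "integral {0..b} (\<lambda>x. 1 - (x / A)\<^sup>2 / 2) = b - b ^ 3 / (6 * A\<^sup>2)"
      by (simp add: integral_unique)
    have "integral {0..b} (\<lambda>x. ball_profile d (x / A)) \<le> integral {0..b} (\<lambda>x. 1 - (x / A)\<^sup>2 / 2)"
      using that assms
      by (intro integral_le integrable_continuous_interval continuous_on_compose2[OF ball_profile_continuous[of UNIV]] continuous_intros ball_profile_le)
         (auto simp: divide_le_eq_1)
    then show ?thesis by (simp only: I)
  qed
  have Ibd: "profile_integral d \<le> 5/6"
    using bound[of 1 1] by (simp add: profile_integral_def)
  show thesis
  proof
    show "0 < c" using A0 by (simp add: c_def)
    fix A :: real assume "0 < A"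
    define S where "S = (\<Sum>m\<le>nat \<lfloor>A\<rfloor>. ball_profile d (real m / A))"
    have S: "S = 1 + (\<Sum>m=1..nat \<lfloor>A\<rfloor>. ball_profile d (real m / A))"
      unfolding S_def by (simp add: atMost_atLeast0 sum.atLeast_Suc_atMost ball_profile_def)
    have tail_nonneg: "0 \<le> (\<Sum>m=1..nat \<lfloor>A\<rfloor>. ball_profile d (real m / A))"
    proof (intro sum_nonneg)
      fix m assume "m \<in> {1..nat \<lfloor>A\<rfloor>}"
      then have "m \<le> nat \<lfloor>A\<rfloor>" by simp
      then have "real m \<le> A" using \<open>0 < A\<close> by linarith
      then show "0 \<le> ball_profile d (real m / A)"
        using \<open>0 < A\<close> by (auto simp: ball_profile_def abs_square_le_1 intro!: zero_le_power)
    qed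
    consider "A \<le> 1" | "1 \<le> A" "A \<le> A0" | "A0 \<le> A" by linarith
    then have "A * profile_integral d + c \<le> S"
    proof cases
      case 1
      have "A * profile_integral d \<le> 1 * (5/6)"
        using 1 \<open>0 < A\<close> Ibd profile_integral_nonneg by (intro mult_mono) auto
      moreover have "c \<le> 1/6" by (simp add: c_def)
      ultimately show ?thesis using tail_nonneg S by linarith
    next
      case 2
      have co: "continuous_on U (\<lambda>x. ball_profile d (x / A))" for U
        using \<open>0 < A\<close> by (intro continuous_on_compose2[OF ball_profile_continuous[of UNIV]] continuous_intros) auto
      have am: "antimono_on {real 1..A} (\<lambda>x. ball_profile d (x / A))"
        using \<open>0 < A\<close> by (auto intro!: monotone_onI monotone_onD[OF ball_profile_antimono] divide_right_mono)
      have "integral {1..A} (\<lambda>x. ball_profile d (x / A)) \<le> (\<Sum>m=1..nat \<lfloor>A\<rfloor>. ball_profile d (real m / A))"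
        using sum_integral_antimono(1)[OF am co] 2 by (simp add: ball_profile_def)
      moreover have "A * profile_integral d = integral {0..1} (\<lambda>x. ball_profile d (x / A)) + integral {1..A} (\<lambda>x. ball_profile d (x / A))"
        unfolding profile_integral_def
        by (subst integral_stretch[OF \<open>0 < A\<close> ball_profile_continuous, symmetric],
            subst Henstock_Kurzweil_Integration.integral_combine)
          (use 2 in \<open>auto intro!: integrable_continuous_interval co\<close>)
      moreover have "integral {0..1} (\<lambda>x. ball_profile d (x / A)) \<le> 1 - 1 / (6 * A\<^sup>2)"
        using bound[of 1 A] 2 by simp
      moreover have "c \<le> 1 / (6 * A\<^sup>2)"
      proof -
        have "1 / (6 * A0\<^sup>2) \<le> 1 / (6 * A\<^sup>2)"
          using 2 by (intro divide_left_mono mult_left_mono power_mono) auto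
        then show ?thesis by (simp add: c_def min.coboundedI2)
      qed
      ultimately show ?thesis using S by linarith
    next
      case 3
      have "c \<le> 1/6" by (simp add: c_def)
      then show ?thesis using A0(2)[OF 3] unfolding S_def[symmetric] by linarith
    qed
    then show "A * profile_integral d + c \<le> (\<Sum>m\<le>nat \<lfloor>A\<rfloor>. ball_profile d (real m / A))"
      by (simp add: S_def)
  qed
qed

section \<open>Lattice points in ellipsoids and their orthants\<close>

text \<open>Arbitrary index sets and coordinate types allow coordinates to be removed one at a time
  and let integer and natural lattices share one slicing lemma.\<close>

definition sublevel_count :: "'i set \<Rightarrow> ('i \<Rightarrow> 'z \<Rightarrow> real) \<Rightarrow> real \<Rightarrow> nat" where
  "sublevel_count J q \<Lambda> = card {z \<in> J \<rightarrow>\<^sub>E UNIV. (\<Sum>i\<in>J. q i (z i)) \<le> \<Lambda>}"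

lemma finite_sublevel:
  assumes "finite J" "\<And>i v. i \<in> J \<Longrightarrow> 0 \<le> q i v" "\<And>i \<Lambda>. i \<in> J \<Longrightarrow> finite {v. q i v \<le> (\<Lambda>::real)}"
  shows "finite {z \<in> J \<rightarrow>\<^sub>E UNIV. (\<Sum>i\<in>J. q i (z i)) \<le> \<Lambda>}"
proof (rule finite_subset)
  show "{z \<in> J \<rightarrow>\<^sub>E UNIV. (\<Sum>i\<in>J. q i (z i)) \<le> \<Lambda>} \<subseteq> (\<Pi>\<^sub>E i\<in>J. {v. q i v \<le> \<Lambda>})"
  proof
    fix z assume "z \<in> {z \<in> J \<rightarrow>\<^sub>E UNIV. (\<Sum>i\<in>J. q i (z i)) \<le> \<Lambda>}"
    then have z: "z \<in> J \<rightarrow>\<^sub>E UNIV" "(\<Sum>i\<in>J. q i (z i)) \<le> \<Lambda>" by auto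
    have "q i (z i) \<le> \<Lambda>" if "i \<in> J" for i
      using member_le_sum[OF that, of "\<lambda>i. q i (z i)"] assms(1,2) z(2) by fastforce
    then show "z \<in> (\<Pi>\<^sub>E i\<in>J. {v. q i v \<le> \<Lambda>})" using z(1) by (auto simp: PiE_iff)
  qed
  show "finite (\<Pi>\<^sub>E i\<in>J. {v. q i v \<le> \<Lambda>})"
    using assms by (intro finite_PiE) auto
qed

lemma sublevel_count_insert:
  assumes "finite J" "i \<notin> J" "\<And>j v. j \<in> insert i J \<Longrightarrow> 0 \<le> q j v"
    "\<And>j \<Lambda>. j \<in> insert i J \<Longrightarrow> finite {v. q j v \<le> (\<Lambda>::real)}"
  shows "sublevel_count (insert i J) q \<Lambda> = (\<Sum>v | q i v \<le> \<Lambda>. sublevel_count J q (\<Lambda> - q i v))"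
proof -
  let ?S = "\<lambda>v. {z \<in> J \<rightarrow>\<^sub>E UNIV. (\<Sum>j\<in>J. q j (z j)) \<le> \<Lambda> - q i v}"
  let ?A = "SIGMA v:{v. q i v \<le> \<Lambda>}. ?S v"
  let ?B = "{z \<in> insert i J \<rightarrow>\<^sub>E UNIV. (\<Sum>j\<in>insert i J. q j (z j)) \<le> \<Lambda>}"
  have upd: "(\<Sum>j\<in>J. q j ((z(i := v)) j)) = (\<Sum>j\<in>J. q j (z j))" for z v
    using assms(2) by (intro sum.cong) auto
  have "bij_betw (\<lambda>(v, z). z(i := v)) ?A ?B"
  proof (rule bij_betwI[where g = "\<lambda>z. (z i, z(i := undefined))"])
    show "(\<lambda>(v, z). z(i := v)) \<in> ?A \<rightarrow> ?B"
      using assms(1,2) by (auto simp: upd simp del: fun_upd_apply intro: fun_upd_in_PiE) (auto simp: PiE_iff extensional_def split: if_splits)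
    show "(\<lambda>z. (z i, z(i := undefined))) \<in> ?B \<rightarrow> ?A"
    proof
      fix z assume z: "z \<in> ?B"
      have "0 \<le> (\<Sum>j\<in>J. q j (z j))" using assms(3) by (intro sum_nonneg) auto
      then show "(z i, z(i := undefined)) \<in> ?A"
        using z assms(1,2) by (auto simp: upd simp del: fun_upd_apply) (auto simp: PiE_iff extensional_def)
    qed
    show "(\<lambda>z. (z i, z(i := undefined))) ((\<lambda>(v, z). z(i := v)) x) = x" if "x \<in> ?A" for x
      using that assms(2) by (auto simp: PiE_iff extensional_def fun_eq_iff)
  qed auto
  then have "sublevel_count (insert i J) q \<Lambda> = card ?A"
    unfolding sublevel_count_def by (rule bij_betw_same_card[symmetric])
  also have "\<dots> = (\<Sum>v | q i v \<le> \<Lambda>. sublevel_count J q (\<Lambda> - q i v))"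
    unfolding sublevel_count_def using assms by (intro card_SigmaI) (auto intro!: finite_sublevel)
  finally show ?thesis .
qed

section \<open>Slicing along one coordinate\<close>

definition lattice_points :: "nat set \<Rightarrow> (nat \<Rightarrow> real) \<Rightarrow> real \<Rightarrow> nat" where
  "lattice_points J a t = sublevel_count J (\<lambda>i (z::int). (of_int z)\<^sup>2 / (a i)\<^sup>2) (t\<^sup>2)"

definition orthant_points :: "nat set \<Rightarrow> (nat \<Rightarrow> real) \<Rightarrow> real \<Rightarrow> nat" where
  "orthant_points J a t = sublevel_count J (\<lambda>i (m::nat). (real m)\<^sup>2 / (a i)\<^sup>2) (t\<^sup>2)"

text \<open>F is evaluated at the scale factor of the slice in which the coordinate with half-axis
  \<open>\<alpha> * t\<close> takes the value m.\<close>

definition radial_sum :: "real \<Rightarrow> real \<Rightarrow> (real \<Rightarrow> real) \<Rightarrow> real" where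
  "radial_sum \<alpha> t F = (\<Sum>m\<le>nat \<lfloor>\<alpha> * t\<rfloor>. F (sqrt (t\<^sup>2 - (real m / \<alpha>)\<^sup>2)))"

lemma le_nat_floor_mult_iff:
  assumes "0 < \<alpha>" "0 \<le> t"
  shows "m \<le> nat \<lfloor>\<alpha> * t\<rfloor> \<longleftrightarrow> (real m / \<alpha>)\<^sup>2 \<le> t\<^sup>2"
proof -
  have "m \<le> nat \<lfloor>\<alpha> * t\<rfloor> \<longleftrightarrow> real m \<le> \<alpha> * t"
    using assms mult_nonneg_nonneg[of \<alpha> t] by (simp add: le_nat_iff le_floor_iff)
  also have "\<dots> \<longleftrightarrow> real m / \<alpha> \<le> t"
    using assms by (simp add: field_simps)
  also have "\<dots> \<longleftrightarrow> (real m / \<alpha>)\<^sup>2 \<le> t\<^sup>2"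
    using assms by (intro power_mono_iff[symmetric]) auto
  finally show ?thesis .
qed

lemma sublevel_nat: "0 < \<alpha> \<Longrightarrow> 0 \<le> t \<Longrightarrow> {m::nat. (real m)\<^sup>2 / \<alpha>\<^sup>2 \<le> t\<^sup>2} = {..nat \<lfloor>\<alpha> * t\<rfloor>}"
  using le_nat_floor_mult_iff by (auto simp: power_divide)

lemma sublevel_int:
  fixes \<alpha> :: real
  assumes "0 < \<alpha>" "0 \<le> t"
  shows "{z::int. (of_int z)\<^sup>2 / \<alpha>\<^sup>2 \<le> t\<^sup>2} = {- int (nat \<lfloor>\<alpha> * t\<rfloor>)..int (nat \<lfloor>\<alpha> * t\<rfloor>)}"
proof -
  have "(of_int z)\<^sup>2 / \<alpha>\<^sup>2 \<le> t\<^sup>2 \<longleftrightarrow> nat \<bar>z\<bar> \<le> nat \<lfloor>\<alpha> * t\<rfloor>" for z :: int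
    using le_nat_floor_mult_iff[OF assms, of "nat \<bar>z\<bar>"] by (simp add: power_divide)
  moreover have "nat \<bar>z\<bar> \<le> N \<longleftrightarrow> z \<in> {- int N..int N}" for z N by auto
  ultimately show ?thesis by (simp only: Collect_mem_eq)
qed

lemma finite_sublevel_nat: "0 < \<alpha> \<Longrightarrow> finite {m::nat. (real m)\<^sup>2 / \<alpha>\<^sup>2 \<le> \<Lambda>}"
  by (rule finite_subset[OF _ finite_atMost[of "nat \<lfloor>\<alpha> * sqrt \<bar>\<Lambda>\<bar>\<rfloor>"]])
    (use sublevel_nat[of \<alpha> "sqrt \<bar>\<Lambda>\<bar>"] in auto)

lemma finite_sublevel_int: "0 < (\<alpha>::real) \<Longrightarrow> finite {z::int. (of_int z)\<^sup>2 / \<alpha>\<^sup>2 \<le> \<Lambda>}"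
proof (rule finite_subset)
  assume "0 < \<alpha>"
  then show "{z::int. (of_int z)\<^sup>2 / \<alpha>\<^sup>2 \<le> \<Lambda>} \<subseteq> {- int (nat \<lfloor>\<alpha> * sqrt \<bar>\<Lambda>\<bar>\<rfloor>)..int (nat \<lfloor>\<alpha> * sqrt \<bar>\<Lambda>\<bar>\<rfloor>)}"
    by (subst sublevel_int[symmetric]) auto
qed auto

lemma sum_symmetric_int:
  fixes G :: "nat \<Rightarrow> real"
  shows "(\<Sum>z\<in>{- int N..int N}. G (nat \<bar>z\<bar>)) = 2 * (\<Sum>m\<le>N. G m) - G 0"
proof (induction N)
  case (Suc N)
  have "{- int (Suc N)..int (Suc N)} = insert (- int (Suc N)) (insert (int (Suc N)) {- int N..int N})"
    by auto
  then show ?case using Suc by (simp add: nat_add_distrib)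
qed simp

lemma orthant_points_empty [simp]: "orthant_points {} a t = 1" and lattice_points_empty [simp]: "lattice_points {} a t = 1"
  by (simp_all add: orthant_points_def lattice_points_def sublevel_count_def cong: conj_cong)

lemma orthant_points_insert:
  assumes "finite J" "i \<notin> J" "\<And>j. j \<in> insert i J \<Longrightarrow> 0 < a j" "0 \<le> t"
  shows "real (orthant_points (insert i J) a t) = radial_sum (a i) t (\<lambda>s. real (orthant_points J a s))"
proof -
  have "orthant_points (insert i J) a t = (\<Sum>m\<in>{..nat \<lfloor>a i * t\<rfloor>}. sublevel_count J (\<lambda>i m. (real m)\<^sup>2 / (a i)\<^sup>2) (t\<^sup>2 - (real m)\<^sup>2 / (a i)\<^sup>2))"
    unfolding orthant_points_def using assms
    by (subst sublevel_count_insert) (auto simp: sublevel_nat finite_sublevel_nat)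
  also have "\<dots> = (\<Sum>m\<in>{..nat \<lfloor>a i * t\<rfloor>}. orthant_points J a (sqrt (t\<^sup>2 - (real m / a i)\<^sup>2)))"
    using le_nat_floor_mult_iff[of "a i" t] assms by (intro sum.cong) (auto simp: orthant_points_def power_divide)
  finally show ?thesis by (simp add: radial_sum_def)
qed

text \<open>The slices at z and -z agree while the central one occurs once. Its subtraction is what
  later cancels the boundary term of the trapezoidal rule.\<close>

lemma lattice_points_insert:
  assumes "finite J" "i \<notin> J" "\<And>j. j \<in> insert i J \<Longrightarrow> 0 < a j" "0 \<le> t"
  shows "real (lattice_points (insert i J) a t) = 2 * radial_sum (a i) t (\<lambda>s. real (lattice_points J a s)) - real (lattice_points J a t)"
proof -
  define G where "G m = real (lattice_points J a (sqrt (t\<^sup>2 - (real m / a i)\<^sup>2)))" for m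
  have "lattice_points (insert i J) a t = (\<Sum>z\<in>{- int (nat \<lfloor>a i * t\<rfloor>)..int (nat \<lfloor>a i * t\<rfloor>)}. sublevel_count J (\<lambda>i z. (of_int z)\<^sup>2 / (a i)\<^sup>2) (t\<^sup>2 - (of_int z)\<^sup>2 / (a i)\<^sup>2))"
    unfolding lattice_points_def
  proof (subst sublevel_count_insert)
    show "finite {v::int. (real_of_int v)\<^sup>2 / (a j)\<^sup>2 \<le> \<Lambda>}" if "j \<in> insert i J" for j \<Lambda>
      using finite_sublevel_int assms(3)[OF that] by blast
  qed (use assms in \<open>simp_all only: sublevel_int insertI1 zero_le_divide_iff zero_le_power2 simp_thms\<close>)
  also have "\<dots> = (\<Sum>z\<in>{- int (nat \<lfloor>a i * t\<rfloor>)..int (nat \<lfloor>a i * t\<rfloor>)}. lattice_points J a (sqrt (t\<^sup>2 - (real (nat \<bar>z\<bar>) / a i)\<^sup>2)))"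
  proof (intro sum.cong refl)
    fix z :: int assume "z \<in> {- int (nat \<lfloor>a i * t\<rfloor>)..int (nat \<lfloor>a i * t\<rfloor>)}"
    moreover have "nat \<bar>z\<bar> \<le> N" if "z \<in> {- int N..int N}" for N using that by auto
    ultimately have "nat \<bar>z\<bar> \<le> nat \<lfloor>a i * t\<rfloor>" by blast
    then have "(real (nat \<bar>z\<bar>) / a i)\<^sup>2 \<le> t\<^sup>2"
      using le_nat_floor_mult_iff[of "a i" t] assms by auto
    then show "sublevel_count J (\<lambda>i z. (of_int z)\<^sup>2 / (a i)\<^sup>2) (t\<^sup>2 - (of_int z)\<^sup>2 / (a i)\<^sup>2) = lattice_points J a (sqrt (t\<^sup>2 - (real (nat \<bar>z\<bar>) / a i)\<^sup>2))"
      by (simp add: lattice_points_def power_divide)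
  qed
  finally have "real (lattice_points (insert i J) a t) = (\<Sum>z\<in>{- int (nat \<lfloor>a i * t\<rfloor>)..int (nat \<lfloor>a i * t\<rfloor>)}. G (nat \<bar>z\<bar>))"
    by (simp add: G_def)
  then show ?thesis
    unfolding sum_symmetric_int using assms(4) by (simp add: G_def radial_sum_def)
qed

lemma radial_arg:
  assumes "0 < \<alpha>" "0 \<le> t" "m \<le> nat \<lfloor>\<alpha> * t\<rfloor>"
  shows "0 \<le> sqrt (t\<^sup>2 - (real m / \<alpha>)\<^sup>2)" "sqrt (t\<^sup>2 - (real m / \<alpha>)\<^sup>2) \<le> t"
  using assms le_nat_floor_mult_iff[of \<alpha> t m] by (auto intro: real_le_lsqrt)

lemma radial_sum_mono:
  assumes "0 < \<alpha>" "0 \<le> t" "\<And>s. 0 \<le> s \<Longrightarrow> s \<le> t \<Longrightarrow> F s \<le> G s"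
  shows "radial_sum \<alpha> t F \<le> radial_sum \<alpha> t G"
  unfolding radial_sum_def using radial_arg[OF assms(1,2)] by (intro sum_mono assms(3)) auto

lemma radial_sum_cmult: "radial_sum \<alpha> t (\<lambda>s. c * F s) = c * radial_sum \<alpha> t F"
  by (simp add: radial_sum_def sum_distrib_left)

lemma radial_sum_diff: "radial_sum \<alpha> t (\<lambda>s. F s - G s) = radial_sum \<alpha> t F - radial_sum \<alpha> t G"
  by (simp add: radial_sum_def sum_subtractf)

lemma radial_sum_abs_le:
  assumes "0 < \<alpha>" "0 \<le> t" "\<And>s. 0 \<le> s \<Longrightarrow> s \<le> t \<Longrightarrow> \<bar>F s\<bar> \<le> e"
  shows "\<bar>radial_sum \<alpha> t F\<bar> \<le> (\<alpha> * t + 1) * e"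
proof -
  have "0 \<le> e" using assms(3)[of 0] assms(2) by auto
  have "\<bar>radial_sum \<alpha> t F\<bar> \<le> (\<Sum>m\<le>nat \<lfloor>\<alpha> * t\<rfloor>. e)"
    unfolding radial_sum_def using radial_arg[OF assms(1,2)]
    by (intro order.trans[OF sum_abs sum_mono] assms(3)) auto
  also have "\<dots> = (real (nat \<lfloor>\<alpha> * t\<rfloor>) + 1) * e" by (simp add: algebra_simps)
  also have "\<dots> \<le> (\<alpha> * t + 1) * e"
    using assms(1,2) \<open>0 \<le> e\<close> by (intro mult_right_mono) auto
  finally show ?thesis .
qed

lemma radial_sum_power:
  assumes "0 < \<alpha>" "0 < t"
  shows "radial_sum \<alpha> t (\<lambda>s. s ^ d) = t ^ d * (\<Sum>m\<le>nat \<lfloor>\<alpha> * t\<rfloor>. ball_profile d (real m / (\<alpha> * t)))"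
proof -
  have "sqrt (t\<^sup>2 - (real m / \<alpha>)\<^sup>2) = t * sqrt (1 - (real m / (\<alpha> * t))\<^sup>2)" for m
  proof -
    have "t\<^sup>2 - (real m / \<alpha>)\<^sup>2 = t\<^sup>2 * (1 - (real m / (\<alpha> * t))\<^sup>2)"
      using assms by (simp add: field_simps)
    then show ?thesis using assms by (simp add: real_sqrt_mult)
  qed
  then show ?thesis
    by (simp add: radial_sum_def ball_profile_def power_mult_distrib sum_distrib_left)
qed

lemma radial_sum_power_bounds:
  assumes "0 < \<alpha>" "0 \<le> t"
  shows "\<alpha> * profile_integral d * t ^ Suc d \<le> radial_sum \<alpha> t (\<lambda>s. s ^ d)"
    and "radial_sum \<alpha> t (\<lambda>s. s ^ d) \<le> \<alpha> * profile_integral d * t ^ Suc d + t ^ d"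
proof -
  have "\<alpha> * profile_integral d * t ^ Suc d \<le> radial_sum \<alpha> t (\<lambda>s. s ^ d) \<and>
    radial_sum \<alpha> t (\<lambda>s. s ^ d) \<le> \<alpha> * profile_integral d * t ^ Suc d + t ^ d"
  proof (cases "t = 0")
    case True
    then show ?thesis by (simp add: radial_sum_def)
  next
    case False
    then have "0 < t" "0 < \<alpha> * t" using assms by auto
    define X where "X = (\<Sum>m\<le>nat \<lfloor>\<alpha> * t\<rfloor>. ball_profile d (real m / (\<alpha> * t)))"
    have "t ^ d * (\<alpha> * t * profile_integral d) \<le> t ^ d * X" "t ^ d * X \<le> t ^ d * (\<alpha> * t * profile_integral d + 1)"
      using sum_ball_profile[OF \<open>0 < \<alpha> * t\<close>, of d] \<open>0 < t\<close>
      by (auto simp: X_def intro!: mult_left_mono)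
    then show ?thesis
      unfolding radial_sum_power[OF assms(1) \<open>0 < t\<close>] X_def by (simp add: algebra_simps)
  qed
  then show "\<alpha> * profile_integral d * t ^ Suc d \<le> radial_sum \<alpha> t (\<lambda>s. s ^ d)"
    "radial_sum \<alpha> t (\<lambda>s. s ^ d) \<le> \<alpha> * profile_integral d * t ^ Suc d + t ^ d" by auto
qed

lemma radial_sum_approx:
  assumes "0 < \<alpha>" "0 \<le> t" "\<And>s. 0 \<le> s \<Longrightarrow> s \<le> t \<Longrightarrow> \<bar>F s - c * s ^ d\<bar> \<le> e"
  shows "\<bar>radial_sum \<alpha> t F - c * \<alpha> * profile_integral d * t ^ Suc d\<bar> \<le> \<bar>c\<bar> * t ^ d + (\<alpha> * t + 1) * e"
proof -
  have 1: "\<bar>radial_sum \<alpha> t F - c * radial_sum \<alpha> t (\<lambda>s. s ^ d)\<bar> \<le> (\<alpha> * t + 1) * e"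
    using radial_sum_abs_le[OF assms] by (simp add: radial_sum_diff radial_sum_cmult)
  have "\<bar>radial_sum \<alpha> t (\<lambda>s. s ^ d) - \<alpha> * profile_integral d * t ^ Suc d\<bar> \<le> t ^ d"
    using radial_sum_power_bounds[OF assms(1,2), of d] by linarith
  then have "\<bar>c\<bar> * \<bar>radial_sum \<alpha> t (\<lambda>s. s ^ d) - \<alpha> * profile_integral d * t ^ Suc d\<bar> \<le> \<bar>c\<bar> * t ^ d"
    by (rule mult_left_mono) auto
  then have 2: "\<bar>c * radial_sum \<alpha> t (\<lambda>s. s ^ d) - c * \<alpha> * profile_integral d * t ^ Suc d\<bar> \<le> \<bar>c\<bar> * t ^ d"
    unfolding abs_mult[symmetric] by (simp add: algebra_simps)
  show ?thesis using 1 2 by linarith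
qed

section \<open>Main terms of the counts, by induction on the dimension\<close>

lemma prod_le_power_hi:
  assumes "\<And>i. i \<in> J \<Longrightarrow> 0 < a i \<and> a i \<le> (hi::real)"
  shows "0 \<le> (\<Prod>i\<in>J. a i)" "(\<Prod>i\<in>J. a i) \<le> hi ^ card J"
proof -
  show "0 \<le> (\<Prod>i\<in>J. a i)" using assms by (intro prod_nonneg) (auto intro: less_imp_le)
  have "(\<Prod>i\<in>J. a i) \<le> (\<Prod>i\<in>J. hi)" using assms by (intro prod_mono) (auto intro: less_imp_le)
  then show "(\<Prod>i\<in>J. a i) \<le> hi ^ card J" by simp
qed

text \<open>
  The error vanishes in dimension 0. This is recorded in the bound because an error \<open>O(1)\<close> there would
  grow to \<open>O(t)\<close> in dimension 1.
\<close>
lemma lattice_points_approx: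
  fixes hi :: real
  assumes "finite J" "0 \<le> hi"
  obtains C where "0 \<le> C" "\<And>a t. \<lbrakk>\<And>i. i \<in> J \<Longrightarrow> 0 < a i \<and> a i \<le> hi; 0 \<le> t\<rbrakk> \<Longrightarrow>
     \<bar>real (lattice_points J a t) - unit_ball_vol (real (card J)) * (\<Prod>i\<in>J. a i) * t ^ card J\<bar>
        \<le> C * (if card J = 0 then 0 else (1 + t) ^ (card J - 1))"
proof -
  have "\<exists>C\<ge>0. \<forall>a t. (\<forall>i\<in>J. 0 < a i \<and> a i \<le> hi) \<longrightarrow> 0 \<le> t \<longrightarrow>
     \<bar>real (lattice_points J a t) - unit_ball_vol (real (card J)) * (\<Prod>i\<in>J. a i) * t ^ card J\<bar>
        \<le> C * (if card J = 0 then 0 else (1 + t) ^ (card J - 1))"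
    using assms(1)
  proof (induction J rule: finite_induct)
    case (insert i J)
    define d where "d = card J"
    define w where "w = unit_ball_vol (real d)"
    define E where "E t = (if d = 0 then 0 else (1 + t) ^ (d - 1) :: real)" for t
    obtain C where C: "0 \<le> C" "\<And>a t. (\<forall>i\<in>J. 0 < a i \<and> a i \<le> hi) \<Longrightarrow> 0 \<le> t \<Longrightarrow>
       \<bar>real (lattice_points J a t) - w * (\<Prod>i\<in>J. a i) * t ^ d\<bar> \<le> C * E t"
      using insert.IH unfolding d_def[symmetric] w_def[symmetric] E_def by blast
    have "0 \<le> w" by (simp add: w_def)
    \<comment> \<open>The term \<open>w * hi ^ d\<close> occurs twice because the doubled Riemann
      sum may exceed its integral by one top summand, and once for the central slice. The other
      terms propagate the inductive error.\<close>
    define C' where "C' = 3 * w * hi ^ d + 2 * (hi + 1) * C + C"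
    show ?case
    proof (intro exI[of _ C'] conjI allI impI)
      show "0 \<le> C'" using C assms \<open>0 \<le> w\<close> by (simp add: C'_def)
      fix a :: "nat \<Rightarrow> real" and t :: real
      assume a: "\<forall>j\<in>insert i J. 0 < a j \<and> a j \<le> hi" and t: "0 \<le> t"
      define P where "P = (\<Prod>j\<in>J. a j)"
      have P: "0 \<le> P" "P \<le> hi ^ d"
        unfolding P_def d_def using a by (auto intro!: prod_le_power_hi)
      have ai: "0 < a i" "a i \<le> hi" using a by auto
      have Emono: "E s \<le> E t" if "0 \<le> s" "s \<le> t" for s
        using that by (auto simp: E_def intro!: power_mono)
      have approx: "\<bar>radial_sum (a i) t (\<lambda>s. real (lattice_points J a s)) - w * P * a i * profile_integral d * t ^ Suc d\<bar>
          \<le> \<bar>w * P\<bar> * t ^ d + (a i * t + 1) * (C * E t)"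
      proof (rule radial_sum_approx[OF ai(1) t])
        fix s :: real assume s: "0 \<le> s" "s \<le> t"
        have "\<bar>real (lattice_points J a s) - w * P * s ^ d\<bar> \<le> C * E s"
          unfolding P_def using C(2) a s by auto
        also have "\<dots> \<le> C * E t" using Emono[OF s] C(1) by (rule mult_left_mono)
        finally show "\<bar>real (lattice_points J a s) - w * P * s ^ d\<bar> \<le> C * E t" .
      qed
      have lt: "\<bar>real (lattice_points J a t) - w * P * t ^ d\<bar> \<le> C * E t"
        unfolding P_def using C(2) a t by auto
      have Ele: "(1 + t) * E t \<le> (1 + t) ^ d" "E t \<le> (1 + t) ^ d" "0 \<le> E t"
        using t by (auto simp: E_def intro!: power_increasing simp flip: power_Suc)
      have 1: "\<bar>w * P\<bar> * t ^ d \<le> w * hi ^ d * (1 + t) ^ d"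
        using P \<open>0 \<le> w\<close> t by (auto simp: abs_mult intro!: mult_mono power_mono)
      have 2: "(a i * t + 1) * (C * E t) \<le> (hi + 1) * C * (1 + t) ^ d"
      proof -
        have "a i * t + 1 \<le> (hi + 1) * (1 + t)"
        proof -
          have "a i * t \<le> hi * t" using ai t by (intro mult_right_mono) auto
          then show ?thesis using t assms(2) by (simp add: algebra_simps)
        qed
        then have "(a i * t + 1) * (C * E t) \<le> (hi + 1) * (1 + t) * (C * E t)"
          using C(1) Ele by (intro mult_right_mono) auto
        also have "\<dots> = (hi + 1) * C * ((1 + t) * E t)" by simp
        also have "\<dots> \<le> (hi + 1) * C * (1 + t) ^ d"
          using Ele C(1) assms(2) by (intro mult_left_mono) auto
        finally show ?thesis .
      qed
      have 3: "C * E t \<le> C * (1 + t) ^ d" using Ele C(1) by (intro mult_left_mono)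
      have rec: "real (lattice_points (insert i J) a t) = 2 * radial_sum (a i) t (\<lambda>s. real (lattice_points J a s)) - real (lattice_points J a t)"
        using lattice_points_insert[of J i a t] insert.hyps a t by auto
      have main: "unit_ball_vol (real (Suc d)) * (\<Prod>j\<in>insert i J. a j) * t ^ Suc d = 2 * (w * P * a i * profile_integral d * t ^ Suc d)"
        using insert.hyps by (simp only: unit_ball_vol_Suc) (simp add: w_def P_def)
      have "0 \<le> w * P * t ^ d" "w * P * t ^ d \<le> w * hi ^ d * (1 + t) ^ d"
        using 1 \<open>0 \<le> w\<close> P t by (auto simp: abs_mult)
      then have "\<bar>real (lattice_points (insert i J) a t) - unit_ball_vol (real (Suc d)) * (\<Prod>j\<in>insert i J. a j) * t ^ Suc d\<bar>
          \<le> 3 * (w * hi ^ d * (1 + t) ^ d) + 2 * ((hi + 1) * C * (1 + t) ^ d) + C * (1 + t) ^ d"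
        unfolding rec main using approx lt 1 2 3 by (simp only: abs_le_iff) linarith
      also have "\<dots> = C' * (1 + t) ^ d"
        by (simp add: C'_def algebra_simps)
      finally show "\<bar>real (lattice_points (insert i J) a t) - unit_ball_vol (real (card (insert i J))) * (\<Prod>j\<in>insert i J. a j) * t ^ card (insert i J)\<bar>
          \<le> C' * (if card (insert i J) = 0 then 0 else (1 + t) ^ (card (insert i J) - 1))"
        using insert.hyps by (simp add: d_def)
    qed
  qed (auto intro!: exI[of _ 0])
  then show thesis using that by metis
qed

text \<open>In \<open>2 ^ card J\<close> times the orthant count, a lattice point with r vanishing
  coordinates has weight \<open>2 ^ r\<close>. The excess over the plain count is therefore the sum
  of the counts on the coordinate hyperplanes, up to intersections of at least two of them, which
  are of lower order. Slicing turns this into an induction.\<close>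

lemma orthant_points_lat_approx:
  fixes hi :: real
  assumes "finite J" "0 \<le> hi"
  obtains C where "0 \<le> C" "\<And>a t. \<lbrakk>\<And>i. i \<in> J \<Longrightarrow> 0 < a i \<and> a i \<le> hi; 0 \<le> t\<rbrakk> \<Longrightarrow>
     \<bar>2 ^ card J * real (orthant_points J a t) - real (lattice_points J a t)
        - unit_ball_vol (real (card J - 1)) * (\<Sum>i\<in>J. \<Prod>j\<in>J - {i}. a j) * t ^ (card J - 1)\<bar>
        \<le> C * (if card J \<le> 1 then 0 else (1 + t) ^ (card J - 2))"
proof -
  have "\<exists>C\<ge>0. \<forall>a t. (\<forall>i\<in>J. 0 < a i \<and> a i \<le> hi) \<longrightarrow> 0 \<le> t \<longrightarrow>
     \<bar>2 ^ card J * real (orthant_points J a t) - real (lattice_points J a t)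
        - unit_ball_vol (real (card J - 1)) * (\<Sum>i\<in>J. \<Prod>j\<in>J - {i}. a j) * t ^ (card J - 1)\<bar>
        \<le> C * (if card J \<le> 1 then 0 else (1 + t) ^ (card J - 2))"
    using assms(1)
  proof (induction J rule: finite_induct)
    case (insert i J)
    show ?case
    proof (cases "J = {}")
      case True
      \<comment> \<open>In dimension 1 the excess is exactly the doubly counted origin, so no error
        of order 1 enters the induction.\<close>
      have "2 * real (orthant_points {i} a t) - real (lattice_points {i} a t) = 1" if "0 < a i" "0 \<le> t" for a t
        using orthant_points_insert[of "{}" i a t] lattice_points_insert[of "{}" i a t] that by simp
      then show ?thesis using True by (auto intro!: exI[of _ 0])
    next
      case False
      obtain e where e: "card J = Suc e" using False insert.hyps by (metis card_0_eq not0_implies_Suc)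
      define w where "w = unit_ball_vol (real e)"
      define E where "E t = (if e = 0 then 0 else (1 + t) ^ (e - 1) :: real)" for t
      define D where "D a t = 2 ^ Suc e * real (orthant_points J a t) - real (lattice_points J a t)" for a t
      define Q where "Q a = (\<Sum>i\<in>J. \<Prod>j\<in>J - {i}. a j)" for a :: "nat \<Rightarrow> real"
      obtain C where C: "0 \<le> C" "\<And>a t. (\<forall>i\<in>J. 0 < a i \<and> a i \<le> hi) \<Longrightarrow> 0 \<le> t \<Longrightarrow>
         \<bar>D a t - w * Q a * t ^ e\<bar> \<le> C * E t"
      proof -
        have "\<exists>C\<ge>0. \<forall>a t. (\<forall>i\<in>J. 0 < a i \<and> a i \<le> hi) \<longrightarrow> 0 \<le> t \<longrightarrow> \<bar>D a t - w * Q a * t ^ e\<bar> \<le> C * E t"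
          using insert.IH by (simp add: D_def w_def E_def Q_def e cong: if_cong)
        then show ?thesis using that by blast
      qed
      obtain C1 where C1: "0 \<le> C1" "\<And>a t. \<lbrakk>\<And>i. i \<in> J \<Longrightarrow> 0 < a i \<and> a i \<le> hi; 0 \<le> t\<rbrakk> \<Longrightarrow>
       \<bar>real (lattice_points J a t) - unit_ball_vol (real (card J)) * (\<Prod>i\<in>J. a i) * t ^ card J\<bar>
          \<le> C1 * (if card J = 0 then 0 else (1 + t) ^ (card J - 1))"
        using lattice_points_approx[OF insert.hyps(1) assms(2)] by blast
      have "0 \<le> w" by (simp add: w_def)
      define C' where "C' = 2 * w * (real (Suc e) * hi ^ e) + 2 * (hi + 1) * C + C1"
      show ?thesis
      proof (intro exI[of _ C'] conjI allI impI)
        show "0 \<le> C'" using C C1 assms \<open>0 \<le> w\<close> by (simp add: C'_def)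
        fix a :: "nat \<Rightarrow> real" and t :: real
        assume a: "\<forall>j\<in>insert i J. 0 < a j \<and> a j \<le> hi" and t: "0 \<le> t"
        define P where "P = (\<Prod>j\<in>J. a j)"
        have Q: "0 \<le> Q a" "Q a \<le> real (Suc e) * hi ^ e"
        proof -
          have *: "0 \<le> (\<Prod>j\<in>J - {k}. a j) \<and> (\<Prod>j\<in>J - {k}. a j) \<le> hi ^ e" if "k \<in> J" for k
            using prod_le_power_hi[of "J - {k}" a hi] a that e insert.hyps by auto
          show "0 \<le> Q a" unfolding Q_def using * by (intro sum_nonneg) auto
          have "Q a \<le> (\<Sum>k\<in>J. hi ^ e)" unfolding Q_def using * by (intro sum_mono) auto
          then show "Q a \<le> real (Suc e) * hi ^ e" by (simp add: e)
        qed
        have ai: "0 < a i" "a i \<le> hi" using a by auto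
        have Emono: "E s \<le> E t" if "0 \<le> s" "s \<le> t" for s
          using that by (auto simp: E_def intro!: power_mono)
        have approx: "\<bar>radial_sum (a i) t (D a) - w * Q a * a i * profile_integral e * t ^ Suc e\<bar>
            \<le> \<bar>w * Q a\<bar> * t ^ e + (a i * t + 1) * (C * E t)"
        proof (rule radial_sum_approx[OF ai(1) t])
          fix s :: real assume s: "0 \<le> s" "s \<le> t"
          have "\<bar>D a s - w * Q a * s ^ e\<bar> \<le> C * E s"
            using C(2) a s by auto
          also have "\<dots> \<le> C * E t" using Emono[OF s] C(1) by (rule mult_left_mono)
          finally show "\<bar>D a s - w * Q a * s ^ e\<bar> \<le> C * E t" .
        qed
        have lt: "\<bar>real (lattice_points J a t) - unit_ball_vol (real (Suc e)) * P * t ^ Suc e\<bar> \<le> C1 * (1 + t) ^ e"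
          unfolding P_def using C1(2)[of a t] a t by (auto simp: e)
        have Ele: "(1 + t) * E t \<le> (1 + t) ^ e" "0 \<le> E t"
          using t by (auto simp: E_def simp flip: power_Suc)
        have 1: "\<bar>w * Q a\<bar> * t ^ e \<le> w * (real (Suc e) * hi ^ e) * (1 + t) ^ e"
          using Q \<open>0 \<le> w\<close> t by (simp only: abs_mult abs_of_nonneg) (intro mult_mono power_mono, auto intro: order.trans)
        have 2: "(a i * t + 1) * (C * E t) \<le> (hi + 1) * C * (1 + t) ^ e"
        proof -
          have "a i * t + 1 \<le> (hi + 1) * (1 + t)"
          proof -
            have "a i * t \<le> hi * t" using ai t by (intro mult_right_mono) auto
            then show ?thesis using t assms(2) by (simp add: algebra_simps)
          qed
          then have "(a i * t + 1) * (C * E t) \<le> (hi + 1) * (1 + t) * (C * E t)"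
            using C(1) Ele by (intro mult_right_mono) auto
          also have "\<dots> = (hi + 1) * C * ((1 + t) * E t)" by simp
          also have "\<dots> \<le> (hi + 1) * C * (1 + t) ^ e"
            using Ele C(1) assms(2) by (intro mult_left_mono) auto
          finally show ?thesis .
        qed
        \<comment> \<open>The slice sum of the excess is doubled and one central slice is left over.
          The volume of that slice is the new hyperplane term P; the old terms acquire the factor
          \<open>a i\<close>.\<close>
        have rec: "2 ^ Suc (Suc e) * real (orthant_points (insert i J) a t) - real (lattice_points (insert i J) a t)
            = 2 * radial_sum (a i) t (D a) + real (lattice_points J a t)"
          using lattice_points_insert[of J i a t] orthant_points_insert[of J i a t] insert.hyps a t
          unfolding D_def radial_sum_diff radial_sum_cmult by auto
        have prods: "(\<Sum>k\<in>insert i J. \<Prod>j\<in>insert i J - {k}. a j) = P + a i * Q a"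
        proof -
          have "(\<Prod>j\<in>insert i J - {k}. a j) = a i * (\<Prod>j\<in>J - {k}. a j)" if "k \<in> J" for k
          proof -
            have "insert i J - {k} = insert i (J - {k})" using that insert.hyps by auto
            then show ?thesis using insert.hyps by simp
          qed
          moreover have "insert i J - {i} = J" using insert.hyps by auto
          ultimately show ?thesis using insert.hyps by (simp add: P_def Q_def sum_distrib_left)
        qed
        have main: "unit_ball_vol (real (Suc e)) * (P + a i * Q a) * t ^ Suc e
            = unit_ball_vol (real (Suc e)) * P * t ^ Suc e + 2 * (w * Q a * a i * profile_integral e * t ^ Suc e)"
          using unit_ball_vol_Suc[of e] by (simp add: w_def algebra_simps)
        have "\<bar>(2 * R + l) - (L + 2 * M)\<bar> \<le> 2 * (x + y) + z"
          if "\<bar>R - M\<bar> \<le> x + y" "\<bar>l - L\<bar> \<le> z" for R l L M x y z :: real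
          using that by (simp only: abs_le_iff) argo
        from this[OF approx lt]
        have "\<bar>2 ^ Suc (Suc e) * real (orthant_points (insert i J) a t) - real (lattice_points (insert i J) a t)
              - unit_ball_vol (real (Suc e)) * (P + a i * Q a) * t ^ Suc e\<bar>
            \<le> 2 * (\<bar>w * Q a\<bar> * t ^ e + (a i * t + 1) * (C * E t)) + C1 * (1 + t) ^ e"
          unfolding rec main .
        also have "\<dots> \<le> 2 * (w * (real (Suc e) * hi ^ e) * (1 + t) ^ e + (hi + 1) * C * (1 + t) ^ e) + C1 * (1 + t) ^ e"
          by (rule add_right_mono, rule mult_left_mono, rule add_mono[OF 1 2], simp)
        also have "\<dots> = C' * (1 + t) ^ e"
          by (simp add: C'_def algebra_simps)
        finally show "\<bar>2 ^ card (insert i J) * real (orthant_points (insert i J) a t) - real (lattice_points (insert i J) a t)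
            - unit_ball_vol (real (card (insert i J) - 1)) * (\<Sum>k\<in>insert i J. \<Prod>j\<in>insert i J - {k}. a j) * t ^ (card (insert i J) - 1)\<bar>
            \<le> C' * (if card (insert i J) \<le> 1 then 0 else (1 + t) ^ (card (insert i J) - 2))"
          using insert.hyps by (simp only: prods) (simp add: e)
      qed
    qed
  qed (auto intro!: exI[of _ 0])
  then show thesis using that by metis
qed

text \<open>Unit cubes attached to the counted points, each point being the lowest corner of its
  cube, cover the orthant of the ellipsoid. In terms of slices, a left Riemann sum of a decreasing
  profile is at least its integral.\<close>

lemma orthant_points_ge_volume:
  assumes "finite J" "\<And>i. i \<in> J \<Longrightarrow> 0 < a i" "0 \<le> t"
  shows "unit_ball_vol (real (card J)) * (\<Prod>i\<in>J. a i) * t ^ card J / 2 ^ card J \<le> real (orthant_points J a t)"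
  using assms
proof (induction J arbitrary: t rule: finite_induct)
  case (insert i J)
  define c where "c = unit_ball_vol (real (card J)) * (\<Prod>i\<in>J. a i) / 2 ^ card J"
  have "0 \<le> (\<Prod>i\<in>J. a i)" using insert.prems by (intro prod_nonneg) (auto intro: less_imp_le)
  then have "0 \<le> c" by (simp add: c_def)
  have "unit_ball_vol (real (card (insert i J))) * (\<Prod>i\<in>insert i J. a i) * t ^ card (insert i J) / 2 ^ card (insert i J)
      = c * (a i * profile_integral (card J) * t ^ Suc (card J))"
    using insert.hyps by (simp add: c_def unit_ball_vol_Suc del: of_nat_Suc)
  also have "\<dots> \<le> c * radial_sum (a i) t (\<lambda>s. s ^ card J)"
    using \<open>0 \<le> c\<close> insert.prems by (intro mult_left_mono radial_sum_power_bounds) auto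
  also have "\<dots> = radial_sum (a i) t (\<lambda>s. c * s ^ card J)" by (simp add: radial_sum_cmult)
  also have "\<dots> \<le> radial_sum (a i) t (\<lambda>s. real (orthant_points J a s))"
    using insert.prems insert.IH by (intro radial_sum_mono) (auto simp: c_def)
  also have "\<dots> = real (orthant_points (insert i J) a t)"
    using insert.hyps insert.prems by (intro orthant_points_insert[symmetric]) auto
  finally show ?case .
qed simp

text \<open>The uniform Riemann sum excess is used only in direction i; the remaining directions
  contribute the plain volume bound. If the product is 1 and i is the shortest side, the product
  over J is \<open>1 / a i\<close>, so the gain is large exactly for thin cuboids.\<close>

lemma orthant_points_ge_volume_excess:
  assumes "1 \<le> d"
  obtains c where "0 < c" "\<And>J i (a :: nat \<Rightarrow> real) t. \<lbrakk>finite J; i \<notin> J; card J = d; \<And>j. j \<in> insert i J \<Longrightarrow> 0 < a j; 0 \<le> t\<rbrakk> \<Longrightarrow>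
     (unit_ball_vol (real (Suc d)) * (\<Prod>j\<in>insert i J. a j) * t ^ Suc d + c * (\<Prod>j\<in>J. a j) * t ^ d) / 2 ^ Suc d
       \<le> real (orthant_points (insert i J) a t)"
proof -
  obtain c where c: "0 < c"
    "\<And>A. 0 < A \<Longrightarrow> A * profile_integral d + c \<le> (\<Sum>m\<le>nat \<lfloor>A\<rfloor>. ball_profile d (real m / A))"
    using sum_ball_profile_excess[OF assms] by blast
  define w where "w = unit_ball_vol (real d)"
  have "0 < w" by (simp add: w_def)
  show thesis
  proof
    show "0 < 2 * w * c" using c \<open>0 < w\<close> by simp
    fix J i and a :: "nat \<Rightarrow> real" and t :: real
    assume J: "finite J" "i \<notin> J" "card J = d" and a: "\<And>j. j \<in> insert i J \<Longrightarrow> 0 < a j" and t: "0 \<le> t"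
    define P where "P = (\<Prod>j\<in>J. a j)"
    have "0 \<le> P" unfolding P_def using a by (intro prod_nonneg) (auto intro: less_imp_le)
    have rs: "(a i * profile_integral d * t ^ Suc d + c * t ^ d) \<le> radial_sum (a i) t (\<lambda>s. s ^ d)"
    proof (cases "t = 0")
      case True
      then show ?thesis using assms by (simp add: radial_sum_def power_0_left)
    next
      case False
      then have "0 < t" using t by simp
      have "t ^ d * (a i * t * profile_integral d + c) \<le> radial_sum (a i) t (\<lambda>s. s ^ d)"
        unfolding radial_sum_power[OF a[of i, simplified] \<open>0 < t\<close>]
        using a \<open>0 < t\<close> by (intro mult_left_mono c) auto
      then show ?thesis by (simp add: algebra_simps)
    qed
    have "(unit_ball_vol (real (Suc d)) * (\<Prod>j\<in>insert i J. a j) * t ^ Suc d + 2 * w * c * P * t ^ d) / 2 ^ Suc d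
      = w * P / 2 ^ d * (a i * profile_integral d * t ^ Suc d + c * t ^ d)"
      using J unit_ball_vol_Suc[of d] by (simp add: w_def P_def field_simps)
    also have "\<dots> \<le> w * P / 2 ^ d * radial_sum (a i) t (\<lambda>s. s ^ d)"
      using \<open>0 \<le> P\<close> \<open>0 < w\<close> by (intro mult_left_mono rs) auto
    also have "\<dots> = radial_sum (a i) t (\<lambda>s. w * P / 2 ^ d * s ^ d)" by (simp only: radial_sum_cmult)
    also have "\<dots> \<le> radial_sum (a i) t (\<lambda>s. real (orthant_points J a s))"
      using a t J orthant_points_ge_volume[of J a] by (intro radial_sum_mono) (auto simp: w_def P_def)
    also have "\<dots> = real (orthant_points (insert i J) a t)"
      using J a t by (intro orthant_points_insert[symmetric]) auto
    finally show "(unit_ball_vol (real (Suc d)) * (\<Prod>j\<in>insert i J. a j) * t ^ Suc d + 2 * w * c * (\<Prod>j\<in>J. a j) * t ^ d) / 2 ^ Suc d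
       \<le> real (orthant_points (insert i J) a t)" by (simp only: P_def)
  qed
qed

section \<open>A lattice point error of smaller order than the surface\<close>

text \<open>Factoring a difference of squares gives the first difference of s exactly and makes the
  remainder explicit. The height bound \<open>\<kappa> * t\<close> keeps away from the end of the
  axis, where the tangent is vertical.\<close>

lemma sqrt_second_difference:
  fixes t \<alpha> \<kappa> x j :: real
  defines "s \<equiv> (\<lambda>x. sqrt (t\<^sup>2 - (x / \<alpha>)\<^sup>2))"
  assumes pos: "0 < \<alpha>" "0 < t" "0 < \<kappa>" "\<kappa> \<le> 1" "0 \<le> x" "0 \<le> j"
    and y: "x + j \<le> \<alpha> * t" "\<kappa> * t \<le> s (x + j)"
  shows "\<bar>s (x + j) - s x + j * x / (\<alpha>\<^sup>2 * s x)\<bar> \<le> j\<^sup>2 / (\<alpha>\<^sup>2 * \<kappa> ^ 3 * t)"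
proof -
  define p where "p = s x"
  define r where "r = s (x + j)"
  define y where "y = x + j"
  have "0 < \<kappa> * t" using pos by simp
  then have "0 < r" "\<kappa> * t \<le> r" using y(2) by (simp_all add: r_def)
  have ya: "(y / \<alpha>)\<^sup>2 \<le> t\<^sup>2" "(x / \<alpha>)\<^sup>2 \<le> (y / \<alpha>)\<^sup>2"
  proof -
    have "y / \<alpha> \<le> t" using pos y(1) by (simp add: y_def field_simps)
    then show "(y / \<alpha>)\<^sup>2 \<le> t\<^sup>2" using pos by (intro power_mono) (auto simp: y_def)
    show "(x / \<alpha>)\<^sup>2 \<le> (y / \<alpha>)\<^sup>2"
      using pos by (intro power_mono divide_right_mono) (auto simp: y_def)
  qed
  have "r \<le> p" unfolding r_def p_def s_def y_def[symmetric] using ya by simp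
  have "0 < p" "\<kappa> * t \<le> p" using \<open>r \<le> p\<close> \<open>0 < r\<close> \<open>\<kappa> * t \<le> r\<close> by linarith+
  have sq: "p\<^sup>2 = t\<^sup>2 - x\<^sup>2 / \<alpha>\<^sup>2" "r\<^sup>2 = t\<^sup>2 - y\<^sup>2 / \<alpha>\<^sup>2"
    using ya by (simp_all add: p_def r_def s_def y_def power_divide)
  have "(p - r) * (p + r) = j * (x + y) / \<alpha>\<^sup>2"
    using sq by (simp add: y_def power2_eq_square algebra_simps add_divide_distrib)
  moreover have "p - r = (p - r) * (p + r) / (p + r)"
    using \<open>0 < p\<close> \<open>0 < r\<close> by simp
  ultimately have pr: "p - r = j * (x + y) / (\<alpha>\<^sup>2 * (p + r))"
    by (simp only: divide_divide_eq_left)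
  \<comment> \<open>Apart from the sign in front, all factors are nonnegative, so the size follows
    from the lower bound on \<open>p + r\<close> and the upper bound on
    \<open>p - r\<close>.\<close>
  have id: "r - p + j * x / (\<alpha>\<^sup>2 * p) = - (j / (\<alpha>\<^sup>2 * (p + r))) * (x * (p - r) / p + j)"
  proof -
    have "r - p = - (j * (x + y) / (\<alpha>\<^sup>2 * (p + r)))" using pr by simp
    then have "r - p + j * x / (\<alpha>\<^sup>2 * p) = j / \<alpha>\<^sup>2 * (x / p - (x + y) / (p + r))"
      by (simp add: right_diff_distrib)
    also have "x / p - (x + y) / (p + r) = - ((x * (p - r) / p + j) / (p + r))"
    proof -
      have "p + r \<noteq> 0" using \<open>0 < p\<close> \<open>0 < r\<close> by simp
      then have "x / p = x * (p + r) / p / (p + r)" by simp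
      moreover have "x * (p + r) / p = x + x * r / p" "x * (p - r) / p = x - x * r / p"
        using \<open>0 < p\<close> \<open>0 < r\<close> by (simp_all add: distrib_left right_diff_distrib add_divide_distrib diff_divide_distrib)
      ultimately have "x / p - (x + y) / (p + r) = ((x + x * r / p) - (x + y)) / (p + r)"
        by (simp only: diff_divide_distrib)
      also have "(x + x * r / p) - (x + y) = - (x * (p - r) / p + j)"
        using \<open>0 < p\<close> by (simp add: y_def right_diff_distrib diff_divide_distrib)
      finally show ?thesis by (simp only: minus_divide_left)
    qed
    finally show ?thesis by simp
  qed
  have yb: "y \<le> \<alpha> * t" "x \<le> \<alpha> * t" "0 \<le> y" using pos y(1) by (auto simp: y_def)
  have sum2: "2 * (\<kappa> * t) \<le> p + r" using \<open>\<kappa> * t \<le> p\<close> \<open>\<kappa> * t \<le> r\<close> by linarith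
  have b1: "p - r \<le> j / (\<alpha> * \<kappa>)"
  proof -
    have "p - r \<le> j * (2 * (\<alpha> * t)) / (\<alpha>\<^sup>2 * (2 * (\<kappa> * t)))"
      unfolding pr using sum2 yb pos \<open>0 < \<kappa> * t\<close> by (intro frac_le mult_left_mono mult_pos_pos) auto
    also have "\<dots> = j / (\<alpha> * \<kappa>)" using pos by (simp add: power2_eq_square)
    finally show ?thesis .
  qed
  have b2: "x * (p - r) / p \<le> j / \<kappa>\<^sup>2"
  proof -
    have "x * (p - r) / p \<le> (\<alpha> * t) * (j / (\<alpha> * \<kappa>)) / (\<kappa> * t)"
      using b1 yb \<open>r \<le> p\<close> pos \<open>0 < \<kappa> * t\<close> \<open>\<kappa> * t \<le> p\<close> by (intro frac_le mult_mono) auto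
    also have "\<dots> = j / \<kappa>\<^sup>2" using pos by (simp add: power2_eq_square)
    finally show ?thesis .
  qed
  have b3: "j \<le> j / \<kappa>\<^sup>2"
  proof -
    have "\<kappa>\<^sup>2 \<le> 1" using pos by (simp add: power_le_one)
    then have "j * \<kappa>\<^sup>2 \<le> j * 1" using pos by (intro mult_left_mono) auto
    then show ?thesis using pos by (simp add: field_simps)
  qed
  have nn: "0 \<le> x * (p - r) / p" using pos \<open>r \<le> p\<close> \<open>0 < p\<close> by simp
  have "\<bar>r - p + j * x / (\<alpha>\<^sup>2 * p)\<bar> = j / (\<alpha>\<^sup>2 * (p + r)) * (x * (p - r) / p + j)"
    unfolding id using pos nn \<open>0 < p\<close> \<open>0 < r\<close> by (simp add: abs_mult)
  also have "\<dots> \<le> j / (\<alpha>\<^sup>2 * (2 * (\<kappa> * t))) * (2 * (j / \<kappa>\<^sup>2))"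
  proof (rule mult_mono)
    show "j / (\<alpha>\<^sup>2 * (p + r)) \<le> j / (\<alpha>\<^sup>2 * (2 * (\<kappa> * t)))"
      using pos sum2 \<open>0 < \<kappa> * t\<close> \<open>0 < p\<close> \<open>0 < r\<close> by (intro divide_left_mono mult_left_mono mult_pos_pos) auto
    show "x * (p - r) / p + j \<le> 2 * (j / \<kappa>\<^sup>2)" using b2 b3 by linarith
  qed (use pos nn \<open>0 < \<kappa> * t\<close> in auto)
  also have "\<dots> = j\<^sup>2 / (\<alpha>\<^sup>2 * \<kappa> ^ 3 * t)"
    using pos by (simp add: power2_eq_square power3_eq_cube)
  finally show ?thesis unfolding p_def r_def .
qed

text \<open>Up to the fraction w of the axis the slope of the arc is bounded and changes at a rate
  of order 1 / t, as the sawtooth estimate demands. The remaining summands, about a fraction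
  \<open>1 - w\<close>, are bounded by their number.\<close>

lemma ellipse_sawtooth_small:
  fixes lo hi \<epsilon> :: real
  assumes "0 < lo" "lo \<le> hi" "0 < \<epsilon>"
  obtains T where "0 < T"
    "\<And>t \<alpha> b. \<lbrakk>T \<le> t; lo \<le> \<alpha>; \<alpha> \<le> hi; lo \<le> b; b \<le> hi\<rbrakk>
      \<Longrightarrow> \<bar>\<Sum>m\<le>nat \<lfloor>\<alpha> * t\<rfloor>. (frac (b * sqrt (t\<^sup>2 - (real m / \<alpha>)\<^sup>2)) - 1/2)\<bar> \<le> \<epsilon> * t"
proof -
  have "0 < hi" using assms by simp
  \<comment> \<open>Makes the discarded stretch at most \<open>\<epsilon> / 4 * t\<close> long,
    while 1/2 keeps w positive. The threshold 8 / \<epsilon> chosen below absorbs two units of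
    rounding in the same way.\<close>
  define \<eta> where "\<eta> = min (1/2) (\<epsilon> / (4 * hi))"
  define w where "w = 1 - \<eta>"
  have w: "0 < w" "w < 1" "(1 - w) * hi \<le> \<epsilon> / 4"
  proof -
    show "0 < w" "w < 1" using assms \<open>0 < hi\<close> by (auto simp: w_def \<eta>_def)
    have "\<eta> * hi \<le> \<epsilon> / (4 * hi) * hi" using \<open>0 < hi\<close> by (intro mult_right_mono) (auto simp: \<eta>_def)
    then show "(1 - w) * hi \<le> \<epsilon> / 4" using \<open>0 < hi\<close> by (simp add: w_def)
  qed
  define \<kappa> where "\<kappa> = sqrt (1 - w\<^sup>2)"
  have "w\<^sup>2 < 1" using w by (simp add: abs_square_less_1)
  then have \<kappa>: "0 < \<kappa>" "\<kappa> \<le> 1" by (auto simp: \<kappa>_def)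
  \<comment> \<open>Besides the second difference, the constant has to bound the number of summands
    by \<open>C * t\<close>, hence the maximum with hi.\<close>
  define C where "C = max hi (hi / (lo\<^sup>2 * \<kappa> ^ 3))"
  define c where "c = lo / hi\<^sup>2"
  define B where "B = hi / (lo * \<kappa>)"
  have "0 < c" "0 \<le> C" using assms \<open>0 < hi\<close> by (auto simp: c_def C_def)
  obtain T0 where T0: "0 < T0"
    "\<And>t f g N. \<lbrakk>T0 \<le> t; real N \<le> C * t;
       \<And>x. x < N \<Longrightarrow> \<bar>g x\<bar> \<le> B;
       \<And>x y. x < y \<Longrightarrow> y < N \<Longrightarrow> c * (real y - real x) / t \<le> g x - g y;
       \<And>x j. x + j < N \<Longrightarrow> \<bar>f (x + j) - f x - real j * g x\<bar> \<le> C * (real j)\<^sup>2 / t\<rbrakk>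
     \<Longrightarrow> \<bar>\<Sum>x<N. (frac (f x) - 1/2)\<bar> \<le> \<epsilon> / 2 * t"
    using sawtooth_sum_small[OF \<open>0 < c\<close> \<open>0 \<le> C\<close> half_gt_zero[OF assms(3)], of B] by blast
  define T where "T = max T0 (8 / \<epsilon>)"
  show thesis
  proof
    show "0 < T" using T0 by (simp add: T_def)
    fix t \<alpha> b assume t: "T \<le> t" and ab: "lo \<le> \<alpha>" "\<alpha> \<le> hi" "lo \<le> b" "b \<le> hi"
    have "0 < t" "T0 \<le> t" "8 / \<epsilon> \<le> t" using t T0 by (auto simp: T_def)
    have pos: "0 < \<alpha>" "0 < b" using ab assms by auto
    define s where "s = (\<lambda>x. sqrt (t\<^sup>2 - (x / \<alpha>)\<^sup>2))"
    define f where "f m = b * s (real m)" for m :: nat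
    define g where "g m = - (b * real m / (\<alpha>\<^sup>2 * s (real m)))" for m :: nat
    define N where "N = nat \<lfloor>w * \<alpha> * t\<rfloor>"
    have wat: "0 \<le> w * \<alpha> * t" using w pos \<open>0 < t\<close> by simp
    have N: "real N \<le> w * \<alpha> * t" "w * \<alpha> * t - 1 \<le> real N" unfolding N_def using wat by linarith+
    have wle: "w * \<alpha> * t \<le> \<alpha> * t" using w pos \<open>0 < t\<close> by simp
    have s_ge: "\<kappa> * t \<le> s x" if "0 \<le> x" "x \<le> w * \<alpha> * t" for x
    proof -
      have "x / \<alpha> \<le> w * t" using that pos by (simp add: field_simps)
      then have "(x / \<alpha>)\<^sup>2 \<le> (w * t)\<^sup>2" using that pos by (intro power_mono) auto
      then have "(1 - w\<^sup>2) * t\<^sup>2 \<le> t\<^sup>2 - (x / \<alpha>)\<^sup>2" by (simp add: algebra_simps power_mult_distrib)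
      then have "sqrt ((1 - w\<^sup>2) * t\<^sup>2) \<le> s x" unfolding s_def by (rule real_sqrt_le_mono)
      then show ?thesis using \<open>0 < t\<close> by (simp add: \<kappa>_def real_sqrt_mult)
    qed
    have s_le: "s x \<le> t" for x unfolding s_def using \<open>0 < t\<close> by (intro real_le_lsqrt) auto
    have s_anti: "s y \<le> s x" if "0 \<le> x" "x \<le> y" for x y
      unfolding s_def using that pos by (intro real_sqrt_le_mono diff_left_mono power_mono divide_right_mono) auto
    have "0 < \<kappa> * t" using \<kappa> \<open>0 < t\<close> by simp
    have main: "\<bar>\<Sum>m<N. (frac (f m) - 1/2)\<bar> \<le> \<epsilon> / 2 * t"
    proof (rule T0(2)[where g = g])
      show "T0 \<le> t" by fact
      have "\<alpha> * t \<le> C * t" using ab \<open>0 < t\<close> by (intro mult_right_mono) (auto simp: C_def)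
      then show "real N \<le> C * t" using N wle by linarith
      have xN: "real x \<le> w * \<alpha> * t" if "x < N" for x using that N by linarith
      show "\<bar>g x\<bar> \<le> B" if "x < N" for x
      proof -
        have sx: "\<kappa> * t \<le> s (real x)" using s_ge xN[OF that] by simp
        have "\<bar>g x\<bar> = b * real x / (\<alpha>\<^sup>2 * s (real x))"
          using pos sx \<open>0 < \<kappa> * t\<close> by (simp add: g_def abs_mult)
        also have "\<dots> \<le> hi * (\<alpha> * t) / (\<alpha>\<^sup>2 * (\<kappa> * t))"
          using pos sx \<open>0 < \<kappa> * t\<close> ab order.trans[OF xN[OF that] wle] \<open>0 < hi\<close> \<open>0 < t\<close> by (intro frac_le mult_mono mult_left_mono) auto
        also have "\<dots> = hi / (\<alpha> * \<kappa>)" using pos \<open>0 < t\<close> by (simp add: power2_eq_square)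
        also have "\<dots> \<le> B" unfolding B_def using ab \<kappa> assms \<open>0 < hi\<close>
          by (intro divide_left_mono mult_right_mono mult_pos_pos) auto
        finally show ?thesis .
      qed
      show "c * (real y - real x) / t \<le> g x - g y" if "x < y" "y < N" for x y
      proof -
        have sy: "\<kappa> * t \<le> s (real y)" using s_ge xN[OF that(2)] by simp
        have sx: "s (real y) \<le> s (real x)" using s_anti that by simp
        have p: "0 < s (real y)" "0 < s (real x)" using sx sy \<open>0 < \<kappa> * t\<close> by linarith+
        \<comment> \<open>The quotient x / s x grows both because x grows and because s decreases;
          keeping the first effect alone gives the lower bound on the curvature.\<close>
        have "real x / s (real x) \<le> real x / s (real y)"
          using p sx by (intro divide_left_mono mult_pos_pos) auto
        then have "(real y - real x) / s (real y) \<le> real y / s (real y) - real x / s (real x)"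
          by (simp add: diff_divide_distrib)
        moreover have "(real y - real x) / t \<le> (real y - real x) / s (real y)"
          using that p s_le \<open>0 < t\<close> by (intro divide_left_mono mult_pos_pos) auto
        ultimately have 1: "(real y - real x) / t \<le> real y / s (real y) - real x / s (real x)" by linarith
        have "c \<le> b / \<alpha>\<^sup>2"
          unfolding c_def using ab pos assms by (intro frac_le power_mono) auto
        then have "c * ((real y - real x) / t) \<le> b / \<alpha>\<^sup>2 * ((real y - real x) / t)"
          using that \<open>0 < t\<close> by (intro mult_right_mono) auto
        also have "\<dots> \<le> b / \<alpha>\<^sup>2 * (real y / s (real y) - real x / s (real x))"
          using 1 pos by (intro mult_left_mono) auto
        also have "\<dots> = g x - g y" by (simp add: g_def right_diff_distrib)
        finally show ?thesis by simp
      qed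
      show "\<bar>f (x + j) - f x - real j * g x\<bar> \<le> C * (real j)\<^sup>2 / t" if "x + j < N" for x j
      proof -
        have "real x + real j \<le> w * \<alpha> * t" using xN[OF that] by simp
        moreover have "real x + real j \<le> \<alpha> * t" using calculation wle by linarith
        ultimately have "\<bar>s (real x + real j) - s (real x) + real j * real x / (\<alpha>\<^sup>2 * s (real x))\<bar> \<le> (real j)\<^sup>2 / (\<alpha>\<^sup>2 * \<kappa> ^ 3 * t)"
          unfolding s_def using s_ge[unfolded s_def, of "real x + real j"] pos \<open>0 < t\<close> \<kappa>
          by (intro sqrt_second_difference) auto
        then have "b * \<bar>s (real x + real j) - s (real x) + real j * real x / (\<alpha>\<^sup>2 * s (real x))\<bar> \<le> hi * ((real j)\<^sup>2 / (\<alpha>\<^sup>2 * \<kappa> ^ 3 * t))"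
          using ab pos by (intro mult_mono) auto
        also have "b * \<bar>s (real x + real j) - s (real x) + real j * real x / (\<alpha>\<^sup>2 * s (real x))\<bar>
            = \<bar>b * (s (real x + real j) - s (real x) + real j * real x / (\<alpha>\<^sup>2 * s (real x)))\<bar>"
          using pos by (simp add: abs_mult)
        also have "b * (s (real x + real j) - s (real x) + real j * real x / (\<alpha>\<^sup>2 * s (real x))) = f (x + j) - f x - real j * g x"
          by (simp add: f_def g_def algebra_simps)
        also have "hi * ((real j)\<^sup>2 / (\<alpha>\<^sup>2 * \<kappa> ^ 3 * t)) = hi / (\<alpha>\<^sup>2 * \<kappa> ^ 3) * ((real j)\<^sup>2 / t)" by simp
        also have "\<dots> \<le> C * ((real j)\<^sup>2 / t)"
        proof (rule mult_right_mono)
          have "hi / (\<alpha>\<^sup>2 * \<kappa> ^ 3) \<le> hi / (lo\<^sup>2 * \<kappa> ^ 3)"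
            using ab \<kappa> assms \<open>0 < hi\<close> pos by (intro divide_left_mono mult_right_mono power_mono mult_pos_pos) auto
          then show "hi / (\<alpha>\<^sup>2 * \<kappa> ^ 3) \<le> C" by (simp add: C_def)
        qed (use \<open>0 < t\<close> in auto)
        finally show ?thesis by simp
      qed
    qed
    have "0 \<le> \<alpha> * t" using pos \<open>0 < t\<close> by simp
    have NM: "N \<le> nat \<lfloor>\<alpha> * t\<rfloor>" unfolding N_def using wle by (intro nat_mono floor_mono)
    have "(\<Sum>m\<le>nat \<lfloor>\<alpha> * t\<rfloor>. (frac (f m) - 1/2)) = (\<Sum>m<N. (frac (f m) - 1/2)) + (\<Sum>m=N..nat \<lfloor>\<alpha> * t\<rfloor>. (frac (f m) - 1/2))"
      using NM sum.atLeastLessThan_concat[of 0 N "Suc (nat \<lfloor>\<alpha> * t\<rfloor>)" "\<lambda>m. frac (f m) - 1/2"]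
      by (simp only: atLeast0LessThan atMost_atLeast0 atLeastLessThanSuc_atLeastAtMost le_SucI zero_le)
    moreover have "\<bar>\<Sum>m=N..nat \<lfloor>\<alpha> * t\<rfloor>. (frac (f m) - 1/2)\<bar> \<le> \<epsilon> / 2 * t"
    proof -
      have half: "\<bar>frac z - 1/2\<bar> \<le> (1::real)" for z :: real
        using frac_ge_0[of z] frac_lt_1[of z] by argo
      have "\<bar>\<Sum>m=N..nat \<lfloor>\<alpha> * t\<rfloor>. (frac (f m) - 1/2)\<bar> \<le> (\<Sum>m=N..nat \<lfloor>\<alpha> * t\<rfloor>. 1)"
        by (rule order.trans[OF sum_abs sum_mono]) (rule half)
      also have "\<dots> = real (nat \<lfloor>\<alpha> * t\<rfloor>) + 1 - real N" using NM by (simp add: of_nat_diff)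
      also have "\<dots> \<le> \<alpha> * t + 2 - w * \<alpha> * t"
        using N of_nat_floor[OF \<open>0 \<le> \<alpha> * t\<close>] by linarith
      also have "\<dots> = (1 - w) * \<alpha> * t + 2" by (simp add: algebra_simps)
      also have "\<dots> \<le> \<epsilon> / 4 * t + \<epsilon> / 4 * t"
      proof (rule add_mono)
        have "(1 - w) * \<alpha> \<le> (1 - w) * hi" using w ab by (intro mult_left_mono) auto
        also note w(3)
        finally show "(1 - w) * \<alpha> * t \<le> \<epsilon> / 4 * t" using \<open>0 < t\<close> by (intro mult_right_mono) auto
        show "2 \<le> \<epsilon> / 4 * t" using \<open>8 / \<epsilon> \<le> t\<close> assms(3) by (simp add: field_simps)
      qed
      finally show ?thesis by (simp add: algebra_simps)
    qed
    moreover have "\<epsilon> * t = \<epsilon> / 2 * t + \<epsilon> / 2 * t" by simp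
    ultimately have "\<bar>\<Sum>m\<le>nat \<lfloor>\<alpha> * t\<rfloor>. (frac (f m) - 1/2)\<bar> \<le> \<epsilon> * t"
      using main by linarith
    then show "\<bar>\<Sum>m\<le>nat \<lfloor>\<alpha> * t\<rfloor>. (frac (b * sqrt (t\<^sup>2 - (real m / \<alpha>)\<^sup>2)) - 1/2)\<bar> \<le> \<epsilon> * t"
      by (simp add: f_def s_def)
  qed
qed


section \<open>From sawtooth sums to lattice points in every dimension\<close>

lemma radial_sum_power_trapezoid:
  assumes "1 \<le> d" "0 < \<epsilon>"
  obtains A0 where "0 < A0" "\<And>\<alpha> t. \<lbrakk>0 < \<alpha>; 0 < t; A0 \<le> \<alpha> * t\<rbrakk> \<Longrightarrow>
      \<bar>radial_sum \<alpha> t (\<lambda>s. s ^ d) - \<alpha> * profile_integral d * t ^ Suc d - t ^ d / 2\<bar> \<le> \<epsilon> * t ^ d"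
proof -
  obtain A0 where A0: "0 < A0" "\<And>A. A0 \<le> A \<Longrightarrow>
     \<bar>(\<Sum>m\<le>nat \<lfloor>A\<rfloor>. ball_profile d (real m / A)) - A * profile_integral d - 1 / 2\<bar> \<le> \<epsilon>"
    using sum_ball_profile_trapezoid[OF assms] by blast
  show thesis
  proof
    show "0 < A0" by fact
    fix \<alpha> t :: real assume pos: "0 < \<alpha>" "0 < t" and A: "A0 \<le> \<alpha> * t"
    define X where "X = (\<Sum>m\<le>nat \<lfloor>\<alpha> * t\<rfloor>. ball_profile d (real m / (\<alpha> * t)))"
    have "\<bar>t ^ d * (X - \<alpha> * t * profile_integral d - 1 / 2)\<bar> = t ^ d * \<bar>X - \<alpha> * t * profile_integral d - 1 / 2\<bar>"
      using pos by (simp add: abs_mult)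
    also have "\<dots> \<le> t ^ d * \<epsilon>"
      using A0(2)[OF A] pos unfolding X_def by (intro mult_left_mono) auto
    finally show "\<bar>radial_sum \<alpha> t (\<lambda>s. s ^ d) - \<alpha> * profile_integral d * t ^ Suc d - t ^ d / 2\<bar> \<le> \<epsilon> * t ^ d"
      unfolding radial_sum_power[OF pos] X_def[symmetric] by (simp add: algebra_simps)
  qed
qed

lemma lattice_points_singleton:
  assumes "0 < a j" "0 \<le> t"
  shows "real (lattice_points {j} a t) = 2 * (a j * t) - 2 * (frac (a j * t) - 1/2)"
proof -
  have "real (lattice_points {j} a t) = 2 * real (nat \<lfloor>a j * t\<rfloor>) + 1"
    using lattice_points_insert[of "{}" j a t] assms by (simp add: radial_sum_def)
  also have "real (nat \<lfloor>a j * t\<rfloor>) = a j * t - frac (a j * t)"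
    using assms by (simp add: frac_def)
  finally show ?thesis by simp
qed

text \<open>The boundary term \<open>t / 2\<close> of the trapezoidal rule, with its factor
  \<open>4 * a j\<close>, cancels against the \<open>2 * (a j * t)\<close> of the central slice.
  Left are the error of the rule, the sawtooth sum along the ellipse and a bounded term, each given
  a third of \<open>\<epsilon> * t\<close>.\<close>

lemma lattice_points_pair_little_o:
  fixes lo hi \<epsilon> :: real
  assumes "i \<noteq> j" "0 < lo" "lo \<le> hi" "0 < \<epsilon>"
  obtains T where "0 < T" "\<And>t a. \<lbrakk>T \<le> t; lo \<le> a i; a i \<le> hi; lo \<le> a j; a j \<le> hi\<rbrakk> \<Longrightarrow>
     \<bar>real (lattice_points {i, j} a t) - unit_ball_vol 2 * (a i * a j) * t\<^sup>2\<bar> \<le> \<epsilon> * t"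
proof -
  have "0 < hi" using assms by simp
  have e: "0 < \<epsilon> / (12 * hi)" "0 < \<epsilon> / 12" using assms \<open>0 < hi\<close> by auto
  obtain A0 where A0: "0 < A0" "\<And>\<alpha> t. \<lbrakk>0 < \<alpha>; 0 < t; A0 \<le> \<alpha> * t\<rbrakk> \<Longrightarrow>
      \<bar>radial_sum \<alpha> t (\<lambda>s. s ^ 1) - \<alpha> * profile_integral 1 * t ^ Suc 1 - t ^ 1 / 2\<bar> \<le> \<epsilon> / (12 * hi) * t ^ 1"
    using radial_sum_power_trapezoid[OF order.refl e(1)] by blast
  obtain T0 where T0: "0 < T0" "\<And>t \<alpha> b. \<lbrakk>T0 \<le> t; lo \<le> \<alpha>; \<alpha> \<le> hi; lo \<le> b; b \<le> hi\<rbrakk>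
      \<Longrightarrow> \<bar>\<Sum>m\<le>nat \<lfloor>\<alpha> * t\<rfloor>. (frac (b * sqrt (t\<^sup>2 - (real m / \<alpha>)\<^sup>2)) - 1/2)\<bar> \<le> \<epsilon> / 12 * t"
    using ellipse_sawtooth_small[OF assms(2,3) e(2)] by blast
  define T where "T = max (max T0 (A0 / lo)) (3 / \<epsilon>)"
  show thesis
  proof
    show "0 < T" using T0 by (simp add: T_def less_max_iff_disj)
    fix t and a :: "nat \<Rightarrow> real"
    assume t: "T \<le> t" and a: "lo \<le> a i" "a i \<le> hi" "lo \<le> a j" "a j \<le> hi"
    have t': "T0 \<le> t" "A0 / lo \<le> t" "3 / \<epsilon> \<le> t" "0 < t" using t \<open>0 < T\<close> by (auto simp: T_def)
    have pos: "0 < a i" "0 < a j" using a assms by auto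
    define R where "R = radial_sum (a i) t (\<lambda>s. s ^ 1)"
    define \<Psi> where "\<Psi> = (\<Sum>m\<le>nat \<lfloor>a i * t\<rfloor>. (frac (a j * sqrt (t\<^sup>2 - (real m / a i)\<^sup>2)) - 1/2))"
    have "real (lattice_points {i, j} a t) = 2 * radial_sum (a i) t (\<lambda>s. real (lattice_points {j} a s)) - real (lattice_points {j} a t)"
      using lattice_points_insert[of "{j}" i a t] assms pos \<open>0 < t\<close> by auto
    also have "radial_sum (a i) t (\<lambda>s. real (lattice_points {j} a s)) = radial_sum (a i) t (\<lambda>s. 2 * a j * s ^ 1 - 2 * (frac (a j * s) - 1/2))"
      unfolding radial_sum_def
    proof (rule sum.cong[OF refl])
      fix m assume "m \<in> {..nat \<lfloor>a i * t\<rfloor>}"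
      then show "real (lattice_points {j} a (sqrt (t\<^sup>2 - (real m / a i)\<^sup>2))) = 2 * a j * sqrt (t\<^sup>2 - (real m / a i)\<^sup>2) ^ 1 - 2 * (frac (a j * sqrt (t\<^sup>2 - (real m / a i)\<^sup>2)) - 1/2)"
        using radial_arg(1)[of "a i" t m] pos \<open>0 < t\<close> by (subst lattice_points_singleton) auto
    qed
    also have "\<dots> = 2 * a j * R - 2 * \<Psi>"
      unfolding radial_sum_diff[of _ _ "\<lambda>s. 2 * a j * s ^ 1"] radial_sum_cmult R_def \<Psi>_def radial_sum_def ..
    also have "real (lattice_points {j} a t) = 2 * (a j * t) - 2 * (frac (a j * t) - 1/2)"
      using pos \<open>0 < t\<close> by (intro lattice_points_singleton) auto
    finally have L: "real (lattice_points {i, j} a t) = 2 * (2 * a j * R - 2 * \<Psi>) - (2 * (a j * t) - 2 * (frac (a j * t) - 1/2))" .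
    have "unit_ball_vol 2 = 4 * profile_integral 1"
      using unit_ball_vol_Suc[of 1] by simp
    then have V: "unit_ball_vol 2 * (a i * a j) * t\<^sup>2 = 4 * a j * (a i * profile_integral 1 * t ^ Suc 1)"
      by (simp add: power2_eq_square)
    have "real (lattice_points {i, j} a t) - unit_ball_vol 2 * (a i * a j) * t\<^sup>2
       = 4 * a j * (R - a i * profile_integral 1 * t ^ Suc 1 - t ^ 1 / 2) - 4 * \<Psi> + (2 * frac (a j * t) - 1)"
      unfolding L V by (simp add: algebra_simps)
    moreover have "\<bar>4 * a j * (R - a i * profile_integral 1 * t ^ Suc 1 - t ^ 1 / 2)\<bar> \<le> \<epsilon> * t / 3"
    proof -
      have "A0 \<le> lo * t" using t'(2) assms by (simp add: field_simps)
      also have "\<dots> \<le> a i * t" using a t' by (intro mult_right_mono) auto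
      finally have "\<bar>R - a i * profile_integral 1 * t ^ Suc 1 - t ^ 1 / 2\<bar> \<le> \<epsilon> / (12 * hi) * t ^ 1"
        unfolding R_def using pos t' by (intro A0(2))
      then have "\<bar>4 * a j\<bar> * \<bar>R - a i * profile_integral 1 * t ^ Suc 1 - t ^ 1 / 2\<bar> \<le> 4 * hi * (\<epsilon> / (12 * hi) * t ^ 1)"
        using a pos \<open>0 < hi\<close> by (intro mult_mono) auto
      then show ?thesis using \<open>0 < hi\<close> by (simp only: abs_mult) simp
    qed
    moreover have "\<bar>4 * \<Psi>\<bar> \<le> \<epsilon> * t / 3"
      using T0(2)[OF t'(1) a] unfolding \<Psi>_def[symmetric] by (simp add: abs_mult)
    moreover have "\<bar>2 * frac (a j * t) - 1\<bar> \<le> \<epsilon> * t / 3"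
    proof -
      have "1 \<le> \<epsilon> * t / 3" using t'(3) assms(4) by (simp add: field_simps)
      then show ?thesis using frac_ge_0[of "a j * t"] frac_lt_1[of "a j * t"] by argo
    qed
    moreover have "\<bar>x - y + z\<bar> \<le> e" if "\<bar>x\<bar> \<le> e / 3" "\<bar>y\<bar> \<le> e / 3" "\<bar>z\<bar> \<le> e / 3" for x y z e :: real
      using that by argo
    ultimately show "\<bar>real (lattice_points {i, j} a t) - unit_ball_vol 2 * (a i * a j) * t\<^sup>2\<bar> \<le> \<epsilon> * t"
      by metis
  qed
qed

text \<open>About \<open>a i * t\<close> slices, each with error
  \<open>\<delta> * t ^ (d - 1)\<close>, add up to the order \<open>\<delta> * t ^ d\<close>, and
  the boundary term of the Riemann sum again cancels the central slice. Thus smallness of the error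
  passes from dimension d to d + 1, and oscillation has to be treated only in the plane.\<close>

lemma lattice_points_little_o:
  fixes lo hi :: real
  assumes "finite J" "2 \<le> card J" "0 < lo" "lo \<le> hi" "0 < \<epsilon>"
  obtains T where "0 < T" "\<And>t a. \<lbrakk>T \<le> t; \<And>i. i \<in> J \<Longrightarrow> lo \<le> a i \<and> a i \<le> hi\<rbrakk> \<Longrightarrow>
     \<bar>real (lattice_points J a t) - unit_ball_vol (real (card J)) * (\<Prod>i\<in>J. a i) * t ^ card J\<bar> \<le> \<epsilon> * t ^ (card J - 1)"
proof -
  have "\<exists>T>0. \<forall>t\<ge>T. \<forall>a. (\<forall>i\<in>J. lo \<le> a i \<and> a i \<le> hi) \<longrightarrow>
     \<bar>real (lattice_points J a t) - unit_ball_vol (real (card J)) * (\<Prod>i\<in>J. a i) * t ^ card J\<bar> \<le> \<epsilon> * t ^ (card J - 1)"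
    using assms(1,2,5)
  proof (induction J arbitrary: \<epsilon> rule: finite_induct)
    case (insert i J)
    have hi: "0 < hi" using assms(3,4) by simp
    show ?case
    proof (cases "card J = 1")
      case True
      then obtain j where J: "J = {j}" by (metis card_1_singletonE)
      then have "i \<noteq> j" using insert.hyps by auto
      obtain T where "0 < T" "\<And>t a. \<lbrakk>T \<le> t; lo \<le> a i; a i \<le> hi; lo \<le> a j; a j \<le> hi\<rbrakk> \<Longrightarrow>
         \<bar>real (lattice_points {i, j} a t) - unit_ball_vol 2 * (a i * a j) * t\<^sup>2\<bar> \<le> \<epsilon> * t"
        using lattice_points_pair_little_o[OF \<open>i \<noteq> j\<close> assms(3,4) insert.prems(2)] by blast
      then show ?thesis using \<open>i \<noteq> j\<close> by (auto simp: J numeral_2_eq_2 intro!: exI[of _ T])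
    next
      case False
      define d where "d = card J"
      have d: "2 \<le> d" using False insert.prems insert.hyps by (simp add: d_def)
      define w where "w = unit_ball_vol (real d)"
      have "0 \<le> w" by (simp add: w_def)
      \<comment> \<open>The weights of the three errors: slice errors, error of the Riemann sum,
        central slice.\<close>
      define k where "k = 2 * (hi + 1) + 2 * (w * hi ^ d) + 1"
      have "0 < k" using hi mult_nonneg_nonneg[OF \<open>0 \<le> w\<close>, of "hi ^ d"] by (simp add: k_def)
      define \<delta> where "\<delta> = \<epsilon> / k"
      have "0 < \<delta>" using \<open>0 < k\<close> insert.prems by (simp add: \<delta>_def)
      obtain T0 where T0: "0 < T0" "\<And>t a. T0 \<le> t \<Longrightarrow> \<forall>i\<in>J. lo \<le> a i \<and> a i \<le> hi \<Longrightarrow>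
         \<bar>real (lattice_points J a t) - w * (\<Prod>i\<in>J. a i) * t ^ d\<bar> \<le> \<delta> * t ^ (d - 1)"
        using insert.IH[of \<delta>] d \<open>0 < \<delta>\<close> unfolding w_def d_def by blast
      obtain C where C: "0 \<le> C" "\<And>a t. \<lbrakk>\<And>i. i \<in> J \<Longrightarrow> 0 < a i \<and> a i \<le> hi; 0 \<le> t\<rbrakk> \<Longrightarrow>
         \<bar>real (lattice_points J a t) - unit_ball_vol (real (card J)) * (\<Prod>i\<in>J. a i) * t ^ card J\<bar>
            \<le> C * (if card J = 0 then 0 else (1 + t) ^ (card J - 1))"
        using lattice_points_approx[OF insert.hyps(1), of hi] hi by (auto intro: less_imp_le)
      obtain A0 where A0: "0 < A0" "\<And>\<alpha> t. \<lbrakk>0 < \<alpha>; 0 < t; A0 \<le> \<alpha> * t\<rbrakk> \<Longrightarrow>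
          \<bar>radial_sum \<alpha> t (\<lambda>s. s ^ d) - \<alpha> * profile_integral d * t ^ Suc d - t ^ d / 2\<bar> \<le> \<delta> * t ^ d"
        using radial_sum_power_trapezoid[of d \<delta>] d \<open>0 < \<delta>\<close> by auto
      define T where "T = max (max T0 (A0 / lo)) (max 1 (C * (1 + T0) ^ (d - 1) / \<delta>))"
      show ?thesis
      proof (intro exI[of _ T] conjI allI impI)
        show "0 < T" by (simp add: T_def less_max_iff_disj)
        fix t and a :: "nat \<Rightarrow> real"
        assume t: "T \<le> t" and a: "\<forall>j\<in>insert i J. lo \<le> a j \<and> a j \<le> hi"
        have t': "T0 \<le> t" "A0 / lo \<le> t" "1 \<le> t" "C * (1 + T0) ^ (d - 1) / \<delta> \<le> t" using t by (auto simp: T_def)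
        have ai: "0 < a i" "lo \<le> a i" "a i \<le> hi" using a assms(3) by auto
        have apos: "0 < a j \<and> a j \<le> hi" if "j \<in> J" for j using a assms(3) that by force
        define P where "P = (\<Prod>j\<in>J. a j)"
        have P: "0 \<le> P" "P \<le> hi ^ d" unfolding P_def d_def using apos by (auto intro!: prod_le_power_hi)
        have tp: "t \<le> t ^ (d - 1)" using t' d self_le_power[of t "d - 1"] by simp
        have small: "\<bar>real (lattice_points J a s) - w * P * s ^ d\<bar> \<le> \<delta> * t ^ (d - 1)" if s: "0 \<le> s" "s \<le> t" for s
        proof (cases "T0 \<le> s")
          case True
          then have "\<bar>real (lattice_points J a s) - w * P * s ^ d\<bar> \<le> \<delta> * s ^ (d - 1)"
            unfolding P_def using T0(2) a by auto
          also have "\<dots> \<le> \<delta> * t ^ (d - 1)" using s \<open>0 < \<delta>\<close> by (intro mult_left_mono power_mono) auto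
          finally show ?thesis .
        next
          \<comment> \<open>Slices of radius below T0 are outside the reach of the inductive bound.
            Their error is bounded by a constant, which is at most \<open>\<delta> * t\<close> and
            hence at most \<open>\<delta> * t ^ (d - 1)\<close> because d \<ge> 2.\<close>
          case False
          have "\<bar>real (lattice_points J a s) - w * P * s ^ d\<bar> \<le> C * (1 + s) ^ (d - 1)"
            using C(2)[of a s] apos s d by (simp add: w_def P_def d_def)
          also have "\<dots> \<le> C * (1 + T0) ^ (d - 1)" using s C(1) False by (intro mult_left_mono power_mono) auto
          also have "\<dots> \<le> \<delta> * t" using t'(4) \<open>0 < \<delta>\<close> by (simp add: field_simps)
          also have "\<dots> \<le> \<delta> * t ^ (d - 1)" using tp \<open>0 < \<delta>\<close> by (intro mult_left_mono) auto
          finally show ?thesis .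
        qed
        define R where "R = radial_sum (a i) t (\<lambda>s. s ^ d)"
        have td: "t ^ d = t * t ^ (d - 1)" using d by (simp add: power_eq_if)
        have 1: "\<bar>radial_sum (a i) t (\<lambda>s. real (lattice_points J a s)) - w * P * R\<bar> \<le> (hi + 1) * \<delta> * t ^ d"
        proof -
          have "\<bar>radial_sum (a i) t (\<lambda>s. real (lattice_points J a s)) - w * P * R\<bar> \<le> (a i * t + 1) * (\<delta> * t ^ (d - 1))"
            using radial_sum_abs_le[OF ai(1), of t "\<lambda>s. real (lattice_points J a s) - w * P * s ^ d"] small t'
            by (simp add: radial_sum_diff radial_sum_cmult R_def)
          also have "\<dots> \<le> ((hi + 1) * t) * (\<delta> * t ^ (d - 1))"
          proof (rule mult_right_mono)
            have "a i * t \<le> hi * t" using ai t' by (intro mult_right_mono) auto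
            then show "a i * t + 1 \<le> (hi + 1) * t" unfolding distrib_right using t'(3) by linarith
          qed (use \<open>0 < \<delta>\<close> t' in auto)
          finally show ?thesis by (simp only: td mult_ac)
        qed
        have 2: "\<bar>w * P * (R - a i * profile_integral d * t ^ Suc d - t ^ d / 2)\<bar> \<le> w * hi ^ d * (\<delta> * t ^ d)"
        proof -
          have "A0 \<le> lo * t" using t'(2) assms by (simp add: field_simps)
          also have "\<dots> \<le> a i * t" using ai t' by (intro mult_right_mono) auto
          finally have "\<bar>R - a i * profile_integral d * t ^ Suc d - t ^ d / 2\<bar> \<le> \<delta> * t ^ d"
            unfolding R_def using ai t' by (intro A0(2)) auto
          then show ?thesis
            unfolding abs_mult using P \<open>0 \<le> w\<close> hi by (intro mult_mono) auto
        qed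
        have 3: "\<bar>real (lattice_points J a t) - w * P * t ^ d\<bar> \<le> \<delta> * t ^ d"
        proof -
          have "\<bar>real (lattice_points J a t) - w * P * t ^ d\<bar> \<le> \<delta> * t ^ (d - 1)" using small t' by simp
          also have "\<dots> \<le> \<delta> * t ^ d" using t' \<open>0 < \<delta>\<close> by (intro mult_left_mono power_increasing) auto
          finally show ?thesis .
        qed
        have rec: "real (lattice_points (insert i J) a t) = 2 * radial_sum (a i) t (\<lambda>s. real (lattice_points J a s)) - real (lattice_points J a t)"
          using insert.hyps ai apos t' by (intro lattice_points_insert) auto
        have main: "unit_ball_vol (real (Suc d)) * (\<Prod>j\<in>insert i J. a j) * t ^ Suc d = 2 * (w * P * (a i * profile_integral d * t ^ Suc d))"
          using insert.hyps by (simp only: unit_ball_vol_Suc) (simp add: w_def P_def)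
        have "real (lattice_points (insert i J) a t) - unit_ball_vol (real (Suc d)) * (\<Prod>j\<in>insert i J. a j) * t ^ Suc d
           = 2 * (radial_sum (a i) t (\<lambda>s. real (lattice_points J a s)) - w * P * R)
             + 2 * (w * P * (R - a i * profile_integral d * t ^ Suc d - t ^ d / 2))
             - (real (lattice_points J a t) - w * P * t ^ d)"
          unfolding rec main by (simp add: algebra_simps)
        moreover have "\<bar>2 * x + 2 * y - z\<bar> \<le> 2 * X + 2 * Y + Z"
          if "\<bar>x\<bar> \<le> X" "\<bar>y\<bar> \<le> Y" "\<bar>z\<bar> \<le> Z" for x y z X Y Z :: real
          using that by (simp only: abs_le_iff) argo
        ultimately have "\<bar>real (lattice_points (insert i J) a t) - unit_ball_vol (real (Suc d)) * (\<Prod>j\<in>insert i J. a j) * t ^ Suc d\<bar>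
          \<le> 2 * ((hi + 1) * \<delta> * t ^ d) + 2 * (w * hi ^ d * (\<delta> * t ^ d)) + \<delta> * t ^ d"
          using 1 2 3 by metis
        also have "\<dots> = k * \<delta> * t ^ d" by (simp add: k_def algebra_simps)
        also have "k * \<delta> = \<epsilon>" using \<open>0 < k\<close> by (simp add: \<delta>_def)
        finally show "\<bar>real (lattice_points (insert i J) a t) - unit_ball_vol (real (card (insert i J))) * (\<Prod>j\<in>insert i J. a j) * t ^ card (insert i J)\<bar>
          \<le> \<epsilon> * t ^ (card (insert i J) - 1)"
          using insert.hyps by (simp add: d_def)
      qed
    qed
  qed simp
  then show thesis using that by metis
qed

section \<open>The Neumann eigenvalues and their counting function\<close>

text \<open>The rank of an element is the number of its predecessors in the order by f, with ties
  broken by an enumeration of X. Finite sublevel sets make ranks finite; the set of ranks is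
  downward closed and infinite, hence all of \<open>nat\<close>.\<close>

lemma exists_monotone_listing:
  fixes f :: "'x \<Rightarrow> real"
  assumes "infinite X" "countable X" and fin: "\<And>\<Lambda>. finite {x \<in> X. f x \<le> \<Lambda>}"
  obtains e :: "nat \<Rightarrow> 'x" where "bij_betw e UNIV X" "mono (\<lambda>k. f (e k))"
proof -
  define c where "c = to_nat_on X"
  have c: "inj_on c X" unfolding c_def by (rule inj_on_to_nat_on[OF assms(2)])
  define prec where "prec x y \<longleftrightarrow> f x < f y \<or> (f x = f y \<and> c x < c y)" for x y
  define r where "r x = card {y \<in> X. prec y x}" for x
  have finp: "finite {y \<in> X. prec y x}" for x
    by (rule finite_subset[OF _ fin[of "f x"]]) (auto simp: prec_def)
  have r_less: "r x < r y" if "x \<in> X" "prec x y" for x y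
  proof -
    have "{z \<in> X. prec z x} \<subset> {z \<in> X. prec z y}"
      using that by (auto simp: prec_def)
    then show ?thesis unfolding r_def by (rule psubset_card_mono[OF finp])
  qed
  have total: "prec x y \<or> prec y x" if "x \<in> X" "y \<in> X" "x \<noteq> y" for x y
    using that inj_onD[OF c, of x y] unfolding prec_def by (metis linorder_less_linear)
  have inj: "inj_on r X"
    by (rule inj_onI) (metis total r_less less_irrefl)
  have down: "m \<in> r ` X" if "x \<in> X" "m < r x" for x m
  proof -
    have "r ` {y \<in> X. prec y x} \<subseteq> {..<r x}" using r_less by auto
    moreover have "card (r ` {y \<in> X. prec y x}) = card {..<r x}"
      using card_image[OF inj_on_subset[OF inj, of "{y \<in> X. prec y x}"]] by (auto simp: r_def)
    ultimately have "r ` {y \<in> X. prec y x} = {..<r x}"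
      by (intro card_subset_eq) auto
    then show ?thesis using that by (metis (no_types, lifting) image_iff lessThan_iff mem_Collect_eq)
  qed
  have "infinite (r ` X)" using assms(1) inj by (simp add: finite_image_iff)
  have "r ` X = UNIV"
  proof (intro equalityI subset_UNIV subsetI)
    fix m :: nat
    obtain l where "m < l" "l \<in> r ` X"
      using \<open>infinite (r ` X)\<close> by (meson infinite_nat_iff_unbounded)
    then show "m \<in> r ` X" using down by auto
  qed
  with inj have bij: "bij_betw r X UNIV" by (simp add: bij_betw_def)
  define e where "e = inv_into X r"
  have e: "bij_betw e UNIV X" unfolding e_def by (rule bij_betw_inv_into[OF bij])
  have re: "r (e k) = k" "e k \<in> X" for k
    using bij e \<open>r ` X = UNIV\<close> by (auto simp: e_def f_inv_into_f bij_betw_def inv_into_into)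
  have "mono (\<lambda>k. f (e k))"
  proof (rule monoI)
    fix k l :: nat assume "k \<le> l"
    have "\<not> prec (e l) (e k)"
      using r_less[of "e l" "e k"] re \<open>k \<le> l\<close> by auto
    then show "f (e k) \<le> f (e l)" by (auto simp: prec_def)
  qed
  with e show thesis by (rule that)
qed

text \<open>The values of a monotone listing depend on the counting function alone, whatever the
  order within an eigenspace. This provides both the uniqueness behind the definite description and
  the translation into lattice points.\<close>

lemma monotone_listing_le_iff:
  fixes f :: "'x \<Rightarrow> real"
  assumes "bij_betw e UNIV X" "mono (\<lambda>k. f (e k))" "\<And>\<Lambda>. finite {x \<in> X. f x \<le> \<Lambda>}"
  shows "f (e k) \<le> \<Lambda> \<longleftrightarrow> k < card {x \<in> X. f x \<le> \<Lambda>}"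
proof -
  have eq: "{x \<in> X. f x \<le> \<Lambda>} = e ` {j. f (e j) \<le> \<Lambda>}"
    using assms(1) by (auto simp: bij_betw_def)
  have inj: "inj e" using assms(1) by (simp add: bij_betw_def)
  have card: "card {x \<in> X. f x \<le> \<Lambda>} = card {j. f (e j) \<le> \<Lambda>}"
    unfolding eq by (intro card_image inj_on_subset[OF inj]) auto
  have fin: "finite {j. f (e j) \<le> \<Lambda>}"
    using assms(3)[of \<Lambda>] inj unfolding eq by (simp add: finite_image_iff inj_on_subset)
  show ?thesis
  proof (cases "f (e k) \<le> \<Lambda>")
    case True
    then have "{..k} \<subseteq> {j. f (e j) \<le> \<Lambda>}"
      using monoD[OF assms(2)] order.trans by blast
    then have "card {..k} \<le> card {j. f (e j) \<le> \<Lambda>}" by (rule card_mono[OF fin])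
    then show ?thesis using True card by simp
  next
    case False
    then have "{j. f (e j) \<le> \<Lambda>} \<subseteq> {..<k}"
      using monoD[OF assms(2), of k] by (force simp: not_less[symmetric])
    then have "card {j. f (e j) \<le> \<Lambda>} \<le> card {..<k}" by (intro card_mono) auto
    then show ?thesis using False card by simp
  qed
qed

section \<open>The spectrum as a lattice point count\<close>

lemma multi_indices_countable: "countable (multi_indices n)"
  unfolding multi_indices_def by (intro countable_PiE) auto

lemma multi_indices_infinite:
  assumes "1 \<le> n"
  shows "infinite (multi_indices n)"
proof
  assume fin: "finite (multi_indices n)"
  have "inj (\<lambda>m::nat. restrict (\<lambda>_. m) {1..n})"
    using assms by (intro injI) (auto simp: fun_eq_iff restrict_def split: if_splits)
  moreover have "range (\<lambda>m::nat. restrict (\<lambda>_. m) {1..n}) \<subseteq> multi_indices n"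
    by (auto simp: multi_indices_def)
  ultimately show False using fin by (meson finite_imageD finite_subset infinite_UNIV_nat)
qed

lemma neumann_eigenvalue_le_iff:
  "neumann_eigenvalue n a m \<le> \<Lambda> \<longleftrightarrow> (\<Sum>i=1..n. (real (m i))\<^sup>2 / (a i)\<^sup>2) \<le> \<Lambda> / pi\<^sup>2"
proof -
  have "neumann_eigenvalue n a m = pi\<^sup>2 * (\<Sum>i=1..n. (real (m i))\<^sup>2 / (a i)\<^sup>2)"
    by (simp add: neumann_eigenvalue_def sum_distrib_left)
  then show ?thesis by (simp add: field_simps)
qed

lemma finite_neumann_sublevel:
  assumes "\<And>i. i \<in> {1..n} \<Longrightarrow> 0 < a i"
  shows "finite {m \<in> multi_indices n. neumann_eigenvalue n a m \<le> \<Lambda>}"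
  unfolding neumann_eigenvalue_le_iff multi_indices_def
  using assms by (intro finite_sublevel finite_sublevel_nat) auto

lemma neumann_mu_le_iff:
  assumes "1 \<le> n" "\<And>i. i \<in> {1..n} \<Longrightarrow> 0 < a i"
  shows "neumann_mu n a k \<le> \<Lambda> \<longleftrightarrow> k < card {m \<in> multi_indices n. neumann_eigenvalue n a m \<le> \<Lambda>}"
proof -
  define Q where "Q \<mu> \<longleftrightarrow> mono \<mu> \<and>
        (\<exists>e. bij_betw e UNIV (multi_indices n) \<and> (\<forall>k. \<mu> k = neumann_eigenvalue n a (e k)))" for \<mu> :: "nat \<Rightarrow> real"
  have fin: "finite {m \<in> multi_indices n. neumann_eigenvalue n a m \<le> \<Lambda>}" for \<Lambda>
    by (rule finite_neumann_sublevel) (use assms in auto)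
  have le_iff: "\<mu> k \<le> \<Lambda> \<longleftrightarrow> k < card {m \<in> multi_indices n. neumann_eigenvalue n a m \<le> \<Lambda>}"
    if "Q \<mu>" for \<mu> k \<Lambda>
  proof -
    obtain e where e': "bij_betw e UNIV (multi_indices n)" "\<forall>k. \<mu> k = neumann_eigenvalue n a (e k)" "mono \<mu>"
      using \<open>Q \<mu>\<close> unfolding Q_def by blast
    then have e: "bij_betw e UNIV (multi_indices n)" "\<mu> = (\<lambda>k. neumann_eigenvalue n a (e k))" "mono \<mu>"
      by auto
    show ?thesis
      using monotone_listing_le_iff[OF e(1) e(3)[unfolded e(2)] fin] e(2) by simp
  qed
  obtain e :: "nat \<Rightarrow> nat \<Rightarrow> nat" where "bij_betw e UNIV (multi_indices n)" "mono (\<lambda>k. neumann_eigenvalue n a (e k))"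
    by (rule exists_monotone_listing[OF multi_indices_infinite[OF assms(1)] multi_indices_countable fin])
  then have ex: "Q (\<lambda>k. neumann_eigenvalue n a (e k))"
    unfolding Q_def by (intro conjI exI[of _ e] allI refl)
  \<comment> \<open>Two listings with the same counting function bound each other: \<Lambda> is
    taken to be the value of either one.\<close>
  have "\<mu> = \<nu>" if "Q \<mu>" "Q \<nu>" for \<mu> \<nu>
    using le_iff[OF that(1)] le_iff[OF that(2)] by (intro ext antisym) (metis order.refl)+
  with ex have "Q (THE \<mu>. Q \<mu>)" by (intro theI[of Q]) auto
  then have "Q (neumann_mu n a)" unfolding neumann_mu_def Q_def .
  then show ?thesis by (rule le_iff)
qed

lemma neumann_mu_le_iff_orth:
  assumes "1 \<le> n" "\<And>i. i \<in> {1..n} \<Longrightarrow> 0 < a i"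
  shows "neumann_mu n a k \<le> pi\<^sup>2 * t\<^sup>2 \<longleftrightarrow> k < orthant_points {1..n} a t"
  using neumann_mu_le_iff[of n a k "pi\<^sup>2 * t\<^sup>2"] assms
  by (simp add: neumann_eigenvalue_le_iff orthant_points_def sublevel_count_def multi_indices_def)

lemma lattice_count_eq_lat: "lattice_count n a t = lattice_points {1..n} a t"
  by (simp add: lattice_count_def lattice_points_def sublevel_count_def)

section \<open>Maximising cuboids\<close>

lemma unit_cube: "unit_cuboid n (\<lambda>_. 1)"
  by (simp add: unit_cuboid_def monotone_on_def)

lemma orthant_points_mono:
  assumes "finite J" "\<And>i. i \<in> J \<Longrightarrow> 0 < a i" "0 \<le> s" "s \<le> t"
  shows "orthant_points J a s \<le> orthant_points J a t"
proof -
  have "s\<^sup>2 \<le> t\<^sup>2" using assms by (intro power_mono) auto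
  then show ?thesis
    unfolding orthant_points_def sublevel_count_def
    using assms(1,2) by (intro card_mono finite_sublevel finite_sublevel_nat) (auto intro: order.trans)
qed

text \<open>The comparison stops short of t because at t itself the count of the maximiser may
  already exceed k, for instance when the maximiser is the cube.\<close>

lemma maximiser_comparison:
  assumes "1 \<le> n" "maximises_mu n k b"
  obtains t where "0 \<le> t" "k < orthant_points {1..n} (\<lambda>_. 1) t" "\<And>s. 0 \<le> s \<Longrightarrow> s < t \<Longrightarrow> orthant_points {1..n} b s \<le> k"
proof -
  define M where "M = neumann_mu n (\<lambda>_. 1) k"
  have "0 \<le> M"
  proof (rule ccontr)
    assume "\<not> 0 \<le> M"
    moreover have "0 \<le> neumann_eigenvalue n (\<lambda>_. 1) m" for m
      by (simp add: neumann_eigenvalue_def sum_nonneg)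
    ultimately have "{m \<in> multi_indices n. neumann_eigenvalue n (\<lambda>_. 1) m \<le> M} = {}"
      by (auto simp: not_le intro: less_le_trans)
    then have "card {m \<in> multi_indices n. neumann_eigenvalue n (\<lambda>_. 1) m \<le> M} = 0"
      by (simp only: card.empty)
    then show False
      using neumann_mu_le_iff[of n "\<lambda>_. 1" k M] assms(1) unfolding M_def by simp
  qed
  define t where "t = sqrt M / pi"
  have M: "pi\<^sup>2 * t\<^sup>2 = M" "0 \<le> t"
    using \<open>0 \<le> M\<close> by (simp_all add: t_def power_divide)
  have b: "0 < b i" if "i \<in> {1..n}" for i
    using assms(2) that by (simp add: maximises_mu_def unit_cuboid_def)
  show thesis
  proof
    show "0 \<le> t" by fact
    show "k < orthant_points {1..n} (\<lambda>_. 1) t"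
      using neumann_mu_le_iff_orth[of n "\<lambda>_. 1" k t] assms(1) by (simp add: M M_def)
    fix s assume s: "0 \<le> s" "s < t"
    then have "s\<^sup>2 < t\<^sup>2" by (intro power_strict_mono) auto
    then have "pi\<^sup>2 * s\<^sup>2 < M" unfolding M(1)[symmetric] by simp
    also have "M \<le> neumann_mu n b k"
      using assms(2) unit_cube unfolding M_def maximises_mu_def by blast
    finally show "orthant_points {1..n} b s \<le> k"
      using neumann_mu_le_iff_orth[of n b k s] assms(1) b by auto
  qed
qed

text \<open>The counts may jump at t but the main terms are continuous, so bounds obtained to the
  left of t carry over to t.\<close>

lemma le_at_right_endpoint:
  fixes F :: "real \<Rightarrow> real"
  assumes "isCont F t" "l < t" "\<And>s. l < s \<Longrightarrow> s < t \<Longrightarrow> F s \<le> G"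
  shows "F t \<le> G"
proof (rule tendsto_upperbound[of F "F t" "at_left t"])
  show "(F \<longlongrightarrow> F t) (at_left t)"
    using assms(1) unfolding isCont_def by (rule filterlim_mono) (auto simp: at_within_le_at)
  show "\<forall>\<^sub>F s in at_left t. F s \<le> G"
    using assms(2,3) by (auto simp: eventually_at_left[of l t])
qed auto

section \<open>A priori bounds for the sides\<close>

lemma orthant_points_cube_le:
  assumes "1 \<le> n"
  obtains C where "0 \<le> C" "\<And>t. 1 \<le> t \<Longrightarrow>
    2 ^ n * real (orthant_points {1..n} (\<lambda>_. 1) t) \<le> unit_ball_vol (real n) * t ^ n + C * t ^ (n - 1)"
proof -
  obtain C1 where C1: "0 \<le> C1" "\<And>a t. \<lbrakk>\<And>i. i \<in> {1..n} \<Longrightarrow> 0 < a i \<and> a i \<le> 1; 0 \<le> t\<rbrakk> \<Longrightarrow>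
     \<bar>real (lattice_points {1..n} a t) - unit_ball_vol (real (card {1..n})) * (\<Prod>i\<in>{1..n}. a i) * t ^ card {1..n}\<bar>
        \<le> C1 * (if card {1..n} = 0 then 0 else (1 + t) ^ (card {1..n} - 1))"
    by (rule lattice_points_approx[of "{1..n}" 1]) (auto simp del: card_atLeastAtMost)
  obtain C2 where C2: "0 \<le> C2" "\<And>a t. \<lbrakk>\<And>i. i \<in> {1..n} \<Longrightarrow> 0 < a i \<and> a i \<le> 1; 0 \<le> t\<rbrakk> \<Longrightarrow>
     \<bar>2 ^ card {1..n} * real (orthant_points {1..n} a t) - real (lattice_points {1..n} a t)
        - unit_ball_vol (real (card {1..n} - 1)) * (\<Sum>i\<in>{1..n}. \<Prod>j\<in>{1..n} - {i}. a j) * t ^ (card {1..n} - 1)\<bar>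
        \<le> C2 * (if card {1..n} \<le> 1 then 0 else (1 + t) ^ (card {1..n} - 2))"
    by (rule orthant_points_lat_approx[of "{1..n}" 1]) (auto simp del: card_atLeastAtMost)
  define w where "w = unit_ball_vol (real (n - 1))"
  have "0 \<le> w" by (simp add: w_def)
  show thesis
  proof
    show "0 \<le> (C1 + C2) * 2 ^ (n - 1) + w * real n" using C1 C2 \<open>0 \<le> w\<close> by simp
    fix t :: real assume t: "1 \<le> t"
    have p: "(1 + t) ^ (n - 1) \<le> 2 ^ (n - 1) * t ^ (n - 1)"
      unfolding power_mult_distrib[symmetric] using t by (intro power_mono) auto
    have "real (lattice_points {1..n} (\<lambda>_. 1) t) \<le> unit_ball_vol (real n) * t ^ n + C1 * (1 + t) ^ (n - 1)"
      using C1(2)[of "\<lambda>_. 1" t] t assms by simp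
    also have "C1 * (1 + t) ^ (n - 1) \<le> C1 * (2 ^ (n - 1) * t ^ (n - 1))"
      using p C1(1) by (intro mult_left_mono) auto
    finally have 1: "real (lattice_points {1..n} (\<lambda>_. 1) t) \<le> unit_ball_vol (real n) * t ^ n + C1 * (2 ^ (n - 1) * t ^ (n - 1))" by simp
    have "C2 * (if n \<le> 1 then 0 else (1 + t) ^ (n - 2)) \<le> C2 * (1 + t) ^ (n - 1)"
      using t C2(1) by (intro mult_left_mono) (auto intro!: power_increasing)
    also have "\<dots> \<le> C2 * (2 ^ (n - 1) * t ^ (n - 1))"
      using p C2(1) by (intro mult_left_mono) auto
    finally have 2: "2 ^ n * real (orthant_points {1..n} (\<lambda>_. 1) t) - real (lattice_points {1..n} (\<lambda>_. 1) t) \<le> w * real n * t ^ (n - 1) + C2 * (2 ^ (n - 1) * t ^ (n - 1))"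
      using C2(2)[of "\<lambda>_. 1" t] t by (simp add: w_def cong: if_cong) linarith
    show "2 ^ n * real (orthant_points {1..n} (\<lambda>_. 1) t) \<le> unit_ball_vol (real n) * t ^ n + ((C1 + C2) * 2 ^ (n - 1) + w * real n) * t ^ (n - 1)"
      using 1 2 by (simp add: algebra_simps)
  qed
qed

lemma insert_Icc_endpoints:
  assumes "1 \<le> (n::nat)"
  shows "insert 1 {2..n} = {1..n}" "insert n {1..n - 1} = {1..n}"
  using assms by auto

lemma unit_cuboid_sides:
  assumes "unit_cuboid n b" "1 \<le> n" "i \<in> {1..n}"
  shows "0 < b i" "b 1 \<le> b i" "b i \<le> b n" "1 \<le> b 1 * b n ^ (n - 1)" "b n * b 1 ^ (n - 1) \<le> 1"
    and "1 \<le> b n"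
proof -
  have pos: "0 < b j" if "j \<in> {1..n}" for j using assms(1) that by (simp add: unit_cuboid_def)
  have mono: "b j \<le> b l" if "j \<in> {1..n}" "l \<in> {1..n}" "j \<le> l" for j l
    using assms(1) that unfolding unit_cuboid_def monotone_on_def by blast
  have prod: "(\<Prod>j\<in>{1..n}. b j) = 1" using assms(1) by (simp add: unit_cuboid_def)
  show "0 < b i" "b 1 \<le> b i" "b i \<le> b n" using assms(2,3) by (auto intro!: pos mono)
  have "1 = b 1 * (\<Prod>j\<in>{2..n}. b j)"
    using prod unfolding insert_Icc_endpoints(1)[OF assms(2), symmetric] by simp
  also have "\<dots> \<le> b 1 * (\<Prod>j\<in>{2..n}. b n)"
    using assms(2) by (intro mult_left_mono prod_mono) (auto intro!: less_imp_le[OF pos] mono)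
  finally show "1 \<le> b 1 * b n ^ (n - 1)" by simp
  have "b n * b 1 ^ (n - 1) = b n * (\<Prod>j\<in>{1..n - 1}. b 1)" by simp
  also have "\<dots> \<le> b n * (\<Prod>j\<in>{1..n - 1}. b j)"
    using assms(2) by (intro mult_left_mono prod_mono) (auto intro!: less_imp_le[OF pos] mono)
  also have "\<dots> = (\<Prod>j\<in>insert n {1..n - 1}. b j)" using assms(2) by (subst prod.insert) auto
  also have "\<dots> = 1" unfolding insert_Icc_endpoints(2)[OF assms(2)] by (rule prod)
  finally show "b n * b 1 ^ (n - 1) \<le> 1" .
  have "1 \<le> (\<Prod>j\<in>{1..n}. b n)"
    unfolding prod[symmetric] using assms(2) by (intro prod_mono) (auto intro!: less_imp_le[OF pos] mono)
  then have "1 \<le> b n ^ n" by simp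
  then show "1 \<le> b n"
    using power_less_one_iff[of "b n" n] pos[of n] assms(2) by (meson atLeastAtMost_iff not_less order.refl less_imp_le zero_less_one_class.zero_le_one less_le_trans zero_less_one)
qed

text \<open>The volume terms of the maximiser's lower bound and the cube's upper bound cancel. What
  remains is \<open>c / b 1 \<le> C\<close>, so the shortest side cannot degenerate, and the product
  1 then bounds the longest.\<close>

lemma maximiser_sides_bounded:
  assumes "2 \<le> n"
  obtains H where "1 \<le> H" "\<And>b t k i. \<lbrakk>unit_cuboid n b; 1 \<le> t; k < orthant_points {1..n} (\<lambda>_. 1) t;
      \<And>s. 0 \<le> s \<Longrightarrow> s < t \<Longrightarrow> orthant_points {1..n} b s \<le> k; i \<in> {1..n}\<rbrakk> \<Longrightarrow> 1 / H \<le> b i \<and> b i \<le> H"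
proof -
  have n1: "1 \<le> n" "1 \<le> n - 1" "Suc (n - 1) = n" using assms by auto
  obtain c where c: "0 < c" "\<And>J i (a :: nat \<Rightarrow> real) t. \<lbrakk>finite J; i \<notin> J; card J = n - 1; \<And>j. j \<in> insert i J \<Longrightarrow> 0 < a j; 0 \<le> t\<rbrakk> \<Longrightarrow>
     (unit_ball_vol (real (Suc (n - 1))) * (\<Prod>j\<in>insert i J. a j) * t ^ Suc (n - 1) + c * (\<Prod>j\<in>J. a j) * t ^ (n - 1)) / 2 ^ Suc (n - 1)
       \<le> real (orthant_points (insert i J) a t)"
    using orthant_points_ge_volume_excess[OF n1(2)] by blast
  obtain C where C: "0 \<le> C" "\<And>t. 1 \<le> t \<Longrightarrow>
    2 ^ n * real (orthant_points {1..n} (\<lambda>_. 1) t) \<le> unit_ball_vol (real n) * t ^ n + C * t ^ (n - 1)"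
    using orthant_points_cube_le[OF n1(1)] by blast
  define B where "B = max 1 (C / c)"
  have B: "1 \<le> B" by (simp add: B_def)
  show thesis
  proof
    \<comment> \<open>The shortest side is at least 1 / B, and then
      \<open>b n * b 1 ^ (n - 1) \<le> 1\<close> bounds the longest by \<open>B ^ (n - 1)\<close>,
      which serves as H on both ends.\<close>
    show "1 \<le> B ^ (n - 1)" using B by simp
    fix b t k i assume b: "unit_cuboid n b" and t: "1 \<le> t" and k: "k < orthant_points {1..n} (\<lambda>_. 1) t"
      and le: "\<And>s. 0 \<le> s \<Longrightarrow> s < t \<Longrightarrow> orthant_points {1..n} b s \<le> k" and i: "i \<in> {1..n}"
    note sides = unit_cuboid_sides[OF b n1(1)]
    have b1: "0 < b 1" using sides(1)[of 1] n1 by simp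
    have prod: "(\<Prod>j\<in>{1..n}. b j) = 1" using b by (simp add: unit_cuboid_def)
    then have P: "(\<Prod>j\<in>{2..n}. b j) = 1 / b 1"
      using b1 unfolding insert_Icc_endpoints(1)[OF n1(1), symmetric] by (simp add: field_simps)
    have "unit_ball_vol (real n) * t ^ n + c / b 1 * t ^ (n - 1) \<le> 2 ^ n * real k"
    proof (rule le_at_right_endpoint[where F = "\<lambda>s. unit_ball_vol (real n) * s ^ n + c / b 1 * s ^ (n - 1)" and l = 0])
      fix s :: real assume s: "0 < s" "s < t"
      have "(unit_ball_vol (real n) * s ^ n + c / b 1 * s ^ (n - 1)) / 2 ^ n \<le> real (orthant_points {1..n} b s)"
        using c(2)[of "{2..n}" 1 b s] sides(1) s unfolding P insert_Icc_endpoints(1)[OF n1(1)] prod n1(3) by simp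
      also have "\<dots> \<le> real k" using le[of s] s by simp
      finally show "unit_ball_vol (real n) * s ^ n + c / b 1 * s ^ (n - 1) \<le> 2 ^ n * real k"
        by (simp add: field_simps)
    qed (use t b1 in \<open>auto intro!: continuous_intros\<close>)
    also have "\<dots> \<le> 2 ^ n * real (orthant_points {1..n} (\<lambda>_. 1) t)" using k by simp
    also have "\<dots> \<le> unit_ball_vol (real n) * t ^ n + C * t ^ (n - 1)" by (rule C(2)[OF t])
    finally have "c / b 1 * t ^ (n - 1) \<le> C * t ^ (n - 1)" by simp
    then have "c / b 1 \<le> C" using t by (intro mult_right_le_imp_le[of "c / b 1" "t ^ (n - 1)" C]) auto
    then have "1 / b 1 \<le> C / c" using c(1) b1 by (simp add: field_simps)
    then have "1 / b 1 \<le> B" by (simp add: B_def)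
    then have lo: "1 / B \<le> b 1" using b1 B by (simp add: field_simps)
    have hi: "b n \<le> B ^ (n - 1)"
    proof -
      have "b n * (1 / B) ^ (n - 1) \<le> b n * b 1 ^ (n - 1)"
        using lo B sides(1)[of n] n1 by (intro mult_left_mono power_mono) auto
      also have "\<dots> \<le> 1" using sides(5)[OF i] .
      finally show ?thesis using B by (simp add: power_divide field_simps)
    qed
    have "B \<le> B ^ (n - 1)" using B n1 by (intro self_le_power) auto
    then have "1 / B ^ (n - 1) \<le> 1 / B" using B by (intro divide_left_mono) auto
    then show "1 / B ^ (n - 1) \<le> b i \<and> b i \<le> B ^ (n - 1)"
      using lo hi sides(2,3)[OF i] by linarith
  qed
qed

text \<open>The lattice error is a parameter, so that one comparison serves both an admissible
  exponent and the error of smaller order than the surface, taken with \<theta> = n - 1. It enters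
  once for the maximiser and once for the cube, hence the factor 2.\<close>

lemma reciprocal_sum_bound:
  assumes "2 \<le> n" "1 \<le> H"
  obtains C where "0 \<le> C" "\<And>b t k T E \<theta>. \<lbrakk>unit_cuboid n b; \<And>i. i \<in> {1..n} \<Longrightarrow> 1 / H \<le> b i \<and> b i \<le> H;
      1 \<le> T; T < t; k < orthant_points {1..n} (\<lambda>_. 1) t;
      \<And>s. 0 \<le> s \<Longrightarrow> s < t \<Longrightarrow> orthant_points {1..n} b s \<le> k;
      \<And>a s. \<lbrakk>\<And>i. i \<in> {1..n} \<Longrightarrow> 1 / H \<le> a i \<and> a i \<le> H; T \<le> s\<rbrakk> \<Longrightarrow>
        \<bar>real (lattice_points {1..n} a s) - unit_ball_vol (real n) * (\<Prod>i\<in>{1..n}. a i) * s ^ n\<bar> \<le> E * s powr \<theta>\<rbrakk>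
    \<Longrightarrow> unit_ball_vol (real (n - 1)) * ((\<Sum>i\<in>{1..n}. 1 / b i) - real n) * t ^ (n - 1)
          \<le> 2 * E * t powr \<theta> + C * t ^ (n - 2)"
proof -
  define J where "J = {1..n}"
  have J: "finite J" "card J = n" by (auto simp: J_def)
  obtain C where C: "0 \<le> C" "\<And>a t. \<lbrakk>\<And>i. i \<in> J \<Longrightarrow> 0 < a i \<and> a i \<le> H; 0 \<le> t\<rbrakk> \<Longrightarrow>
     \<bar>2 ^ card J * real (orthant_points J a t) - real (lattice_points J a t)
        - unit_ball_vol (real (card J - 1)) * (\<Sum>i\<in>J. \<Prod>j\<in>J - {i}. a j) * t ^ (card J - 1)\<bar>
        \<le> C * (if card J \<le> 1 then 0 else (1 + t) ^ (card J - 2))"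
    using orthant_points_lat_approx[OF J(1), of H] assms(2) by auto
  define w where "w = unit_ball_vol (real (n - 1))"
  define W where "W = unit_ball_vol (real n)"
  show thesis
  proof
    show "0 \<le> 2 * C * 2 ^ (n - 2)" using C by simp
    fix b t k T E \<theta> assume b: "unit_cuboid n b" and bH: "\<And>i. i \<in> {1..n} \<Longrightarrow> 1 / H \<le> b i \<and> b i \<le> H"
      and T: "1 \<le> T" "T < t" and k: "k < orthant_points {1..n} (\<lambda>_. 1) t"
      and le: "\<And>s. 0 \<le> s \<Longrightarrow> s < t \<Longrightarrow> orthant_points {1..n} b s \<le> k"
      and err: "\<And>a s. \<lbrakk>\<And>i. i \<in> {1..n} \<Longrightarrow> 1 / H \<le> a i \<and> a i \<le> H; T \<le> s\<rbrakk> \<Longrightarrow>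
        \<bar>real (lattice_points {1..n} a s) - unit_ball_vol (real n) * (\<Prod>i\<in>{1..n}. a i) * s ^ n\<bar> \<le> E * s powr \<theta>"
    have pos: "0 < b i" if "i \<in> J" for i using b that by (simp add: unit_cuboid_def J_def)
    have prod: "(\<Prod>i\<in>J. b i) = 1" using b by (simp add: unit_cuboid_def J_def)
    define Q where "Q = (\<Sum>i\<in>{1..n}. 1 / b i)"
    have Q: "(\<Sum>i\<in>J. \<Prod>j\<in>J - {i}. b j) = Q"
      unfolding Q_def J_def[symmetric]
    proof (rule sum.cong[OF refl])
      fix i assume i: "i \<in> J"
      have "b i * (\<Prod>j\<in>J - {i}. b j) = 1" using prod.remove[OF J(1) i, of b] prod by simp
      then show "(\<Prod>j\<in>J - {i}. b j) = 1 / b i" using pos[OF i] by (simp add: field_simps)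
    qed
    have "W * t ^ n - E * t powr \<theta> + w * Q * t ^ (n - 1) - C * (1 + t) ^ (n - 2) \<le> 2 ^ n * real k"
    proof (rule le_at_right_endpoint[where F = "\<lambda>s. W * s ^ n - E * s powr \<theta> + w * Q * s ^ (n - 1) - C * (1 + s) ^ (n - 2)" and l = T])
      fix s assume s: "T < s" "s < t"
      have "\<bar>2 ^ n * real (orthant_points J b s) - real (lattice_points J b s) - w * Q * s ^ (n - 1)\<bar> \<le> C * (1 + s) ^ (n - 2)"
        using C(2)[of b s] pos bH s T assms(1) unfolding J(2) Q w_def[symmetric] by (auto simp: J_def)
      moreover have "\<bar>real (lattice_points J b s) - W * s ^ n\<bar> \<le> E * s powr \<theta>"
        using err[of b s] bH s unfolding J_def[symmetric] prod W_def by auto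
      moreover have "2 ^ n * real (orthant_points J b s) \<le> 2 ^ n * real k"
        using le[of s] s T by (simp add: J_def)
      ultimately show "W * s ^ n - E * s powr \<theta> + w * Q * s ^ (n - 1) - C * (1 + s) ^ (n - 2) \<le> 2 ^ n * real k"
        by linarith
    qed (use T in \<open>auto intro!: continuous_intros\<close>)
    also have "\<dots> \<le> 2 ^ n * real (orthant_points J (\<lambda>_. 1) t)" using k by (simp add: J_def)
    also have "\<dots> \<le> W * t ^ n + E * t powr \<theta> + w * real n * t ^ (n - 1) + C * (1 + t) ^ (n - 2)"
    proof -
      have "\<bar>2 ^ n * real (orthant_points J (\<lambda>_. 1) t) - real (lattice_points J (\<lambda>_. 1) t) - w * real n * t ^ (n - 1)\<bar> \<le> C * (1 + t) ^ (n - 2)"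
        using C(2)[of "\<lambda>_. 1" t] T assms by (simp add: J(2) w_def)
      moreover have "\<bar>real (lattice_points J (\<lambda>_. 1) t) - W * t ^ n\<bar> \<le> E * t powr \<theta>"
        using err[of "\<lambda>_. 1" t] T assms by (simp add: J_def W_def)
      ultimately show ?thesis by linarith
    qed
    finally have "w * (Q - real n) * t ^ (n - 1) \<le> 2 * E * t powr \<theta> + 2 * (C * (1 + t) ^ (n - 2))"
      by (simp add: algebra_simps)
    also have "C * (1 + t) ^ (n - 2) \<le> C * (2 * t) ^ (n - 2)"
      using T C(1) by (intro mult_left_mono power_mono) auto
    finally show "unit_ball_vol (real (n - 1)) * ((\<Sum>i\<in>{1..n}. 1 / b i) - real n) * t ^ (n - 1)
          \<le> 2 * E * t powr \<theta> + 2 * C * 2 ^ (n - 2) * t ^ (n - 2)"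
      by (simp add: w_def Q_def power_mult_distrib)
  qed
qed

text \<open>Both sides vanish at 1, and on [1, H] the derivative \<open>(y - 1) / y\<^sup>2\<close>
  of the right side dominates the derivative \<open>(y - 1) / H\<^sup>2\<close> of the left.\<close>

lemma quadratic_le_reciprocal_ln:
  assumes "1 \<le> x" "x \<le> H"
  shows "(x - 1)\<^sup>2 / (2 * H\<^sup>2) \<le> 1 / x - 1 + ln (x::real)"
proof -
  define \<psi> where "\<psi> y = 1 / y - 1 + ln y - (y - 1)\<^sup>2 / (2 * H\<^sup>2)" for y :: real
  have "\<psi> 1 \<le> \<psi> x"
  proof (rule DERIV_nonneg_imp_nondecreasing[OF assms(1)])
    fix y assume y: "1 \<le> y" "y \<le> x"
    have "(\<psi> has_real_derivative (- 1 / y\<^sup>2 + 1 / y - (y - 1) / H\<^sup>2)) (at y)"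
      unfolding \<psi>_def using y assms
      by (auto intro!: derivative_eq_intros simp: power2_eq_square diff_divide_distrib)
    moreover have "- 1 / y\<^sup>2 + 1 / y = (y - 1) / y\<^sup>2"
      using y by (simp add: field_simps power2_eq_square)
    moreover have "(y - 1) / H\<^sup>2 \<le> (y - 1) / y\<^sup>2"
      using y assms by (intro divide_left_mono power_mono mult_pos_pos) auto
    ultimately show "\<exists>D. (\<psi> has_real_derivative D) (at y) \<and> 0 \<le> D" by force
  qed
  then show ?thesis by (simp add: \<psi>_def)
qed

text \<open>The logarithms of the sides sum to 0, so they may be added freely. Afterwards every
  summand is nonnegative, and the one of the longest side alone gives the bound.\<close>

lemma reciprocal_sum_excess:
  assumes "unit_cuboid n b" "1 \<le> n" "b n \<le> H"
  shows "(b n - 1)\<^sup>2 / (2 * H\<^sup>2) \<le> (\<Sum>i\<in>{1..n}. 1 / b i) - real n"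
proof -
  have pos: "0 < b i" if "i \<in> {1..n}" for i using assms(1) that by (simp add: unit_cuboid_def)
  have nonneg: "0 \<le> 1 / b i - 1 + ln (b i)" if "i \<in> {1..n}" for i
    using ln_le_minus_one[of "1 / b i"] pos[OF that] by (simp add: ln_div)
  have "ln (\<Prod>i\<in>{1..n}. b i) = (\<Sum>i\<in>{1..n}. ln (b i))"
    using pos by (intro ln_prod) force+
  then have "(\<Sum>i\<in>{1..n}. ln (b i)) = 0" using assms(1) by (simp add: unit_cuboid_def)
  then have eq: "(\<Sum>i\<in>{1..n}. 1 / b i - 1 + ln (b i)) = (\<Sum>i\<in>{1..n}. 1 / b i) - real n"
    by (simp add: sum.distrib sum_subtractf)
  have "(b n - 1)\<^sup>2 / (2 * H\<^sup>2) \<le> 1 / b n - 1 + ln (b n)"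
    using unit_cuboid_sides(6)[OF assms(1,2), of n] assms(2,3) by (intro quadratic_le_reciprocal_ln) auto
  also have "\<dots> \<le> (\<Sum>i\<in>{1..n}. 1 / b i - 1 + ln (b i))"
    using nonneg assms(2) by (intro member_le_sum[of n "{1..n}" "\<lambda>i. 1 / b i - 1 + ln (b i)"]) auto
  finally show ?thesis unfolding eq .
qed

text \<open>
  For the unit cube the count only changes when \<open>t\<^sup>2\<close> is an integer, while the main term grows by
  a multiple of \<open>t ^ (n - 2)\<close> as \<open>t\<^sup>2\<close> increases by \<open>1/2\<close>.
\<close>
lemma admissible_exponent_ge:
  assumes "2 \<le> n" "admissible_exponent n \<theta>"
  shows "real n - 2 \<le> \<theta>"
proof (rule ccontr)
  assume "\<not> real n - 2 \<le> \<theta>"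
  then have neg: "\<theta> - (real n - 2) < 0" by simp
  define w where "w = unit_ball_vol (real n)"
  have "0 < w" by (simp add: w_def)
  obtain C where C: "\<forall>\<^sub>F t in at_top. \<forall>a. (\<forall>i\<in>{1..n}. a i \<in> {1}) \<longrightarrow>
      \<bar>real (lattice_count n a t) - w * t ^ n * (\<Prod>i=1..n. a i)\<bar> \<le> C * t powr \<theta>"
    using assms(2)[unfolded admissible_exponent_def, rule_format, of "{1}"] unfolding w_def by auto
  \<comment> \<open>Makes the error at most \<open>w / 8 * t ^ (n - 2)\<close> at both radii, the
    power of 2 accounting for u \<le> 2 t. Together w / 4 falls short of the factor w / 2 by which
    the main term grows.\<close>
  define \<delta> where "\<delta> = w / (8 * ((\<bar>C\<bar> + 1) * 2 ^ (n - 2)))"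
  have "0 < \<delta>" using \<open>0 < w\<close> by (auto simp: \<delta>_def intro!: divide_pos_pos mult_pos_pos)
  have "((\<lambda>t::real. t powr (\<theta> - (real n - 2))) \<longlongrightarrow> 0) at_top"
    by (rule tendsto_neg_powr[OF neg filterlim_ident])
  then have "\<forall>\<^sub>F t::real in at_top. t powr (\<theta> - (real n - 2)) < \<delta>"
    using \<open>0 < \<delta>\<close> by (rule order_tendstoD)
  with C have "\<forall>\<^sub>F t in at_top. \<bar>real (lattice_count n (\<lambda>_. 1) t) - w * t ^ n\<bar> \<le> C * t powr \<theta>
      \<and> t powr (\<theta> - (real n - 2)) < \<delta>"
    by eventually_elim auto
  then obtain t0 where t0: "\<And>t. t0 \<le> t \<Longrightarrow> \<bar>real (lattice_count n (\<lambda>_. 1) t) - w * t ^ n\<bar> \<le> C * t powr \<theta>"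
      "\<And>t. t0 \<le> t \<Longrightarrow> t powr (\<theta> - (real n - 2)) < \<delta>"
    unfolding eventually_at_top_linorder by blast
  obtain m :: nat where m: "(max t0 1)\<^sup>2 \<le> real m" using real_arch_simple by blast
  define t where "t = sqrt (real m)"
  define u where "u = sqrt (real m + 1/2)"
  have "max t0 1 \<le> t" unfolding t_def using m by (rule real_le_rsqrt)
  then have t: "t0 \<le> t" "1 \<le> t" by auto
  have "t \<le> u" by (simp add: t_def u_def)
  have "u \<le> 2 * t"
  proof -
    have "1 \<le> real m" using m by (smt (verit, best) max.cobounded2 one_le_power)
    then have "u \<le> sqrt (2\<^sup>2 * real m)" unfolding u_def by (intro real_sqrt_le_mono) simp
    then show ?thesis by (simp add: t_def real_sqrt_mult)
  qed
  have sq: "t\<^sup>2 = real m" "u\<^sup>2 = real m + 1/2" by (simp_all add: t_def u_def)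
  have same: "lattice_count n (\<lambda>_. 1) u = lattice_count n (\<lambda>_. 1) t"
  proof -
    have "(\<Sum>i=1..n. (real_of_int (z i))\<^sup>2 / 1\<^sup>2) \<le> real m + 1/2 \<longleftrightarrow> (\<Sum>i=1..n. (real_of_int (z i))\<^sup>2 / 1\<^sup>2) \<le> real m" for z :: "nat \<Rightarrow> int"
    proof -
      have "(\<Sum>i=1..n. (real_of_int (z i))\<^sup>2 / 1\<^sup>2) = real_of_int (\<Sum>i=1..n. (z i)\<^sup>2)" by simp
      moreover have "real_of_int y \<le> real m + 1/2 \<longleftrightarrow> real_of_int y \<le> real m" for y
      proof
        assume "real_of_int y \<le> real m + 1/2"
        then have "real_of_int y < real_of_int (int m + 1)" by simp
        then have "y < int m + 1" by (simp only: of_int_less_iff)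
        then show "real_of_int y \<le> real m" by linarith
      qed simp
      ultimately show ?thesis by (simp only:)
    qed
    then show ?thesis unfolding lattice_count_def sq by simp
  qed
  have bound: "C * s powr \<theta> \<le> w / 8 * t ^ (n - 2)" if "t \<le> s" "s \<le> u" for s
  proof -
    have s: "0 < s" "t0 \<le> s" "s \<le> 2 * t" using that t \<open>u \<le> 2 * t\<close> by auto
    have "s powr \<theta> = s powr (\<theta> - (real n - 2)) * s powr (real n - 2)"
      by (simp add: powr_add[symmetric])
    also have "s powr (real n - 2) = s ^ (n - 2)"
      using s(1) assms(1) by (simp add: powr_realpow[symmetric] of_nat_diff)
    finally have sp: "s powr \<theta> = s powr (\<theta> - (real n - 2)) * s ^ (n - 2)" .
    have "C * s powr \<theta> \<le> (\<bar>C\<bar> + 1) * s powr \<theta>" by (intro mult_right_mono) auto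
    also have "(\<bar>C\<bar> + 1) * s powr \<theta> = (\<bar>C\<bar> + 1) * (s powr (\<theta> - (real n - 2)) * s ^ (n - 2))"
      by (simp only: sp)
    also have "(\<bar>C\<bar> + 1) * (s powr (\<theta> - (real n - 2)) * s ^ (n - 2)) \<le> (\<bar>C\<bar> + 1) * (\<delta> * (2 * t) ^ (n - 2))"
      using t0(2)[OF s(2)] s t \<open>0 < \<delta>\<close> by (intro mult_left_mono mult_mono power_mono) auto
    also have "\<dots> = (\<bar>C\<bar> + 1) * 2 ^ (n - 2) * \<delta> * t ^ (n - 2)" by (simp add: power_mult_distrib)
    also have "(\<bar>C\<bar> + 1) * 2 ^ (n - 2) * \<delta> = w / 8" by (simp add: \<delta>_def)
    finally show ?thesis .
  qed
  have "w * (u ^ n - t ^ n) \<le> C * u powr \<theta> + C * t powr \<theta>"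
    using t0(1)[of u] t0(1)[of t] t \<open>t \<le> u\<close> same by (simp add: right_diff_distrib)
  also have "\<dots> \<le> w / 4 * t ^ (n - 2)"
    using bound[of u] bound[of t] \<open>t \<le> u\<close> by simp
  finally have upper: "w * (u ^ n - t ^ n) \<le> w / 4 * t ^ (n - 2)" .
  have "1/2 * t ^ (n - 2) \<le> u ^ n - t ^ n"
  proof -
    have split: "x ^ n = x\<^sup>2 * x ^ (n - 2)" for x :: real
      using assms(1) by (metis le_add_diff_inverse power_add)
    have "u\<^sup>2 * t ^ (n - 2) \<le> u\<^sup>2 * u ^ (n - 2)"
      using t \<open>t \<le> u\<close> by (intro mult_left_mono power_mono) auto
    then have "(u\<^sup>2 - t\<^sup>2) * t ^ (n - 2) \<le> u ^ n - t ^ n"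
      unfolding split[of u] split[of t] left_diff_distrib by linarith
    then show ?thesis by (simp add: sq)
  qed
  then have "w * (1/2 * t ^ (n - 2)) \<le> w * (u ^ n - t ^ n)" using \<open>0 < w\<close> by (intro mult_left_mono) auto
  moreover have "0 < w * t ^ (n - 2)" using \<open>0 < w\<close> t by simp
  ultimately show False using upper by simp
qed

text \<open>Negative powers of t can be replaced by powers of k only if t is bounded below in terms
  of k.\<close>

lemma k_le_power_level:
  assumes "1 \<le> n"
  obtains C where "0 < C" "\<And>t k. 1 \<le> t \<Longrightarrow> k < orthant_points {1..n} (\<lambda>_. 1) t \<Longrightarrow> real k \<le> C * t ^ n"
proof -
  obtain C where C: "0 \<le> C" "\<And>t. 1 \<le> t \<Longrightarrow>
    2 ^ n * real (orthant_points {1..n} (\<lambda>_. 1) t) \<le> unit_ball_vol (real n) * t ^ n + C * t ^ (n - 1)"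
    using orthant_points_cube_le[OF assms] by blast
  show thesis
  proof
    show "0 < unit_ball_vol (real n) + C" using C by (intro add_pos_nonneg) auto
    fix t :: real and k assume t: "1 \<le> t" and k: "k < orthant_points {1..n} (\<lambda>_. 1) t"
    have "real k \<le> 2 ^ n * real k" by (simp add: mult_le_cancel_right1)
    also have "\<dots> \<le> 2 ^ n * real (orthant_points {1..n} (\<lambda>_. 1) t)" using k by simp
    also have "\<dots> \<le> unit_ball_vol (real n) * t ^ n + C * t ^ (n - 1)" by (rule C(2)[OF t])
    also have "C * t ^ (n - 1) \<le> C * t ^ n" using t C by (intro mult_left_mono power_increasing) auto
    finally show "real k \<le> (unit_ball_vol (real n) + C) * t ^ n" by (simp add: algebra_simps)
  qed
qed

text \<open>The bound on the reciprocal sum meets its quadratic lower bound here, at the level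
  \<tau> k given by the cube. E and \<theta> stay free because the last estimate is used twice, for
  the rate and for convergence.\<close>

lemma maximisers_estimate:
  fixes a :: "nat \<Rightarrow> nat \<Rightarrow> real"
  assumes "2 \<le> n" "\<And>k. 1 \<le> k \<Longrightarrow> maximises_mu n k (a k)"
  obtains H C \<tau> where "1 \<le> H" "0 \<le> C" "filterlim \<tau> at_top sequentially"
    "\<And>k i. 1 \<le> k \<Longrightarrow> 1 \<le> \<tau> k \<Longrightarrow> i \<in> {1..n} \<Longrightarrow> 1 / H \<le> a k i \<and> a k i \<le> H"
    "\<And>k. 1 \<le> k \<Longrightarrow> 1 \<le> \<tau> k \<Longrightarrow> real k \<le> C * \<tau> k ^ n"
    "\<And>k T E \<theta>. \<lbrakk>1 \<le> k; 1 \<le> T; T < \<tau> k;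
      \<And>b s. \<lbrakk>\<And>i. i \<in> {1..n} \<Longrightarrow> 1 / H \<le> b i \<and> b i \<le> H; T \<le> s\<rbrakk> \<Longrightarrow>
        \<bar>real (lattice_points {1..n} b s) - unit_ball_vol (real n) * (\<Prod>i\<in>{1..n}. b i) * s ^ n\<bar> \<le> E * s powr \<theta>\<rbrakk>
     \<Longrightarrow> (a k n - 1)\<^sup>2 * \<tau> k ^ (n - 1) \<le> C * (E * \<tau> k powr \<theta> + \<tau> k ^ (n - 2))"
proof -
  have n1: "1 \<le> n" using assms by simp
  obtain H where H: "1 \<le> H" "\<And>b t k i. \<lbrakk>unit_cuboid n b; 1 \<le> t; k < orthant_points {1..n} (\<lambda>_. 1) t;
      \<And>s. 0 \<le> s \<Longrightarrow> s < t \<Longrightarrow> orthant_points {1..n} b s \<le> k; i \<in> {1..n}\<rbrakk> \<Longrightarrow> 1 / H \<le> b i \<and> b i \<le> H"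
    using maximiser_sides_bounded[OF assms(1)] by blast
  obtain C1 where C1: "0 \<le> C1" "\<And>b t k T E \<theta>. \<lbrakk>unit_cuboid n b; \<And>i. i \<in> {1..n} \<Longrightarrow> 1 / H \<le> b i \<and> b i \<le> H;
      1 \<le> T; T < t; k < orthant_points {1..n} (\<lambda>_. 1) t;
      \<And>s. 0 \<le> s \<Longrightarrow> s < t \<Longrightarrow> orthant_points {1..n} b s \<le> k;
      \<And>a s. \<lbrakk>\<And>i. i \<in> {1..n} \<Longrightarrow> 1 / H \<le> a i \<and> a i \<le> H; T \<le> s\<rbrakk> \<Longrightarrow>
        \<bar>real (lattice_points {1..n} a s) - unit_ball_vol (real n) * (\<Prod>i\<in>{1..n}. a i) * s ^ n\<bar> \<le> E * s powr \<theta>\<rbrakk>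
    \<Longrightarrow> unit_ball_vol (real (n - 1)) * ((\<Sum>i\<in>{1..n}. 1 / b i) - real n) * t ^ (n - 1)
          \<le> 2 * E * t powr \<theta> + C1 * t ^ (n - 2)"
    using reciprocal_sum_bound[OF assms(1) H(1)] by blast
  obtain C2 where C2: "0 < C2" "\<And>t k. 1 \<le> t \<Longrightarrow> k < orthant_points {1..n} (\<lambda>_. 1) t \<Longrightarrow> real k \<le> C2 * t ^ n"
    using k_le_power_level[OF n1] by blast
  have "\<exists>t. 0 \<le> t \<and> k < orthant_points {1..n} (\<lambda>_. 1) t \<and> (\<forall>s. 0 \<le> s \<longrightarrow> s < t \<longrightarrow> orthant_points {1..n} (a k) s \<le> k)" if "1 \<le> k" for k
    using maximiser_comparison[OF n1 assms(2)[OF that]] by metis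
  then obtain \<tau> where \<tau>: "\<And>k. 1 \<le> k \<Longrightarrow> 0 \<le> \<tau> k" "\<And>k. 1 \<le> k \<Longrightarrow> k < orthant_points {1..n} (\<lambda>_. 1) (\<tau> k)"
    "\<And>k s. 1 \<le> k \<Longrightarrow> 0 \<le> s \<Longrightarrow> s < \<tau> k \<Longrightarrow> orthant_points {1..n} (a k) s \<le> k" by metis
  have cub: "unit_cuboid n (a k)" if "1 \<le> k" for k using assms(2)[OF that] by (simp add: maximises_mu_def)
  \<comment> \<open>The cube's count at \<tau> k exceeds k, while it is bounded on bounded ranges of
    the radius.\<close>
  have lim: "filterlim \<tau> at_top sequentially"
    unfolding filterlim_at_top
  proof
    fix Z :: real
    show "\<forall>\<^sub>F k in sequentially. Z \<le> \<tau> k"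
      using eventually_ge_at_top[of "max 1 (orthant_points {1..n} (\<lambda>_. 1) \<bar>Z\<bar>)"]
    proof eventually_elim
      case (elim k)
      show ?case
      proof (rule ccontr)
        assume "\<not> Z \<le> \<tau> k"
        then have "orthant_points {1..n} (\<lambda>_. 1) (\<tau> k) \<le> orthant_points {1..n} (\<lambda>_. 1) \<bar>Z\<bar>"
          using \<tau>(1)[of k] elim by (intro orthant_points_mono) auto
        then show False using \<tau>(2)[of k] elim by auto
      qed
    qed
  qed
  define w where "w = unit_ball_vol (real (n - 1))"
  have "0 < w" by (simp add: w_def)
  have sides: "1 / H \<le> a k i \<and> a k i \<le> H" if "1 \<le> k" "1 \<le> \<tau> k" "i \<in> {1..n}" for k i
    using H(2)[OF cub[OF that(1)] that(2) \<tau>(2,3)[OF that(1)] that(3)] by blast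
  define C where "C = max C2 (2 * H\<^sup>2 / w * max 2 C1)"
  show thesis
  proof (rule that[OF H(1) _ lim sides])
    show "0 \<le> C" using C2 by (simp add: C_def)
    show "real k \<le> C * \<tau> k ^ n" if "1 \<le> k" "1 \<le> \<tau> k" for k
    proof -
      have "real k \<le> C2 * \<tau> k ^ n" using C2(2) \<tau>(2) that by blast
      also have "\<dots> \<le> C * \<tau> k ^ n" using that by (intro mult_right_mono) (auto simp: C_def)
      finally show ?thesis .
    qed
    fix k T E \<theta> assume k: "1 \<le> k" and T: "1 \<le> T" "T < \<tau> k" and
      err: "\<And>b s. \<lbrakk>\<And>i. i \<in> {1..n} \<Longrightarrow> 1 / H \<le> b i \<and> b i \<le> H; T \<le> s\<rbrakk> \<Longrightarrow>
        \<bar>real (lattice_points {1..n} b s) - unit_ball_vol (real n) * (\<Prod>i\<in>{1..n}. b i) * s ^ n\<bar> \<le> E * s powr \<theta>"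
    have sd: "1 / H \<le> a k i \<and> a k i \<le> H" if "i \<in> {1..n}" for i using sides[OF k _ that] T by simp
    \<comment> \<open>Nothing is assumed about the sign of E; the error bound applied to the cube
      supplies it.\<close>
    have "0 \<le> E * \<tau> k powr \<theta>"
      using err[of "\<lambda>_. 1" "\<tau> k"] T H(1) by (auto intro: order.trans[OF abs_ge_zero])
    have "w * ((a k n - 1)\<^sup>2 / (2 * H\<^sup>2)) * \<tau> k ^ (n - 1) \<le> w * ((\<Sum>i\<in>{1..n}. 1 / a k i) - real n) * \<tau> k ^ (n - 1)"
      using reciprocal_sum_excess[OF cub[OF k] n1, of H] sd[of n] n1 T \<open>0 < w\<close>
      by (intro mult_right_mono mult_left_mono) auto
    also have "\<dots> \<le> 2 * E * \<tau> k powr \<theta> + C1 * \<tau> k ^ (n - 2)"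
      unfolding w_def by (rule C1(2)[OF cub[OF k] sd T \<tau>(2)[OF k] \<tau>(3)[OF k] err])
    also have "\<dots> \<le> max 2 C1 * (E * \<tau> k powr \<theta>) + max 2 C1 * \<tau> k ^ (n - 2)"
      unfolding mult.assoc[of 2] using \<open>0 \<le> E * \<tau> k powr \<theta>\<close> T by (intro add_mono mult_right_mono) auto
    finally have main: "w * ((a k n - 1)\<^sup>2 / (2 * H\<^sup>2)) * \<tau> k ^ (n - 1) \<le> max 2 C1 * (E * \<tau> k powr \<theta> + \<tau> k ^ (n - 2))"
      by (simp only: distrib_left)
    have "(a k n - 1)\<^sup>2 * \<tau> k ^ (n - 1) = 2 * H\<^sup>2 / w * (w * ((a k n - 1)\<^sup>2 / (2 * H\<^sup>2)) * \<tau> k ^ (n - 1))"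
      using \<open>0 < w\<close> H(1) by simp
    also have "\<dots> \<le> 2 * H\<^sup>2 / w * (max 2 C1 * (E * \<tau> k powr \<theta> + \<tau> k ^ (n - 2)))"
      using \<open>0 < w\<close> by (intro mult_left_mono main) auto
    also have "\<dots> = 2 * H\<^sup>2 / w * max 2 C1 * (E * \<tau> k powr \<theta> + \<tau> k ^ (n - 2))" by (simp only: mult.assoc)
    also have "\<dots> \<le> C * (E * \<tau> k powr \<theta> + \<tau> k ^ (n - 2))"
      using \<open>0 \<le> E * \<tau> k powr \<theta>\<close> T by (intro mult_right_mono) (auto simp: C_def)
    finally show "(a k n - 1)\<^sup>2 * \<tau> k ^ (n - 1) \<le> C * (E * \<tau> k powr \<theta> + \<tau> k ^ (n - 2))" .
  qed
qed

theorem theorem1p2: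
  fixes n :: nat and a :: "nat \<Rightarrow> nat \<Rightarrow> real"
  assumes "n \<ge> 2"
    and "\<And>k. k \<ge> 1 \<Longrightarrow> maximises_mu n k (a k)"
  shows "(\<forall>\<theta>. admissible_exponent n \<theta> \<longrightarrow>
            (\<lambda>k. a k n - 1) \<in> O(\<lambda>k. real k powr ((\<theta> - (real n - 1)) / (2 * real n)))) \<and>
         (\<forall>i\<in>{1..n}. (\<lambda>k. a k i) \<longlonglongrightarrow> 1)"
proof -
  have n1: "1 \<le> n" using assms(1) by simp
  obtain H C \<tau> where H: "1 \<le> H" and C: "0 \<le> C" and lim: "filterlim \<tau> at_top sequentially"
    and sides: "\<And>k i. 1 \<le> k \<Longrightarrow> 1 \<le> \<tau> k \<Longrightarrow> i \<in> {1..n} \<Longrightarrow> 1 / H \<le> a k i \<and> a k i \<le> H"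
    and level: "\<And>k. 1 \<le> k \<Longrightarrow> 1 \<le> \<tau> k \<Longrightarrow> real k \<le> C * \<tau> k ^ n"
    and est: "\<And>k T E \<theta>. \<lbrakk>1 \<le> k; 1 \<le> T; T < \<tau> k;
      \<And>b s. \<lbrakk>\<And>i. i \<in> {1..n} \<Longrightarrow> 1 / H \<le> b i \<and> b i \<le> H; T \<le> s\<rbrakk> \<Longrightarrow>
        \<bar>real (lattice_points {1..n} b s) - unit_ball_vol (real n) * (\<Prod>i\<in>{1..n}. b i) * s ^ n\<bar> \<le> E * s powr \<theta>\<rbrakk>
     \<Longrightarrow> (a k n - 1)\<^sup>2 * \<tau> k ^ (n - 1) \<le> C * (E * \<tau> k powr \<theta> + \<tau> k ^ (n - 2))"
    using maximisers_estimate[OF assms] by blast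
  have cub: "unit_cuboid n (a k)" if "1 \<le> k" for k
    using assms(2)[OF that] by (simp add: maximises_mu_def)
  have an1: "1 \<le> a k n" if "1 \<le> k" for k
    using unit_cuboid_sides(6)[OF cub[OF that] n1, of n] n1 by simp
  have ev: "\<forall>\<^sub>F k in sequentially. T < \<tau> k \<and> 1 \<le> k" for T
    using eventually_conj[OF filterlim_at_top_dense[THEN iffD1, OF lim, rule_format, of T] eventually_ge_at_top[of 1]] .
  have rate: "(\<lambda>k. a k n - 1) \<in> O(\<lambda>k. real k powr ((\<theta> - (real n - 1)) / (2 * real n)))"
    if adm: "admissible_exponent n \<theta>" for \<theta>
  \<comment> \<open>If \<theta> \<ge> n - 1, the comparison function is at least 1 and boundedness
    of the sides suffices.\<close>
  proof (cases "real n - 1 \<le> \<theta>")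
    case True
    show ?thesis
    proof (rule bigoI[where c = H])
      show "\<forall>\<^sub>F k in sequentially. norm (a k n - 1) \<le> H * norm (real k powr ((\<theta> - (real n - 1)) / (2 * real n)))"
        using ev[of 1]
      proof eventually_elim
        case (elim k)
        have "1 \<le> real k powr ((\<theta> - (real n - 1)) / (2 * real n))"
          using elim True by (intro ge_one_powr_ge_zero) auto
        then have "H * 1 \<le> H * real k powr ((\<theta> - (real n - 1)) / (2 * real n))"
          using H by (intro mult_left_mono) auto
        moreover have "norm (a k n - 1) \<le> H * 1"
          using an1[of k] sides[of k n] elim n1 by auto
        ultimately show ?case by simp
      qed
    qed
  next
    case False
    define \<beta> where "\<beta> = \<theta> - (real n - 1)"
    have "\<beta> < 0" using False by (simp add: \<beta>_def)
    \<comment> \<open>Allows the hyperplane error \<open>\<tau> k ^ (n - 2)\<close> to be absorbed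
      into \<open>\<tau> k powr \<theta>\<close>.\<close>
    have ge: "real n - 2 \<le> \<theta>" by (rule admissible_exponent_ge[OF assms(1) adm])
    have "compact {1 / H..H}" "{1 / H..H} \<subseteq> {0<..}" using H by (auto intro: less_le_trans[of 0 "1 / H"])
    then obtain E where "\<forall>\<^sub>F t in at_top. \<forall>b. (\<forall>i\<in>{1..n}. b i \<in> {1 / H..H}) \<longrightarrow>
        \<bar>real (lattice_count n b t) - unit_ball_vol (real n) * t ^ n * (\<Prod>i=1..n. b i)\<bar> \<le> E * t powr \<theta>"
      using adm unfolding admissible_exponent_def by blast
    then obtain T0 where T0: "\<And>t b. T0 \<le> t \<Longrightarrow> (\<forall>i\<in>{1..n}. b i \<in> {1 / H..H}) \<Longrightarrow>
        \<bar>real (lattice_count n b t) - unit_ball_vol (real n) * t ^ n * (\<Prod>i=1..n. b i)\<bar> \<le> E * t powr \<theta>"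
      unfolding eventually_at_top_linorder by blast
    define T where "T = max 1 T0"
    define D where "D = C * (\<bar>E\<bar> + 1)"
    have D: "0 \<le> D" using C by (simp add: D_def)
    have quad: "(a k n - 1)\<^sup>2 \<le> D * (\<tau> k powr \<beta>)" if k: "1 \<le> k" and t: "T < \<tau> k" for k
    proof -
      have t1: "1 \<le> \<tau> k" "0 < \<tau> k" using t by (auto simp: T_def)
      have "(a k n - 1)\<^sup>2 * \<tau> k ^ (n - 1) \<le> C * (E * \<tau> k powr \<theta> + \<tau> k ^ (n - 2))"
      proof (rule est[OF k _ t])
        show "1 \<le> T" by (simp add: T_def)
        fix b s assume b: "\<And>i. i \<in> {1..n} \<Longrightarrow> 1 / H \<le> b i \<and> b i \<le> H" and s: "T \<le> s"
        show "\<bar>real (lattice_points {1..n} b s) - unit_ball_vol (real n) * (\<Prod>i\<in>{1..n}. b i) * s ^ n\<bar> \<le> E * s powr \<theta>"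
          using T0[of s b] b s unfolding lattice_count_eq_lat by (auto simp: T_def mult_ac)
      qed
      also have "\<dots> \<le> C * (\<bar>E\<bar> * \<tau> k powr \<theta> + \<tau> k powr \<theta>)"
      proof (intro mult_left_mono add_mono mult_right_mono)
        have "\<tau> k ^ (n - 2) = \<tau> k powr (real n - 2)"
          using t1 assms(1) by (simp add: powr_realpow[symmetric] of_nat_diff)
        also have "\<dots> \<le> \<tau> k powr \<theta>" using t1 ge by (intro powr_mono) auto
        finally show "\<tau> k ^ (n - 2) \<le> \<tau> k powr \<theta>" .
      qed (use C in auto)
      also have "\<dots> = D * \<tau> k powr \<theta>" by (simp add: D_def algebra_simps)
      also have "\<tau> k powr \<theta> = \<tau> k powr \<beta> * \<tau> k ^ (n - 1)"
        using t1 n1 by (simp add: \<beta>_def powr_realpow[symmetric] of_nat_diff powr_add[symmetric])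
      finally have "(a k n - 1)\<^sup>2 * \<tau> k ^ (n - 1) \<le> D * \<tau> k powr \<beta> * \<tau> k ^ (n - 1)" by (simp only: mult.assoc)
      then show ?thesis by (rule mult_right_le_imp_le) (use t1 in auto)
    qed
    define c where "c = sqrt (D * (C + 1) powr (- (\<beta> / real n)))"
    show ?thesis
    proof (rule bigoI[where c = c])
      show "\<forall>\<^sub>F k in sequentially. norm (a k n - 1) \<le> c * norm (real k powr ((\<theta> - (real n - 1)) / (2 * real n)))"
        using ev[of T]
      proof eventually_elim
        case (elim k)
        have k: "1 \<le> k" "1 \<le> \<tau> k" "0 < \<tau> k" using elim by (auto simp: T_def)
        have "real k \<le> C * \<tau> k ^ n" using level k by blast
        \<comment> \<open>C may be 0, and the next step divides by the constant.\<close>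
        also have "\<dots> \<le> (C + 1) * \<tau> k ^ n" using k by (intro mult_right_mono) auto
        finally have lev: "real k / (C + 1) \<le> \<tau> k ^ n" using C by (simp add: field_simps)
        have "\<tau> k powr \<beta> = (\<tau> k ^ n) powr (\<beta> / real n)"
          using k n1 by (simp add: powr_realpow[symmetric] powr_powr)
        \<comment> \<open>\<beta> is negative, so a lower bound on \<open>\<tau> k ^ n\<close> turns
          into an upper bound.\<close>
        also have "\<dots> \<le> (real k / (C + 1)) powr (\<beta> / real n)"
          using lev \<open>\<beta> < 0\<close> k C n1 by (intro powr_mono2') (auto simp: divide_le_0_iff)
        also have "\<dots> = real k powr (\<beta> / real n) * (C + 1) powr (- (\<beta> / real n))"
          using k C by (simp add: powr_divide powr_minus_divide)
        finally have "D * \<tau> k powr \<beta> \<le> D * (real k powr (\<beta> / real n) * (C + 1) powr (- (\<beta> / real n)))"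
          using D by (rule mult_left_mono)
        then have "(a k n - 1)\<^sup>2 \<le> D * (C + 1) powr (- (\<beta> / real n)) * real k powr (\<beta> / real n)"
          using quad[of k] elim by (simp add: mult_ac)
        then have "\<bar>a k n - 1\<bar> \<le> sqrt (D * (C + 1) powr (- (\<beta> / real n)) * real k powr (\<beta> / real n))"
          by (rule real_le_rsqrt[of "\<bar>a k n - 1\<bar>", simplified])
        also have "\<dots> = c * real k powr (\<beta> / (2 * real n))"
          using k by (simp add: c_def real_sqrt_mult powr_half_sqrt[symmetric] powr_powr mult.commute)
        finally show ?case by (simp add: \<beta>_def)
      qed
    qed
  qed
  have conv_n: "(\<lambda>k. a k n) \<longlonglongrightarrow> 1"
  proof (rule tendstoI)
    fix \<delta> :: real assume \<delta>: "0 < \<delta>"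
    \<comment> \<open>Ensures \<open>2 * C * \<epsilon> < \<delta>\<^sup>2\<close>. One
      \<open>C * \<epsilon>\<close> comes from the lattice error, the other from
      \<open>\<tau> k ^ (n - 2) \<le> \<epsilon> * \<tau> k ^ (n - 1)\<close>, which holds once
      \<tau> k \<ge> 1 / \<epsilon>.\<close>
    define \<epsilon> where "\<epsilon> = \<delta>\<^sup>2 / (4 * (C + 1))"
    have \<epsilon>: "0 < \<epsilon>" using \<delta> C by (simp add: \<epsilon>_def)
    obtain T0 where T0: "0 < T0" "\<And>t b. \<lbrakk>T0 \<le> t; \<And>i. i \<in> {1..n} \<Longrightarrow> 1 / H \<le> b i \<and> b i \<le> H\<rbrakk> \<Longrightarrow>
       \<bar>real (lattice_points {1..n} b t) - unit_ball_vol (real n) * (\<Prod>i\<in>{1..n}. b i) * t ^ n\<bar> \<le> \<epsilon> * t ^ (n - 1)"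
    proof -
      have "1 / H \<le> H" using H by (intro order.trans[of "1 / H" 1 H]) auto
      then show thesis
        using lattice_points_little_o[of "{1..n}" "1 / H" H \<epsilon>] assms(1) H \<epsilon> that by (simp del: One_nat_def) blast
    qed
    define T where "T = max (max 1 T0) (1 / \<epsilon>)"
    show "\<forall>\<^sub>F k in sequentially. dist (a k n) 1 < \<delta>"
      using ev[of T]
    proof eventually_elim
      case (elim k)
      have t: "1 \<le> T" "1 / \<epsilon> \<le> \<tau> k" "0 < \<tau> k" using elim by (auto simp: T_def)
      have pw: "s powr real (n - 1) = s ^ (n - 1)" if "0 < s" for s :: real using that by (simp add: powr_realpow)
      have "(a k n - 1)\<^sup>2 * \<tau> k ^ (n - 1) \<le> C * (\<epsilon> * \<tau> k powr real (n - 1) + \<tau> k ^ (n - 2))"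
      proof (rule est[of k T])
        fix b s assume b: "\<And>i. i \<in> {1..n} \<Longrightarrow> 1 / H \<le> b i \<and> b i \<le> H" and s: "T \<le> s"
        then have "T0 \<le> s" "0 < s" using T0(1) by (auto simp: T_def)
        then show "\<bar>real (lattice_points {1..n} b s) - unit_ball_vol (real n) * (\<Prod>i\<in>{1..n}. b i) * s ^ n\<bar> \<le> \<epsilon> * s powr real (n - 1)"
          unfolding pw[OF \<open>0 < s\<close>] using b by (intro T0(2))
      qed (use elim t in auto)
      also have "\<dots> \<le> C * (\<epsilon> * \<tau> k ^ (n - 1) + \<epsilon> * \<tau> k ^ (n - 1))"
      proof (rule mult_left_mono[OF add_mono C])
        show "\<epsilon> * \<tau> k powr real (n - 1) \<le> \<epsilon> * \<tau> k ^ (n - 1)" using pw[OF t(3)] by simp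
        have "1 \<le> \<epsilon> * \<tau> k" using t(2) \<epsilon> by (simp add: field_simps)
        then have "1 * \<tau> k ^ (n - 2) \<le> \<epsilon> * \<tau> k * \<tau> k ^ (n - 2)" using t by (intro mult_right_mono) auto
        also have "\<dots> = \<epsilon> * (\<tau> k * \<tau> k ^ (n - 2))" by simp
        also have "\<tau> k * \<tau> k ^ (n - 2) = \<tau> k ^ (n - 1)" using assms(1) by (simp add: power_Suc[symmetric] Suc_diff_Suc numeral_2_eq_2 del: power_Suc)
        finally show "\<tau> k ^ (n - 2) \<le> \<epsilon> * \<tau> k ^ (n - 1)" by simp
      qed
      also have "\<dots> = 2 * C * \<epsilon> * \<tau> k ^ (n - 1)" by simp
      finally have "(a k n - 1)\<^sup>2 \<le> 2 * C * \<epsilon>" by (rule mult_right_le_imp_le) (use t in auto)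
      also have "\<dots> < \<delta>\<^sup>2"
      proof -
        have "2 * C * \<epsilon> = \<delta>\<^sup>2 * (2 * C / (4 * (C + 1)))" by (simp add: \<epsilon>_def)
        also have "\<dots> < \<delta>\<^sup>2 * 1" using \<delta> C by (intro mult_strict_left_mono) auto
        finally show ?thesis by simp
      qed
      finally have "\<bar>a k n - 1\<bar> < \<delta>" using \<delta> by (metis abs_le_square_iff abs_of_pos not_le)
      then show ?case by (simp add: dist_real_def)
    qed
  qed
  have "(\<lambda>k. a k i) \<longlonglongrightarrow> 1" if i: "i \<in> {1..n}" for i
  \<comment> \<open>The product 1 keeps the shortest side at least
    \<open>1 / a k n ^ (n - 1)\<close>, so the longest side controls all the others.\<close>
  proof (rule tendsto_sandwich[OF _ _ _ conv_n])
    have "(\<lambda>k. 1 / a k n ^ (n - 1)) \<longlonglongrightarrow> 1 / 1 ^ (n - 1)"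
      by (intro tendsto_intros conv_n) auto
    then show "(\<lambda>k. 1 / a k n ^ (n - 1)) \<longlonglongrightarrow> 1" by simp
    show "\<forall>\<^sub>F k in sequentially. 1 / a k n ^ (n - 1) \<le> a k i"
      using eventually_ge_at_top[of 1]
    proof eventually_elim
      case (elim k)
      have "1 / a k n ^ (n - 1) \<le> a k 1"
        using unit_cuboid_sides(4)[OF cub[OF elim] n1 i] an1[OF elim] by (simp add: divide_le_eq)
      then show ?case using unit_cuboid_sides(2)[OF cub[OF elim] n1 i] by linarith
    qed
    show "\<forall>\<^sub>F k in sequentially. a k i \<le> a k n"
      using eventually_ge_at_top[of 1] by eventually_elim (use unit_cuboid_sides(3)[OF cub n1 i] in auto)
  qed
  with rate show ?thesis by blast
qed

end
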